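(* Let $n\ge 1$ and let $(M^{2n+1},\phi,\xi,\eta,g)$ be a Kenmotsu manifold of dimension $2n+1$. Suppose that $g$ represents a $*$-conformal $\eta$-Ricci soliton, i.e. there exist a smooth vector field $V$ on $M$ and real constants $\lambda,\mu,p$ such that $$\mathcal{L}_Vg+2S^*+\Big[2\lambda-\Big(p+\frac{2}{2n+1}\Big)\Big]g+2\mu\,\eta\otimes\eta=0,$$ where $S^*$ is the $*$-Ricci tensor of $M$. Suppose moreover that $V$ is a contact vector field, i.e. there is a smooth function $f$ on $M$ with $\mathcal{L}_V\xi=f\xi$. Then $V$ is a strict infinitesimal contact transformation, i.e. $\mathcal{L}_V\eta=0$, and $(M,g)$ is Einstein, i.e. its Ricci tensor satisfies $S=a\,g$ for some constant $a$.
   Context: An almost contact metric manifold $(M^{2n+1},\phi,\xi,\eta,g)$ is a smooth $(2n+1)$-dimensional manifold with a $(1,1)$-tensor field $\phi$, a vector field $\xi$ (the characteristic or Reeb vector field), a 1-form $\eta$ and a Riemannian metric $g$ satisfying $\phi^2=-I+\eta\otimes\xi$, $\eta(\xi)=1$ and $g(\phi X,\phi Y)=g(X,Y)-\eta(X)\eta(Y)$ for all vector fields $X,Y$ (consequently $\phi\xi=0$, $\eta\circ\phi=0$, $\eta(X)=g(X,\xi)$, $g(\phi X,Y)=-g(X,\phi Y)$). It is a Kenmotsu manifold if, with $\nabla$ the Levi-Civita connection of $g$, $(\nabla_X\phi)Y=g(\phi X,Y)\xi-\eta(Y)\phi X$ for all vector fields $X,Y$. $R$ denotes the Riemann curvature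 tensor, $R(X,Y)Z=\nabla_X\nabla_YZ-\nabla_Y\nabla_XZ-\nabla_{[X,Y]}Z$, $S$ the Ricci tensor, and $\mathcal{L}$ the Lie derivative. The $*$-Ricci tensor is $S^*(X,Y)=\frac12\operatorname{trace}\{Z\mapsto\phi(R(X,\phi Y)Z)\}$. *)

theory Defs
  imports "HOL-Analysis.Analysis" "HOL-Library.Function_Algebras"
begin

section \<open>Linear algebra\<close>

text \<open>
  Tangent vectors are functionals on functions, so function spaces are made real vector spaces
  with the pointwise operations (addition is the pointwise one of Function_Algebras).
\<close>

instantiation "fun" :: (type, real_vector) real_vector
begin

definition scaleR_fun :: "real \<Rightarrow> ('a \<Rightarrow> 'b) \<Rightarrow> 'a \<Rightarrow> 'b" where
  "scaleR_fun c f = (\<lambda>x. c *\<^sub>R f x)"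

instance
  by standard (simp_all add: scaleR_fun_def fun_eq_iff scaleR_add_right scaleR_add_left)

end

text \<open>
  Trace of an endomorphism of a finite-dimensional subspace \<open>W\<close>, computed in some basis.
\<close>

definition trace_on :: "'v::real_vector set \<Rightarrow> ('v \<Rightarrow> 'v) \<Rightarrow> real" where
  "trace_on W L =
     (let B = (SOME B. B \<subseteq> W \<and> independent B \<and> W \<subseteq> span B)
      in \<Sum>b\<in>B. representation B (L b) b)"


section \<open>Smooth manifolds\<close>

text \<open>
  \<open>Ck_on k U f\<close> is used for open \<open>U\<close> only: all iterated directional derivatives of order at
  most \<open>k\<close> exist as Frechet derivatives and are continuous on \<open>U\<close>.
\<close>

primrec Ck_on ::
  "nat \<Rightarrow> 'b::euclidean_space set \<Rightarrow> ('b \<Rightarrow> 'c::real_normed_vector) \<Rightarrow> bool" where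
  "Ck_on 0 U f \<longleftrightarrow> continuous_on U f"
| "Ck_on (Suc k) U f \<longleftrightarrow>
     (\<forall>x\<in>U. f differentiable (at x)) \<and>
     (\<forall>v. Ck_on k U (\<lambda>x. frechet_derivative f (at x) v))"

definition smooth_on ::
  "'b::euclidean_space set \<Rightarrow> ('b \<Rightarrow> 'c::real_normed_vector) \<Rightarrow> bool" where
  "smooth_on U f \<longleftrightarrow> (\<forall>k. Ck_on k U f)"

text \<open>
  A chart is a pair of a domain and a coordinate map, whose values off the domain are irrelevant.
\<close>

type_synonym ('a, 'b) chart = "'a set \<times> ('a \<Rightarrow> 'b)"

definition is_chart :: "('a::topological_space, 'b::euclidean_space) chart \<Rightarrow> bool" where
  "is_chart c \<longleftrightarrow> (case c of (U, x) \<Rightarrow>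
     open U \<and> open (x ` U) \<and> inj_on x U \<and> homeomorphism U (x ` U) x (inv_into U x))"

text \<open>
  The manifold is the whole type \<open>'a\<close>, Hausdorff and second countable, of dimension
  \<open>DIM('b)\<close>. The atlas need not be maximal, and the manifold need not be connected.
\<close>

definition smooth_atlas ::
  "('a::{t2_space, second_countable_topology}, 'b::euclidean_space) chart set \<Rightarrow> bool" where
  "smooth_atlas A \<longleftrightarrow>
     (\<forall>c\<in>A. is_chart c) \<and> (\<Union>(fst ` A) = UNIV) \<and>
     (\<forall>(U, x)\<in>A. \<forall>(V, y)\<in>A. smooth_on (x ` (U \<inter> V)) (y \<circ> inv_into U x))"

definition smooth_functions ::
  "('a, 'b::euclidean_space) chart set \<Rightarrow> ('a \<Rightarrow> real) set" where
  "smooth_functions A = {f. \<forall>(U, x)\<in>A. smooth_on (x ` U) (f \<circ> inv_into U x)}"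

text \<open>
  Tangent vectors at a point are the derivations of the algebra of smooth functions at that
  point. They are set to 0 on non-smooth functions, so that equality of tangent vectors is HOL
  equality.
\<close>

type_synonym 'a tangent_vector = "('a \<Rightarrow> real) \<Rightarrow> real"

definition tangent_space ::
  "('a, 'b::euclidean_space) chart set \<Rightarrow> 'a \<Rightarrow> 'a tangent_vector set" where
  "tangent_space A q = {v.
     (\<forall>f\<in>smooth_functions A. \<forall>h\<in>smooth_functions A.
        v (\<lambda>r. f r + h r) = v f + v h \<and>
        v (\<lambda>r. f r * h r) = f q * v h + h q * v f) \<and>
     (\<forall>c. \<forall>f\<in>smooth_functions A. v (\<lambda>r. c * f r) = c * v f) \<and>
     (\<forall>f. f \<notin> smooth_functions A \<longrightarrow> v f = 0)}"

type_synonym 'a vector_field = "'a \<Rightarrow> 'a tangent_vector"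

definition vector_fields ::
  "('a, 'b::euclidean_space) chart set \<Rightarrow> 'a vector_field set" where
  "vector_fields A = {X. (\<forall>q. X q \<in> tangent_space A q) \<and>
     (\<forall>f\<in>smooth_functions A. (\<lambda>q. X q f) \<in> smooth_functions A)}"

definition fun_scale ::
  "('a \<Rightarrow> real) \<Rightarrow> ('a \<Rightarrow> 'v::real_vector) \<Rightarrow> 'a \<Rightarrow> 'v" (infixr "\<cdot>\<^sub>F" 75) where
  "f \<cdot>\<^sub>F X = (\<lambda>q. f q *\<^sub>R X q)"

definition apply_field :: "'a vector_field \<Rightarrow> ('a \<Rightarrow> real) \<Rightarrow> 'a \<Rightarrow> real" where
  "apply_field X f = (\<lambda>q. X q f)"

definition lie_bracket :: "'a vector_field \<Rightarrow> 'a vector_field \<Rightarrow> 'a vector_field" where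
  "lie_bracket X Y = (\<lambda>q f. X q (apply_field Y f) - Y q (apply_field X f))"


section \<open>Tensor fields\<close>

text \<open>
  Tensor fields are maps on smooth vector fields that are linear over the smooth functions.
\<close>

definition function_linear ::
  "('a, 'b::euclidean_space) chart set \<Rightarrow> ('a vector_field \<Rightarrow> 'a \<Rightarrow> 'v::real_vector) \<Rightarrow> bool"
where
  "function_linear A L \<longleftrightarrow>
     (\<forall>X\<in>vector_fields A. \<forall>Y\<in>vector_fields A. L (X + Y) = L X + L Y) \<and>
     (\<forall>f\<in>smooth_functions A. \<forall>X\<in>vector_fields A. L (f \<cdot>\<^sub>F X) = f \<cdot>\<^sub>F L X)"

definition endomorphism_field ::
  "('a, 'b::euclidean_space) chart set \<Rightarrow> ('a vector_field \<Rightarrow> 'a vector_field) \<Rightarrow> bool" where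
  "endomorphism_field A \<phi> \<longleftrightarrow>
     (\<forall>X\<in>vector_fields A. \<phi> X \<in> vector_fields A) \<and> function_linear A \<phi>"

definition one_form ::
  "('a, 'b::euclidean_space) chart set \<Rightarrow> ('a vector_field \<Rightarrow> 'a \<Rightarrow> real) \<Rightarrow> bool" where
  "one_form A \<eta> \<longleftrightarrow>
     (\<forall>X\<in>vector_fields A. \<eta> X \<in> smooth_functions A) \<and> function_linear A \<eta>"

type_synonym 'a bilinear_field = "'a vector_field \<Rightarrow> 'a vector_field \<Rightarrow> 'a \<Rightarrow> real"

definition riemannian_metric ::
  "('a, 'b::euclidean_space) chart set \<Rightarrow> 'a bilinear_field \<Rightarrow> bool" where
  "riemannian_metric A g \<longleftrightarrow>
     (\<forall>X\<in>vector_fields A. one_form A (g X)) \<and>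
     (\<forall>X\<in>vector_fields A. \<forall>Y\<in>vector_fields A. g X Y = g Y X) \<and>
     (\<forall>X\<in>vector_fields A. \<forall>q. X q \<noteq> 0 \<longrightarrow> g X X q > 0)"

text \<open>
  Being linear over the smooth functions, an endomorphism field \<open>L\<close> induces an endomorphism of
  each tangent space: extend a tangent vector to any vector field, apply \<open>L\<close>, and evaluate.
\<close>

definition endomorphism_at ::
  "('a, 'b::euclidean_space) chart set \<Rightarrow> ('a vector_field \<Rightarrow> 'a vector_field) \<Rightarrow> 'a \<Rightarrow>
     'a tangent_vector \<Rightarrow> 'a tangent_vector" where
  "endomorphism_at A L q v = L (SOME X. X \<in> vector_fields A \<and> X q = v) q"

definition trace_field ::
  "('a, 'b::euclidean_space) chart set \<Rightarrow> ('a vector_field \<Rightarrow> 'a vector_field) \<Rightarrow> 'a \<Rightarrow> real"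
where
  "trace_field A L q = trace_on (tangent_space A q) (endomorphism_at A L q)"

definition lie_derivative_one_form ::
  "'a vector_field \<Rightarrow> ('a vector_field \<Rightarrow> 'a \<Rightarrow> real) \<Rightarrow> 'a vector_field \<Rightarrow> 'a \<Rightarrow> real" where
  "lie_derivative_one_form V \<eta> X = apply_field V (\<eta> X) - \<eta> (lie_bracket V X)"

definition lie_derivative_bilinear ::
  "'a vector_field \<Rightarrow> 'a bilinear_field \<Rightarrow> 'a bilinear_field" where
  "lie_derivative_bilinear V g X Y =
     apply_field V (g X Y) - g (lie_bracket V X) Y - g X (lie_bracket V Y)"


section \<open>Levi-Civita connection and curvature\<close>

type_synonym 'a connection = "'a vector_field \<Rightarrow> 'a vector_field \<Rightarrow> 'a vector_field"

definition affine_connection ::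
  "('a, 'b::euclidean_space) chart set \<Rightarrow> 'a connection \<Rightarrow> bool" where
  "affine_connection A D \<longleftrightarrow>
     (\<forall>Y\<in>vector_fields A. endomorphism_field A (\<lambda>X. D X Y)) \<and>
     (\<forall>X\<in>vector_fields A. \<forall>Y\<in>vector_fields A. \<forall>Z\<in>vector_fields A.
        D X (Y + Z) = D X Y + D X Z) \<and>
     (\<forall>f\<in>smooth_functions A. \<forall>X\<in>vector_fields A. \<forall>Y\<in>vector_fields A.
        D X (f \<cdot>\<^sub>F Y) = apply_field X f \<cdot>\<^sub>F Y + f \<cdot>\<^sub>F D X Y)"

definition levi_civita ::
  "('a, 'b::euclidean_space) chart set \<Rightarrow> 'a bilinear_field \<Rightarrow> 'a connection \<Rightarrow> bool" where
  "levi_civita A g D \<longleftrightarrow>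
     affine_connection A D \<and>
     (\<forall>X\<in>vector_fields A. \<forall>Y\<in>vector_fields A. D X Y - D Y X = lie_bracket X Y) \<and>
     (\<forall>X\<in>vector_fields A. \<forall>Y\<in>vector_fields A. \<forall>Z\<in>vector_fields A.
        apply_field X (g Y Z) = g (D X Y) Z + g Y (D X Z))"

definition curvature ::
  "'a connection \<Rightarrow> 'a vector_field \<Rightarrow> 'a vector_field \<Rightarrow> 'a vector_field \<Rightarrow> 'a vector_field" where
  "curvature D X Y Z = D X (D Y Z) - D Y (D X Z) - D (lie_bracket X Y) Z"

definition ricci ::
  "('a, 'b::euclidean_space) chart set \<Rightarrow> 'a connection \<Rightarrow> 'a bilinear_field" where
  "ricci A D X Y = trace_field A (\<lambda>Z. curvature D Z X Y)"

definition star_ricci ::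
  "('a, 'b::euclidean_space) chart set \<Rightarrow> 'a connection \<Rightarrow> ('a vector_field \<Rightarrow> 'a vector_field) \<Rightarrow>
     'a bilinear_field" where
  "star_ricci A D \<phi> X Y = (\<lambda>q. 1/2 * trace_field A (\<lambda>Z. \<phi> (curvature D X (\<phi> Y) Z)) q)"

definition einstein ::
  "('a, 'b::euclidean_space) chart set \<Rightarrow> 'a bilinear_field \<Rightarrow> 'a connection \<Rightarrow> bool" where
  "einstein A g D \<longleftrightarrow>
     (\<exists>a::real. \<forall>X\<in>vector_fields A. \<forall>Y\<in>vector_fields A. \<forall>q. ricci A D X Y q = a * g X Y q)"


section \<open>Kenmotsu manifolds and solitons\<close>

definition almost_contact_metric ::
  "('a::{t2_space, second_countable_topology}, 'b::euclidean_space) chart set \<Rightarrow>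
     ('a vector_field \<Rightarrow> 'a vector_field) \<Rightarrow> 'a vector_field \<Rightarrow>
     ('a vector_field \<Rightarrow> 'a \<Rightarrow> real) \<Rightarrow> 'a bilinear_field \<Rightarrow> bool" where
  "almost_contact_metric A \<phi> \<xi> \<eta> g \<longleftrightarrow>
     smooth_atlas A \<and> endomorphism_field A \<phi> \<and> \<xi> \<in> vector_fields A \<and> one_form A \<eta> \<and>
     riemannian_metric A g \<and>
     (\<forall>X\<in>vector_fields A. \<phi> (\<phi> X) = - X + \<eta> X \<cdot>\<^sub>F \<xi>) \<and>
     (\<forall>q. \<eta> \<xi> q = 1) \<and>
     (\<forall>X\<in>vector_fields A. \<forall>Y\<in>vector_fields A. \<forall>q.
        g (\<phi> X) (\<phi> Y) q = g X Y q - \<eta> X q * \<eta> Y q)"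

text \<open>
  The connection \<open>D\<close> is the (unique) Levi-Civita connection of \<open>g\<close>; the left-hand side of the
  last equation is \<open>(D\<^sub>X \<phi>) Y\<close>.
\<close>

definition kenmotsu ::
  "('a::{t2_space, second_countable_topology}, 'b::euclidean_space) chart set \<Rightarrow>
     ('a vector_field \<Rightarrow> 'a vector_field) \<Rightarrow> 'a vector_field \<Rightarrow>
     ('a vector_field \<Rightarrow> 'a \<Rightarrow> real) \<Rightarrow> 'a bilinear_field \<Rightarrow> 'a connection \<Rightarrow> bool" where
  "kenmotsu A \<phi> \<xi> \<eta> g D \<longleftrightarrow>
     almost_contact_metric A \<phi> \<xi> \<eta> g \<and> levi_civita A g D \<and>
     (\<forall>X\<in>vector_fields A. \<forall>Y\<in>vector_fields A.
        D X (\<phi> Y) - \<phi> (D X Y) = g (\<phi> X) Y \<cdot>\<^sub>F \<xi> - \<eta> Y \<cdot>\<^sub>F \<phi> X)"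

text \<open>The dimension \<open>2n+1\<close> of the manifold enters the soliton equation as \<open>DIM('b)\<close>.\<close>

definition star_conformal_eta_ricci_soliton ::
  "('a, 'b::euclidean_space) chart set \<Rightarrow> ('a vector_field \<Rightarrow> 'a vector_field) \<Rightarrow>
     ('a vector_field \<Rightarrow> 'a \<Rightarrow> real) \<Rightarrow> 'a bilinear_field \<Rightarrow> 'a connection \<Rightarrow>
     'a vector_field \<Rightarrow> real \<Rightarrow> real \<Rightarrow> real \<Rightarrow> bool" where
  "star_conformal_eta_ricci_soliton A \<phi> \<eta> g D V l \<mu> p \<longleftrightarrow>
     V \<in> vector_fields A \<and>
     (\<forall>X\<in>vector_fields A. \<forall>Y\<in>vector_fields A. \<forall>q.
        lie_derivative_bilinear V g X Y q + 2 * star_ricci A D \<phi> X Y q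
        + (2 * l - (p + 2 / real DIM('b))) * g X Y q + 2 * \<mu> * (\<eta> X q * \<eta> Y q) = 0)"

definition contact_vector_field ::
  "('a, 'b::euclidean_space) chart set \<Rightarrow> 'a vector_field \<Rightarrow> 'a vector_field \<Rightarrow> bool" where
  "contact_vector_field A \<xi> V \<longleftrightarrow>
     V \<in> vector_fields A \<and> (\<exists>f\<in>smooth_functions A. lie_bracket V \<xi> = f \<cdot>\<^sub>F \<xi>)"

definition strict_infinitesimal_contact ::
  "('a, 'b::euclidean_space) chart set \<Rightarrow> ('a vector_field \<Rightarrow> 'a \<Rightarrow> real) \<Rightarrow> 'a vector_field \<Rightarrow> bool"
where
  "strict_infinitesimal_contact A \<eta> V \<longleftrightarrow>
     V \<in> vector_fields A \<and> (\<forall>X\<in>vector_fields A. \<forall>q. lie_derivative_one_form V \<eta> X q = 0)"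

end

theory Submission
  imports Defs
begin

text \<open>
  Put \<open>\<gamma> = g - \<eta> \<otimes> \<eta>\<close>, \<open>c = 2\<lambda> - (p + 2/(2n+1))\<close> and let \<open>[V, \<xi>] = f \<xi>\<close>. As \<open>S\<^sup>*(\<cdot>, \<xi>) = 0\<close>,
  evaluating the soliton equation on \<open>\<xi>\<close> shows that \<open>f\<close> is the constant \<open>F = c/2 + \<mu>\<close> and that
  \<open>L\<^sub>V \<eta> = - F \<eta>\<close>. On a Kenmotsu manifold \<open>L\<^sub>\<xi> g = L\<^sub>\<xi> \<gamma> = 2\<gamma>\<close> and \<open>L\<^sub>\<xi> S\<^sup>* = - 2\<gamma>\<close>. Substituting
  the soliton equation into \<open>[L\<^sub>V, L\<^sub>\<xi>] g = F L\<^sub>\<xi> g\<close> gives \<open>S\<^sup>* = - (F/2 + 1) \<gamma>\<close>; applying \<open>L\<^sub>\<xi>\<close> to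
  this once more gives \<open>F \<gamma> = 0\<close>, so \<open>F = 0\<close> and \<open>S\<^sup>* = - \<gamma>\<close>. Finally
  \<open>S\<^sup>* = S + (2n-1) g + \<eta> \<otimes> \<eta>\<close>, whence \<open>S = - 2n g\<close>.
\<close>

section \<open>Calculus of smooth functions\<close>

text \<open>What forces \<open>F = 0\<close> is the mismatch between
  \<open>L\<^sub>\<xi> \<gamma> = 2\<gamma>\<close> and
  \<open>L\<^sub>\<xi> S\<^sup>* = - 2\<gamma>\<close>: a constant multiple
  \<open>k \<gamma>\<close> can equal \<open>S\<^sup>*\<close> only for \<open>k = -1\<close>,
  provided that \<gamma> is not zero, and this is where \<open>n \<ge> 1\<close> enters. The second
  formula comes from the curvature: the Lie derivative of the connection along \<xi> is
  \<open>- 2\<gamma> \<otimes> \<xi>\<close>, so that of \<open>R(X,Y)Z\<close> is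
  \<open>2\<gamma>(X,Z)Y - 2\<gamma>(Y,Z)X\<close>, and since
  \<open>L\<^sub>\<xi> \<phi> = 0\<close> two rank-one endomorphisms remain under the trace. Traces
  are taken point by point in an arbitrary basis, so their smoothness is not built in; that of
  \<open>S\<^sup>*\<close>, without which it cannot be differentiated, is read off the soliton
  equation. Tangent vectors are abstract derivations, so even finite dimension and the pointwise
  nature of tensor fields rest on Hadamard's lemma and cutoffs. Global frames exist only up to a
  cutoff factor \<open>w\<close>; trace formulas therefore carry such a factor, and differentiating
  a trace must account for its derivative.\<close>

lemma Ck_on_cong:
  assumes "open U" "\<And>x. x \<in> U \<Longrightarrow> f x = g x" "Ck_on k U f"
  shows "Ck_on k U g"
  using assms(2,3)
proof (induction k arbitrary: f g)
  case 0
  then show ?case by (simp cong: continuous_on_cong)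
next
  case (Suc k)
  have d: "(g has_derivative frechet_derivative f (at x)) (at x)" if x: "x \<in> U" for x
  proof -
    have "(f has_derivative frechet_derivative f (at x)) (at x)"
      using Suc.prems(2) x by (simp add: frechet_derivative_works)
    then show ?thesis
      using has_derivative_transform_within_open[OF _ \<open>open U\<close> x] Suc.prems(1) by blast
  qed
  have "Ck_on k U (\<lambda>x. frechet_derivative g (at x) v)" for v
    by (rule Suc.IH[of "\<lambda>x. frechet_derivative f (at x) v"])
      (use frechet_derivative_at[OF d] Suc.prems(2) in auto)
  then show ?case
    using d by (auto simp: differentiable_def)
qed

lemma Ck_on_SucI:
  assumes "open U" "\<And>x. x \<in> U \<Longrightarrow> (f has_derivative F x) (at x)"
    and "\<And>v. Ck_on k U (\<lambda>x. F x v)"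
  shows "Ck_on (Suc k) U f"
proof -
  have "Ck_on k U (\<lambda>x. frechet_derivative f (at x) v)" for v
    by (rule Ck_on_cong[OF assms(1) _ assms(3)[of v]])
      (use frechet_derivative_at[OF assms(2)] in simp)
  then show ?thesis using assms(2) by (auto simp: differentiable_def)
qed

lemma Ck_on_has_derivative:
  "Ck_on (Suc k) U f \<Longrightarrow> x \<in> U \<Longrightarrow> (f has_derivative frechet_derivative f (at x)) (at x)"
  by (simp add: frechet_derivative_works)

lemma Ck_on_Suc_imp: "Ck_on (Suc k) U f \<Longrightarrow> Ck_on k U f"
proof (induction k arbitrary: f)
  case 0
  then show ?case
    by (auto intro!: continuous_at_imp_continuous_on differentiable_imp_continuous_within)
next
  case (Suc k)
  then show ?case by (metis Ck_on.simps(2))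
qed

lemma Ck_on_continuous: "Ck_on k U f \<Longrightarrow> continuous_on U f"
  by (induction k) (auto dest: Ck_on_Suc_imp simp del: Ck_on.simps(2))

lemma Ck_on_subset: "Ck_on k U f \<Longrightarrow> V \<subseteq> U \<Longrightarrow> Ck_on k V f"
  by (induction k arbitrary: f) (auto intro: continuous_on_subset)

text \<open>For functions extended by zero: smoothness is checked separately near points of the
  original domain and away from the support.\<close>

lemma Ck_on_local:
  assumes "\<And>x. x \<in> U \<Longrightarrow> \<exists>V. open V \<and> x \<in> V \<and> Ck_on k V f"
  shows "Ck_on k U f"
  using assms
proof (induction k arbitrary: f)
  case 0
  have "isCont f x" if "x \<in> U" for x
    using 0[OF that] by (auto simp: continuous_on_eq_continuous_at)
  then show ?case by (auto intro: continuous_at_imp_continuous_on)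
next
  case (Suc k)
  have "f differentiable (at x)" if "x \<in> U" for x
    using Suc.prems[OF that] by auto
  moreover have "Ck_on k U (\<lambda>x. frechet_derivative f (at x) v)" for v
    by (rule Suc.IH) (use Suc.prems in force)
  ultimately show ?case by simp
qed

lemma Ck_on_const: "Ck_on k U (\<lambda>x. c)"
  by (induction k arbitrary: c) auto

lemma Ck_on_bounded_linear:
  assumes "open U" "bounded_linear h" "Ck_on k U f"
  shows "Ck_on k U (\<lambda>x. h (f x))"
  using assms(3)
proof (induction k arbitrary: f)
  case 0
  then show ?case
    using bounded_linear.continuous_on[OF assms(2)] by auto
next
  case (Suc k)
  show ?case
  proof (rule Ck_on_SucI[OF assms(1)])
    show "((\<lambda>x. h (f x)) has_derivative (\<lambda>v. h (frechet_derivative f (at x) v))) (at x)"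
      if "x \<in> U" for x
      using bounded_linear.has_derivative[OF assms(2) Ck_on_has_derivative[OF Suc.prems that]] .
    show "Ck_on k U (\<lambda>x. h (frechet_derivative f (at x) v))" for v
      using Suc by simp
  qed
qed

lemma Ck_on_add:
  assumes "open U" "Ck_on k U f" "Ck_on k U g"
  shows "Ck_on k U (\<lambda>x. f x + g x)"
  using assms(2,3)
proof (induction k arbitrary: f g)
  case 0
  then show ?case by (auto intro: continuous_intros)
next
  case (Suc k)
  show ?case
  proof (rule Ck_on_SucI[OF assms(1)])
    show "((\<lambda>x. f x + g x) has_derivative
        (\<lambda>v. frechet_derivative f (at x) v + frechet_derivative g (at x) v)) (at x)"
      if "x \<in> U" for x
      using Ck_on_has_derivative Suc.prems that by (intro has_derivative_add) blast+
    show "Ck_on k U (\<lambda>x. frechet_derivative f (at x) v + frechet_derivative g (at x) v)" for v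
      using Suc by simp
  qed
qed

lemma Ck_on_mult:
  fixes f g :: "'b::euclidean_space \<Rightarrow> real"
  assumes "open U" "Ck_on k U f" "Ck_on k U g"
  shows "Ck_on k U (\<lambda>x. f x * g x)"
  using assms(2,3)
proof (induction k arbitrary: f g)
  case 0
  then show ?case by (auto intro: continuous_intros)
next
  case (Suc k)
  show ?case
  proof (rule Ck_on_SucI[OF assms(1)])
    show "((\<lambda>x. f x * g x) has_derivative
        (\<lambda>v. f x * frechet_derivative g (at x) v + frechet_derivative f (at x) v * g x)) (at x)"
      if "x \<in> U" for x
      using Ck_on_has_derivative Suc.prems that by (intro has_derivative_mult) blast+
    show "Ck_on k U (\<lambda>x. f x * frechet_derivative g (at x) v + frechet_derivative f (at x) v * g x)"
      for v
      using Suc.prems Suc.prems[THEN Ck_on_Suc_imp] Suc.IH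
      by (intro Ck_on_add[OF assms(1)]) simp_all
  qed
qed

lemma Ck_on_sum:
  assumes "open U" "\<And>i. i \<in> I \<Longrightarrow> Ck_on k U (f i)"
  shows "Ck_on k U (\<lambda>x. \<Sum>i\<in>I. f i x)"
  using assms(2)
  by (induction I rule: infinite_finite_induct) (auto intro: Ck_on_const Ck_on_add[OF assms(1)])

text \<open>The derivative of \<open>f\<close> is expanded in the basis because \<open>Ck_on\<close>
  controls it in fixed directions, whereas the chain rule evaluates it in a direction that moves
  with \<open>x\<close>. The induction replaces \<open>f\<close> by its derivatives while
  \<open>g\<close> stays the same.\<close>

lemma Ck_on_compose:
  fixes f :: "'c::euclidean_space \<Rightarrow> real" and g :: "'b::euclidean_space \<Rightarrow> 'c"
  assumes "open U" "open V" "g ` U \<subseteq> V" "Ck_on k V f" "Ck_on k U g"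
  shows "Ck_on k U (f \<circ> g)"
  using assms(4,5)
proof (induction k arbitrary: f)
  case 0
  then show ?case
    using assms(3) continuous_on_compose[of U g f] continuous_on_subset[of V f "g ` U"] by simp
next
  case (Suc k)
  let ?F = "\<lambda>x v. \<Sum>b\<in>Basis. (frechet_derivative g (at x) v \<bullet> b) * frechet_derivative f (at (g x)) b"
  show ?case
  proof (rule Ck_on_SucI[OF assms(1), of _ ?F])
    fix x assume x: "x \<in> U"
    have f: "(f has_derivative frechet_derivative f (at (g x))) (at (g x))"
      using Ck_on_has_derivative[OF Suc.prems(1)] x assms(3) by blast
    have "(f \<circ> g has_derivative frechet_derivative f (at (g x)) \<circ> frechet_derivative g (at x)) (at x)"
      by (rule diff_chain_at[OF Ck_on_has_derivative[OF Suc.prems(2) x] f])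
    moreover have "frechet_derivative f (at (g x)) \<circ> frechet_derivative g (at x) = ?F x"
    proof
      fix v
      have lin: "linear (frechet_derivative f (at (g x)))"
        using f has_derivative_linear by blast
      have "frechet_derivative f (at (g x)) (frechet_derivative g (at x) v) =
          frechet_derivative f (at (g x)) (\<Sum>b\<in>Basis. (frechet_derivative g (at x) v \<bullet> b) *\<^sub>R b)"
        by (simp add: euclidean_representation)
      then show "(frechet_derivative f (at (g x)) \<circ> frechet_derivative g (at x)) v = ?F x v"
        by (simp add: linear_sum[OF lin] linear_cmul[OF lin])
    qed
    ultimately show "(f \<circ> g has_derivative ?F x) (at x)" by simp
  next
    fix v
    have "Ck_on k U (\<lambda>x. frechet_derivative g (at x) v \<bullet> b)" for b
      using Suc.prems(2) by (intro Ck_on_bounded_linear[OF assms(1) bounded_linear_inner_left]) auto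
    moreover have "Ck_on k U ((\<lambda>y. frechet_derivative f (at y) b) \<circ> g)" for b
      using Suc.IH[OF _ Ck_on_Suc_imp[OF Suc.prems(2)], of "\<lambda>y. frechet_derivative f (at y) b"]
        Suc.prems(1) by (simp add: o_def)
    ultimately show "Ck_on k U (\<lambda>x. ?F x v)"
      by (intro Ck_on_sum[OF assms(1)] Ck_on_mult[OF assms(1)]) (auto simp: o_def)
  qed
qed

lemma Ck_on_ident:
  assumes "open U" shows "Ck_on k U (\<lambda>x. x)"
  by (cases k) (auto intro!: Ck_on_const)

lemma Ck_on_inner_left:
  assumes "open U" "Ck_on k U f" shows "Ck_on k U (\<lambda>x. f x \<bullet> b)"
  by (rule Ck_on_bounded_linear[OF assms(1) bounded_linear_inner_left assms(2)])

lemmas smooth_on_intros =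
  Ck_on_const Ck_on_add Ck_on_mult Ck_on_sum Ck_on_ident Ck_on_inner_left

lemma smooth_on_derivative:
  "smooth_on U f \<Longrightarrow> smooth_on U (\<lambda>x. frechet_derivative f (at x) v)"
  by (metis Ck_on.simps(2) smooth_on_def)

lemma smooth_on_has_derivative:
  "smooth_on U f \<Longrightarrow> x \<in> U \<Longrightarrow> (f has_derivative frechet_derivative f (at x)) (at x)"
  using Ck_on_has_derivative smooth_on_def by blast

text \<open>Differentiation under the integral sign brings out a factor \<open>t\<close> by the
  chain rule along the ray, so the induction runs over all weights \<open>t ^ m\<close>.\<close>

lemma Ck_on_ray_integral:
  fixes f :: "'b::euclidean_space \<Rightarrow> real"
  assumes "Ck_on k (ball z r) f"
  shows "Ck_on k (ball z r) (\<lambda>x. integral {0..1} (\<lambda>t. t ^ m * f (z + t *\<^sub>R (x - z))))"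
  using assms
proof (induction k arbitrary: f m)
  have ray: "z + t *\<^sub>R (x - z) \<in> ball z r" if "x \<in> ball z r" "t \<in> {0..1}" for x and t :: real
  proof -
    have "norm (t *\<^sub>R (x - z)) \<le> norm (x - z)"
      using that by (auto intro: mult_left_le_one_le)
    then show ?thesis using that by (auto simp: dist_norm norm_minus_commute)
  qed
  have cont: "continuous_on (ball z r \<times> cbox 0 1) (\<lambda>(x, t::real). t ^ m * h (z + t *\<^sub>R (x - z)))"
    if "continuous_on (ball z r) h" for h :: "'b \<Rightarrow> real" and m
    unfolding split_beta
    by (intro continuous_intros continuous_on_compose2[OF that]) (auto intro!: ray simp del: mem_ball)
  {
    case 0
    then show ?case
      using integral_continuous_on_param[OF cont, of f m] by simp
  next
    case (Suc k)
    let ?D = "\<lambda>x. frechet_derivative f (at x)"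
    \<comment> \<open>\<open>leibniz_rule\<close> takes the derivative as a continuous family of
      bounded linear maps. \<open>Blinfun\<close> is known to be meaningful here only for points of
      the ball, hence the restriction in the fact \<open>G\<close>.\<close>
    define G where "G x t = Blinfun (\<lambda>v. t ^ Suc m * ?D (z + t *\<^sub>R (x - z)) v)" for x and t :: real
    have D: "(f has_derivative ?D x) (at x)" if "x \<in> ball z r" for x
      using Ck_on_has_derivative[OF Suc.prems that] .
    have G: "blinfun_apply (G x t) = (\<lambda>v. t ^ Suc m * ?D (z + t *\<^sub>R (x - z)) v)"
      if "x \<in> ball z r" "t \<in> {0..1}" for x t
      unfolding G_def using has_derivative_bounded_linear[OF D[OF ray[OF that]]]
      by (intro bounded_linear_Blinfun_apply) (rule bounded_linear_const_mult)
    have contD: "continuous_on (ball z r) (\<lambda>x. ?D x v)" for v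
      using Suc.prems Ck_on_continuous[of k "ball z r" "\<lambda>x. ?D x v"] by simp
    have contG: "continuous_on (ball z r \<times> cbox 0 1) (\<lambda>(x, t). G x t)"
    proof (rule continuous_on_blinfun_componentwise)
      fix i :: 'b assume "i \<in> Basis"
      have "continuous_on (ball z r \<times> cbox 0 1)
          (\<lambda>y. blinfun_apply (case y of (x, t) \<Rightarrow> G x t) i) \<longleftrightarrow>
        continuous_on (ball z r \<times> cbox 0 1)
          (\<lambda>(x, t). t ^ Suc m * ?D (z + t *\<^sub>R (x - z)) i)"
        by (rule continuous_on_cong) (auto simp: G simp del: power_Suc)
      then show "continuous_on (ball z r \<times> cbox 0 1)
          (\<lambda>y. blinfun_apply (case y of (x, t) \<Rightarrow> G x t) i)"
        using cont[OF contD] by blast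
    qed
    have Gint: "G x integrable_on cbox 0 1" if "x \<in> ball z r" for x
      using that contG
      by (intro integrable_continuous continuous_on_compose2[OF contG, of _ "\<lambda>t. (x, t)", simplified])
        (auto intro!: continuous_intros)
    show ?case
    proof (rule Ck_on_SucI[where F = "\<lambda>x. blinfun_apply (integral (cbox 0 1) (G x))"])
      fix x assume x: "x \<in> ball z r"
      have "((\<lambda>x. integral (cbox 0 1) (\<lambda>t. t ^ m * f (z + t *\<^sub>R (x - z)))) has_derivative
          blinfun_apply (integral (cbox 0 1) (G x))) (at x within ball z r)"
      proof (rule leibniz_rule[OF _ _ contG x])
        fix y t assume y: "y \<in> ball z r" and t: "t \<in> cbox (0::real) 1"
        have "((\<lambda>y. z + t *\<^sub>R (y - z)) has_derivative (\<lambda>v. t *\<^sub>R v)) (at y within ball z r)"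
          by (auto intro!: derivative_eq_intros)
        moreover have y': "z + t *\<^sub>R (y - z) \<in> ball z r"
          using ray y t by auto
        ultimately have "((\<lambda>y. f (z + t *\<^sub>R (y - z))) has_derivative
            (\<lambda>v. ?D (z + t *\<^sub>R (y - z)) (t *\<^sub>R v))) (at y within ball z r)"
          using has_derivative_compose D by blast
        then have "((\<lambda>y. t ^ m * f (z + t *\<^sub>R (y - z))) has_derivative
            (\<lambda>v. t ^ m * ?D (z + t *\<^sub>R (y - z)) (t *\<^sub>R v))) (at y within ball z r)"
          by (intro has_derivative_mult_right)
        moreover have "(\<lambda>v. t ^ m * ?D (z + t *\<^sub>R (y - z)) (t *\<^sub>R v)) = blinfun_apply (G y t)"
          using y t linear_cmul[OF has_derivative_linear[OF D[OF y']]] by (auto simp: G)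
        ultimately show "((\<lambda>y. t ^ m * f (z + t *\<^sub>R (y - z))) has_derivative
            blinfun_apply (G y t)) (at y within ball z r)" by simp
      next
        fix y assume y: "y \<in> ball z r"
        have "continuous_on (cbox 0 1)
            (\<lambda>t. (\<lambda>(x, t). t ^ m * f (z + t *\<^sub>R (x - z))) (y, t))"
          by (rule continuous_on_compose2[OF cont[OF Ck_on_continuous[OF Suc.prems]]])
            (use y in \<open>auto intro!: continuous_on_Pair continuous_on_const continuous_on_id simp del: mem_ball\<close>)
        then show "(\<lambda>t. t ^ m * f (z + t *\<^sub>R (y - z))) integrable_on cbox 0 1"
          by (intro integrable_continuous) simp
      qed simp
      then show "((\<lambda>x. integral {0..1} (\<lambda>t. t ^ m * f (z + t *\<^sub>R (x - z)))) has_derivative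
          blinfun_apply (integral (cbox 0 1) (G x))) (at x)"
        using at_within_open[OF x open_ball] by simp
    next
      fix v
      have 1: "Ck_on k (ball z r)
          (\<lambda>x. integral {0..1} (\<lambda>t. t ^ Suc m * ?D (z + t *\<^sub>R (x - z)) v))"
        using Suc.IH[of "\<lambda>x. ?D x v" "Suc m"] Suc.prems by simp
      have 2: "integral {0..1} (\<lambda>t. t ^ Suc m * ?D (z + t *\<^sub>R (x - z)) v) =
          blinfun_apply (integral (cbox 0 1) (G x)) v" if "x \<in> ball z r" for x
        unfolding blinfun_apply_integral[OF Gint[OF that]] unfolding cbox_interval
        by (rule integral_cong) (simp add: G[OF that] del: power_Suc)
      show "Ck_on k (ball z r) (\<lambda>x. blinfun_apply (integral (cbox 0 1) (G x)) v)"
        by (rule Ck_on_cong[OF open_ball 2 1])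
    qed simp
  }
qed

text \<open>The fundamental theorem of calculus along the segment from \<open>z\<close> to
  \<open>x\<close>; \<open>G i\<close> averages the derivative in direction \<open>i\<close> over
  it. Its value at \<open>z\<close> is what identifies derivations with combinations of coordinate
  derivatives.\<close>

lemma hadamard:
  fixes f :: "'b::euclidean_space \<Rightarrow> real"
  assumes f: "smooth_on (ball z r) f"
  obtains G where "\<And>i. smooth_on (ball z r) (G i)"
    and "\<And>i. G i z = frechet_derivative f (at z) i"
    and "\<And>x. x \<in> ball z r \<Longrightarrow> f x = f z + (\<Sum>i\<in>Basis. (x \<bullet> i - z \<bullet> i) * G i x)"
proof -
  let ?D = "\<lambda>x. frechet_derivative f (at x)"
  define G where "G i x = integral {0..1} (\<lambda>t. t ^ 0 * ?D (z + t *\<^sub>R (x - z)) i)" for i x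
  have "smooth_on (ball z r) (G i)" for i
    using smooth_on_derivative[OF f, of i] unfolding G_def smooth_on_def
    by (intro allI Ck_on_ray_integral) blast
  moreover have "G i z = ?D z i" for i
    by (simp add: G_def)
  moreover have "f x = f z + (\<Sum>i\<in>Basis. (x \<bullet> i - z \<bullet> i) * G i x)" if x: "x \<in> ball z r" for x
  proof -
    have ray: "z + t *\<^sub>R (x - z) \<in> ball z r" if "t \<in> {0..1}" for t :: real
    proof -
      have "norm (t *\<^sub>R (x - z)) \<le> norm (x - z)"
        using that by (auto intro: mult_left_le_one_le)
      then show ?thesis using x by (auto simp: dist_norm norm_minus_commute)
    qed
    have D: "?D (z + t *\<^sub>R (x - z)) (x - z) =
        (\<Sum>i\<in>Basis. (x \<bullet> i - z \<bullet> i) * ?D (z + t *\<^sub>R (x - z)) i)" if t: "t \<in> {0..1}" for t :: real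
    proof -
      have lin: "linear (?D (z + t *\<^sub>R (x - z)))"
        using smooth_on_has_derivative[OF f ray[OF t]] has_derivative_linear by blast
      have "?D (z + t *\<^sub>R (x - z)) (x - z) =
          ?D (z + t *\<^sub>R (x - z)) (\<Sum>i\<in>Basis. ((x - z) \<bullet> i) *\<^sub>R i)"
        by (simp only: euclidean_representation)
      then show ?thesis
        by (simp add: linear_sum[OF lin] linear_cmul[OF lin] inner_diff_left)
    qed
    have int: "(\<lambda>t. ?D (z + t *\<^sub>R (x - z)) i) integrable_on {0..1}" for i
    proof -
      have "continuous_on (ball z r) (\<lambda>x. ?D x i)"
        using smooth_on_derivative[OF f] Ck_on_continuous smooth_on_def by blast
      then show ?thesis
        using ray
        by (intro integrable_continuous_real
            continuous_on_compose2[of "ball z r" "\<lambda>x. ?D x i" _ "\<lambda>t. z + t *\<^sub>R (x - z)"]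
            image_subsetI continuous_on_add continuous_on_scaleR continuous_on_const continuous_on_id)
    qed
    have "((\<lambda>t. ?D (z + t *\<^sub>R (x - z)) (x - z)) has_integral
        f (z + 1 *\<^sub>R (x - z)) - f (z + 0 *\<^sub>R (x - z))) {0..1}"
    proof (rule fundamental_theorem_of_calculus)
      fix t :: real assume t: "t \<in> {0..1}"
      have "((\<lambda>t. z + t *\<^sub>R (x - z)) has_derivative (\<lambda>h. h *\<^sub>R (x - z))) (at t within {0..1})"
        by (auto intro!: derivative_eq_intros)
      from has_derivative_compose[OF this smooth_on_has_derivative[OF f ray[OF t]]]
      show "((\<lambda>t. f (z + t *\<^sub>R (x - z))) has_vector_derivative
          ?D (z + t *\<^sub>R (x - z)) (x - z)) (at t within {0..1})"
        using linear_cmul[OF has_derivative_linear[OF smooth_on_has_derivative[OF f ray[OF t]]]]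
        by (simp add: has_vector_derivative_def)
    qed simp
    then have "f x - f z = integral {0..1} (\<lambda>t. ?D (z + t *\<^sub>R (x - z)) (x - z))"
      by (simp add: integral_unique)
    also have "\<dots> = integral {0..1} (\<lambda>t. \<Sum>i\<in>Basis. (x \<bullet> i - z \<bullet> i) * ?D (z + t *\<^sub>R (x - z)) i)"
      by (rule integral_cong) (rule D)
    also have "\<dots> = (\<Sum>i\<in>Basis. (x \<bullet> i - z \<bullet> i) * G i x)"
      using int by (subst integral_sum) (auto intro!: integrable_on_mult_right simp: G_def)
    finally show ?thesis by simp
  qed
  ultimately show ?thesis using that by blast
qed

text \<open>The classical flat function exp(-1/s) together with its quotients by powers of
  \<open>s\<close>: derivatives are again linear combinations of the family, so one induction
  handles all orders.\<close>

definition flat_fun :: "nat \<Rightarrow> real \<Rightarrow> real" where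
  "flat_fun m s = (if s \<le> 0 then 0 else exp (- 1 / s) / s ^ m)"

text \<open>The term of order \<open>m + 2\<close> of the exponential series bounds exp(1/s) from
  below. This order leaves the factor \<open>s\<^sup>2\<close>, so that difference quotients at 0
  tend to 0.\<close>

lemma flat_fun_bound: "\<bar>flat_fun m s\<bar> \<le> fact (m + 2) * s\<^sup>2"
proof (cases "s \<le> 0")
  case False
  then have s: "s > 0" by simp
  have "(\<Sum>n\<in>{m + 2}. (1 / s) ^ n /\<^sub>R fact n) \<le> exp (1 / s)"
    unfolding exp_def by (rule sum_le_suminf[OF summable_exp_generic]) (use s in auto)
  then have "inverse s ^ (m + 2) / fact (m + 2) \<le> exp (1 / s)"
    by (simp only: sum.insert[OF finite.emptyI] sum.empty empty_iff not_False_eq_True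
        add_0_right real_scaleR_def divide_inverse mult_1 mult.commute)
  then have "1 / (s ^ m * s\<^sup>2) \<le> fact (m + 2) * exp (1 / s)"
    by (simp only: pos_divide_le_eq[OF fact_gt_zero] power_inverse power_add inverse_eq_divide mult.commute power_one_over mult_1 times_divide_times_eq)
  then have "exp (- (1 / s)) / s ^ m \<le> fact (m + 2) * s\<^sup>2"
    using s by (simp only: exp_minus) (simp only: divide_simps zero_less_power zero_less_mult_iff
      exp_gt_zero if_True mult_1 mult_ac, simp)
  then show ?thesis using s by (simp only: flat_fun_def) simp
qed (simp add: flat_fun_def)

lemma flat_fun_has_derivative:
  "(flat_fun m has_real_derivative (flat_fun (m + 2) s - m * flat_fun (m + 1) s)) (at s)"
proof -
  consider "s < 0" | "s = 0" | "s > 0" by linarith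
  then show ?thesis
  proof cases
    case 1
    have "(flat_fun m has_real_derivative 0) (at s) \<longleftrightarrow> ((\<lambda>s. 0) has_real_derivative 0) (at s)"
      using 1 by (intro DERIV_cong_ev refl eventually_mono[OF eventually_nhds_in_open[of "{..<0}"]])
        (auto simp: flat_fun_def)
    then show ?thesis using 1 by (simp add: flat_fun_def)
  next
    case 2
    have "((\<lambda>h. flat_fun m h / h) \<longlongrightarrow> 0) (at 0)"
    proof (rule Lim_null_comparison)
      show "\<forall>\<^sub>F h in at 0. norm (flat_fun m h / h) \<le> fact (m + 2) * \<bar>h\<bar>"
        unfolding eventually_at_topological
      proof (intro exI[of _ UNIV] conjI ballI impI)
        fix h :: real assume "h \<noteq> 0"
        then show "norm (flat_fun m h / h) \<le> fact (m + 2) * \<bar>h\<bar>"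
          using flat_fun_bound[of m h] by (simp add: abs_divide divide_le_eq power2_eq_square abs_mult_self_eq mult.assoc)
      qed auto
      show "((\<lambda>h. fact (m + 2) * \<bar>h::real\<bar>) \<longlongrightarrow> 0) (at 0)"
        by (auto intro!: tendsto_eq_intros)
    qed
    then have "(flat_fun m has_real_derivative 0) (at 0)"
      by (simp add: DERIV_def flat_fun_def[of m 0])
    moreover have "flat_fun j 0 = 0" for j by (simp add: flat_fun_def)
    ultimately show ?thesis using 2 by simp
  next
    case 3
    have "(flat_fun m has_real_derivative (flat_fun (m + 2) s - m * flat_fun (m + 1) s)) (at s) \<longleftrightarrow>
      ((\<lambda>s. exp (- 1 / s) / s ^ m) has_real_derivative (flat_fun (m + 2) s - m * flat_fun (m + 1) s)) (at s)"
      using 3 by (intro DERIV_cong_ev refl eventually_mono[OF eventually_nhds_in_open[of "{0<..}"]])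
        (auto simp: flat_fun_def)
    moreover have "((\<lambda>s. exp (- 1 / s) / s ^ m) has_real_derivative
        (flat_fun (m + 2) s - m * flat_fun (m + 1) s)) (at s)"
    proof -
      have "((\<lambda>s. s ^ m) has_real_derivative m * s ^ m / s) (at s)"
        using 3 by (intro DERIV_cong[OF DERIV_pow]) (cases m, auto)
      moreover have "((\<lambda>s. exp (- 1 / s)) has_real_derivative exp (- 1 / s) / s\<^sup>2) (at s)"
        using 3 by (auto intro!: derivative_eq_intros simp: power2_eq_square)
      ultimately have "((\<lambda>s. exp (- 1 / s) / s ^ m) has_real_derivative
          (exp (- 1 / s) / s\<^sup>2 * s ^ m - exp (- 1 / s) * (m * s ^ m / s)) / (s ^ m * s ^ m)) (at s)"
        using 3 by (intro DERIV_divide) auto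
      moreover have "(exp (- 1 / s) / s\<^sup>2 * s ^ m - exp (- 1 / s) * (m * s ^ m / s)) / (s ^ m * s ^ m) =
          flat_fun (m + 2) s - m * flat_fun (m + 1) s"
        using 3 by (simp add: flat_fun_def power_add divide_simps) (simp add: algebra_simps power2_eq_square)
      ultimately show ?thesis by simp
    qed
    ultimately show ?thesis by blast
  qed
qed

lemma Ck_on_flat_fun: "Ck_on k UNIV (flat_fun m)"
proof (induction k arbitrary: m)
  case 0
  then show ?case
    by (auto intro!: continuous_at_imp_continuous_on DERIV_isCont[OF flat_fun_has_derivative])
next
  case (Suc k)
  show ?case
  proof (rule Ck_on_SucI[OF open_UNIV flat_fun_has_derivative[unfolded has_field_derivative_def]])
    show "Ck_on k UNIV (\<lambda>s. (flat_fun (m + 2) s - m * flat_fun (m + 1) s) * v)" for v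
    proof -
      have "Ck_on k UNIV (\<lambda>s. (flat_fun (m + 2) s + (- m) * flat_fun (m + 1) s) * v)"
        by (intro smooth_on_intros Suc open_UNIV)
      then show ?thesis by simp
    qed
  qed
qed

lemma bump_exists:
  fixes z :: "'b::euclidean_space"
  assumes "r > 0"
  obtains b :: "'b \<Rightarrow> real" where "smooth_on UNIV b" "b z = 1" "\<And>x. x \<notin> cball z r \<Longrightarrow> b x = 0"
proof -
  \<comment> \<open>The square of the radius minus the squared distance, written with the sums and
    products that \<open>smooth_on_intros\<close> covers.\<close>
  define q where "q x = r\<^sup>2 + (- 1) * (\<Sum>i\<in>Basis. (x \<bullet> i + - (z \<bullet> i)) * (x \<bullet> i + - (z \<bullet> i)))" for x
  define b where "b x = (flat_fun 0 \<circ> q) x * (1 / flat_fun 0 (r\<^sup>2))" for x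
  have q: "q x = r\<^sup>2 - (dist x z)\<^sup>2" for x
  proof -
    have "(dist x z)\<^sup>2 = (x - z) \<bullet> (x - z)"
      by (simp add: dist_norm power2_norm_eq_inner)
    also have "\<dots> = (\<Sum>i\<in>Basis. (x \<bullet> i + - (z \<bullet> i)) * (x \<bullet> i + - (z \<bullet> i)))"
      by (subst euclidean_inner) (simp add: inner_diff_left)
    finally show ?thesis by (simp add: q_def)
  qed
  have "Ck_on k UNIV q" for k
    unfolding q_def by (intro smooth_on_intros open_UNIV)
  then have "smooth_on UNIV b"
    unfolding smooth_on_def b_def
    by (intro allI smooth_on_intros open_UNIV Ck_on_compose[OF _ open_UNIV] Ck_on_flat_fun subset_UNIV)
  moreover have "b z = 1" using assms by (simp add: b_def q flat_fun_def)
  moreover have "b x = 0" if "x \<notin> cball z r" for x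
  proof -
    have "r\<^sup>2 \<le> (dist x z)\<^sup>2" using that assms by (intro power_mono) (auto simp: dist_commute)
    then show ?thesis by (simp add: b_def q flat_fun_def)
  qed
  ultimately show ?thesis using that by blast
qed


section \<open>Smooth functions and vector fields on a manifold\<close>

lemma sum_fun_apply: "(\<Sum>i\<in>I. F i) x = (\<Sum>i\<in>I. F i x)"
  by (induction I rule: infinite_finite_induct) (auto simp: zero_fun_def)

lemmas fun_ops = plus_fun_apply minus_apply uminus_apply zero_fun_apply scaleR_fun_def fun_scale_def

lemma tangent_space_subspace: "subspace (tangent_space A q)"
  unfolding subspace_def tangent_space_def by (auto simp: fun_ops algebra_simps)

locale smooth_manifold =
  fixes A :: "('a::{t2_space, second_countable_topology}, 'b::euclidean_space) chart set"
  assumes atlas: "smooth_atlas A"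
begin

abbreviation "C \<equiv> smooth_functions A"
abbreviation "\<XX> \<equiv> vector_fields A"

lemma chartD:
  assumes "(U, x) \<in> A"
  shows "open U" "open (x ` U)" "inj_on x U" "homeomorphism U (x ` U) x (inv_into U x)"
  using assms atlas unfolding smooth_atlas_def is_chart_def by fastforce+

lemma open_chart_image:
  assumes "(U, x) \<in> A" "open W" "W \<subseteq> U"
  shows "open (x ` W)"
  using homeomorphism_imp_open_map[OF chartD(4)[OF assms(1)], of W] assms(2,3) chartD(2)[OF assms(1)]
  by (meson open_subset openin_open_eq)

lemma chart_at:
  obtains U x where "(U, x) \<in> A" "q \<in> U"
proof -
  have "q \<in> \<Union>(fst ` A)"
    using atlas unfolding smooth_atlas_def by simp
  then show ?thesis using that by (metis UN_E prod.collapse)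
qed

lemma smooth_function_chart: "f \<in> C \<Longrightarrow> (U, x) \<in> A \<Longrightarrow> smooth_on (x ` U) (f \<circ> inv_into U x)"
  unfolding smooth_functions_def by auto

lemma smooth_const: "(\<lambda>p. c) \<in> C"
  unfolding smooth_functions_def smooth_on_def by (auto simp: o_def intro: Ck_on_const)

lemma smooth_add: "f \<in> C \<Longrightarrow> h \<in> C \<Longrightarrow> (\<lambda>p. f p + h p) \<in> C"
  unfolding smooth_functions_def smooth_on_def
  using chartD(2) by (fastforce simp: o_def intro: Ck_on_add)

lemma smooth_mult: "f \<in> C \<Longrightarrow> h \<in> C \<Longrightarrow> (\<lambda>p. f p * h p) \<in> C"
  unfolding smooth_functions_def smooth_on_def
  using chartD(2) by (fastforce simp: o_def intro: Ck_on_mult)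

lemma smooth_cmult: "f \<in> C \<Longrightarrow> (\<lambda>p. c * f p) \<in> C"
  using smooth_mult smooth_const by blast

lemma smooth_minus: "f \<in> C \<Longrightarrow> (\<lambda>p. - f p) \<in> C"
  using smooth_cmult[of f "-1"] by simp

lemma smooth_diff: "f \<in> C \<Longrightarrow> h \<in> C \<Longrightarrow> (\<lambda>p. f p - h p) \<in> C"
  using smooth_add[of f "\<lambda>p. - h p"] smooth_minus by simp

lemma smooth_sum: "(\<And>i. i \<in> I \<Longrightarrow> f i \<in> C) \<Longrightarrow> (\<lambda>p. \<Sum>i\<in>I. f i p) \<in> C"
  by (induction I rule: infinite_finite_induct) (auto intro: smooth_const smooth_add)

lemmas smooth_intros =
  smooth_const smooth_add smooth_mult smooth_minus smooth_diff smooth_sum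

text \<open>Extension by zero stays smooth because the image of \<open>K\<close> is closed in the
  whole manifold: it is compact, and the space is Hausdorff. On the chart region a change of
  coordinates applies; off the image of \<open>K\<close> the function is locally 0.\<close>

lemma chart_extension:
  assumes U: "(U, x) \<in> A" and Q: "open Q" "Q \<subseteq> x ` U" and F: "smooth_on Q F"
    and K: "compact K" "K \<subseteq> Q" "\<And>z. z \<in> Q - K \<Longrightarrow> F z = 0"
  shows "(\<lambda>p. if p \<in> U \<and> x p \<in> Q then F (x p) else 0) \<in> C" (is "?G \<in> C")
proof -
  define U' where "U' = U \<inter> x -` Q"
  have U': "open U'" "U' \<subseteq> U"
    unfolding U'_def
    using continuous_open_preimage[of U x Q] chartD(1,4)[OF U] Q(1) homeomorphism_cont1 by blast+
  define K' where "K' = inv_into U x ` K"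
  have "compact K'"
    unfolding K'_def
    using continuous_on_subset[OF homeomorphism_cont2[OF chartD(4)[OF U]] subset_trans[OF K(2) Q(2)]] K(1)
    by (rule compact_continuous_image)
  then have K': "closed K'" by (rule compact_imp_closed)
  have K'U: "K' \<subseteq> U'"
    using K(2) Q(2) by (auto simp: K'_def U'_def inv_into_into f_inv_into_f subset_iff)
  have G0: "?G p = 0" if "p \<notin> K'" for p
  proof (cases "p \<in> U \<and> x p \<in> Q")
    case True
    then have "x p \<notin> K"
      using that chartD(3)[OF U] by (force simp: K'_def)
    then show ?thesis using K(3) True by simp
  qed auto
  have "smooth_on (y ` V) (?G \<circ> inv_into V y)" if V: "(V, y) \<in> A" for V y
    unfolding smooth_on_def
  proof (intro allI Ck_on_local)
    fix k z assume "z \<in> y ` V"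
    then obtain p where p: "p \<in> V" "z = y p" by auto
    have inv: "inv_into V y (y p) = p" if "p \<in> V" for p
      using chartD(3)[OF V] that by simp
    show "\<exists>W. open W \<and> z \<in> W \<and> Ck_on k W (?G \<circ> inv_into V y)"
    proof (cases "p \<in> U'")
      case True
      define W where "W = y ` (V \<inter> U')"
      have W: "open W" "z \<in> W" "W \<subseteq> y ` (V \<inter> U)"
        using True p open_chart_image[OF V] chartD(1)[OF V] U' by (auto simp: W_def)
      have "Ck_on k W (x \<circ> inv_into V y)"
        using atlas U V W(3) unfolding smooth_atlas_def smooth_on_def by (blast intro: Ck_on_subset)
      moreover have "(x \<circ> inv_into V y) ` W \<subseteq> Q"
        using inv by (auto simp: W_def U'_def)
      ultimately have "Ck_on k W (F \<circ> (x \<circ> inv_into V y))"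
        using F unfolding smooth_on_def by (intro Ck_on_compose[OF W(1) Q(1)]) auto
      then have "Ck_on k W (?G \<circ> inv_into V y)"
        by (rule Ck_on_cong[OF W(1), rotated]) (use inv in \<open>auto simp: W_def U'_def\<close>)
      then show ?thesis using W by blast
    next
      case False
      define W where "W = y ` (V - K')"
      have W: "open W" "z \<in> W"
        using False K'U p open_chart_image[OF V, of "V - K'"] chartD(1)[OF V] K'
        by (auto simp: W_def open_Diff)
      have "Ck_on k W (?G \<circ> inv_into V y)"
      proof (rule Ck_on_cong[OF W(1) _ Ck_on_const[of k W 0]])
        fix z' assume "z' \<in> W"
        then obtain p' where p': "p' \<in> V" "p' \<notin> K'" "z' = y p'" by (auto simp: W_def)
        show "0 = (?G \<circ> inv_into V y) z'"
          using G0[OF p'(2)] by (simp only: o_apply p'(3) inv[OF p'(1)])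
      qed
      then show ?thesis using W by blast
    qed
  qed
  then show ?thesis unfolding smooth_functions_def by blast
qed

section \<open>Derivations at a point\<close>

lemma tangent_add: "v \<in> tangent_space A q \<Longrightarrow> f \<in> C \<Longrightarrow> h \<in> C \<Longrightarrow> v (\<lambda>r. f r + h r) = v f + v h"
  and tangent_mult:
    "v \<in> tangent_space A q \<Longrightarrow> f \<in> C \<Longrightarrow> h \<in> C \<Longrightarrow> v (\<lambda>r. f r * h r) = f q * v h + h q * v f"
  and tangent_cmult: "v \<in> tangent_space A q \<Longrightarrow> f \<in> C \<Longrightarrow> v (\<lambda>r. c * f r) = c * v f"
  and tangent_nonsmooth: "v \<in> tangent_space A q \<Longrightarrow> f \<notin> C \<Longrightarrow> v f = 0"
  unfolding tangent_space_def by blast+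

lemma tangent_const: assumes "v \<in> tangent_space A q" shows "v (\<lambda>r. c) = 0"
  using tangent_mult[OF assms smooth_const[of 1] smooth_const[of 1]]
    tangent_cmult[OF assms smooth_const[of 1], of c] by simp

lemma tangent_diff:
  assumes "v \<in> tangent_space A q" "f \<in> C" "h \<in> C"
  shows "v (\<lambda>r. f r - h r) = v f - v h"
  using tangent_add[OF assms(1,2) smooth_cmult[OF assms(3)], of "-1"] tangent_cmult[OF assms(1,3), of "-1"]
  by simp

lemma tangent_sum:
  assumes "v \<in> tangent_space A q"
  shows "(\<And>i. i \<in> I \<Longrightarrow> f i \<in> C) \<Longrightarrow> v (\<lambda>r. \<Sum>i\<in>I. f i r) = (\<Sum>i\<in>I. v (f i))"
  by (induction I rule: infinite_finite_induct)
    (auto simp: tangent_const[OF assms] tangent_add[OF assms] smooth_sum)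

text \<open>Every derivation at a point is a combination of coordinate derivatives: by Hadamard's lemma
  and a cutoff, a smooth function agrees near the point with an affine one up to products of
  functions vanishing there.\<close>

lemma tangent_coordinates:
  assumes U: "(U, x) \<in> A" "p \<in> U" and v: "v \<in> tangent_space A p"
  obtains c where
    "\<And>f. f \<in> C \<Longrightarrow> v f = (\<Sum>i\<in>Basis. c i * frechet_derivative (f \<circ> inv_into U x) (at (x p)) i)"
proof -
  obtain r where r: "r > 0" "ball (x p) r \<subseteq> x ` U"
    using chartD(2)[OF U(1)] U(2) open_contains_ball by blast
  obtain b where b: "smooth_on UNIV b" "b (x p) = 1" "\<And>z. z \<notin> cball (x p) (r / 2) \<Longrightarrow> b z = (0::real)"
    using bump_exists[of "r / 2" "x p"] r(1) by auto
  define ext where "ext F = (\<lambda>p'. if p' \<in> U \<and> x p' \<in> ball (x p) r then b (x p') * F (x p') else 0)"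
    for F :: "'b \<Rightarrow> real"
  have ext: "ext F \<in> C" if "smooth_on (ball (x p) r) F" for F
    unfolding ext_def
  proof (rule chart_extension[OF U(1) open_ball r(2), of _ "cball (x p) (r / 2)"])
    show "smooth_on (ball (x p) r) (\<lambda>z. b z * F z)"
      using that b(1) Ck_on_subset[of _ UNIV b] unfolding smooth_on_def
      by (blast intro: Ck_on_mult)
  qed (use r(1) b(3) in \<open>auto simp: subset_iff\<close>)
  have one: "smooth_on (ball (x p) r) (\<lambda>z. 1)" by (simp add: smooth_on_def Ck_on_const)
  have coord: "smooth_on (ball (x p) r) (\<lambda>z. z \<bullet> i + - (x p \<bullet> i))" for i
    unfolding smooth_on_def by (intro allI smooth_on_intros) auto
  \<comment> \<open>Cut-off coordinates centred at \<open>p\<close>; the values of \<open>v\<close>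
    on them will be the coefficients.\<close>
  define \<psi> where "\<psi> i = ext (\<lambda>z. z \<bullet> i + - (x p \<bullet> i))" for i
  show thesis
  proof (rule that[of "\<lambda>i. v (\<psi> i)"])
    fix f assume f: "f \<in> C"
    let ?f = "f \<circ> inv_into U x"
    have "smooth_on (ball (x p) r) ?f"
      using smooth_function_chart[OF f U(1)] r(2) unfolding smooth_on_def by (blast intro: Ck_on_subset)
    then obtain G where G: "\<And>i. smooth_on (ball (x p) r) (G i)"
      "\<And>i. G i (x p) = frechet_derivative ?f (at (x p)) i"
      "\<And>z. z \<in> ball (x p) r \<Longrightarrow> ?f z = ?f (x p) + (\<Sum>i\<in>Basis. (z \<bullet> i - x p \<bullet> i) * G i z)"
      using hadamard by blast
    have inv: "inv_into U x (x p') = p'" if "p' \<in> U" for p'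
      using chartD(3)[OF U(1)] that by simp
    \<comment> \<open>A product of two cutoffs, since both factors of each Hadamard term carry
      one.\<close>
    let ?\<beta> = "\<lambda>p'. ext (\<lambda>z. 1) p' * ext (\<lambda>z. 1) p'"
    have \<beta>: "?\<beta> \<in> C" "?\<beta> p = 1"
      using ext[OF one] U(2) r(1) b(2) by (auto intro: smooth_mult simp: ext_def)
    have \<psi>: "\<psi> i \<in> C" "\<psi> i p = 0" for i
      using ext[OF coord] by (auto simp: \<psi>_def ext_def)
    have g: "ext (G i) \<in> C" "ext (G i) p = G i (x p)" for i
      using ext[OF G(1)] U(2) r(1) b(2) by (auto simp: ext_def)
    have "(\<lambda>p'. ?\<beta> p' * f p') = (\<lambda>p'. f p * ?\<beta> p' + (\<Sum>i\<in>Basis. \<psi> i p' * ext (G i) p'))"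
    proof
      fix p'
      show "?\<beta> p' * f p' = f p * ?\<beta> p' + (\<Sum>i\<in>Basis. \<psi> i p' * ext (G i) p')"
      proof (cases "p' \<in> U \<and> x p' \<in> ball (x p) r")
        case True
        have "f p' = f p + (\<Sum>i\<in>Basis. (x p' \<bullet> i - x p \<bullet> i) * G i (x p'))"
          using G(3)[of "x p'"] True inv U(2) by simp
        then show ?thesis
          using True by (simp add: ext_def \<psi>_def algebra_simps sum_distrib_left sum_distrib_right)
      qed (auto simp: ext_def \<psi>_def)
    qed
    then have "v (\<lambda>p'. ?\<beta> p' * f p') =
        v (\<lambda>p'. f p * ?\<beta> p' + (\<Sum>i\<in>Basis. \<psi> i p' * ext (G i) p'))" by simp
    also have "\<dots> = f p * v ?\<beta> + (\<Sum>i\<in>Basis. \<psi> i p * v (ext (G i)) + ext (G i) p * v (\<psi> i))"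
    proof -
      have s: "(\<lambda>p'. \<psi> i p' * ext (G i) p') \<in> C" for i
        by (rule smooth_mult[OF \<psi>(1) g(1)])
      show ?thesis
        unfolding tangent_add[OF v smooth_cmult[OF \<beta>(1)] smooth_sum[OF s]] tangent_cmult[OF v \<beta>(1)]
          tangent_sum[OF v s] tangent_mult[OF v \<psi>(1) g(1)] ..
    qed
    \<comment> \<open>The product rule on the left-hand side also produces
      \<open>f p * v ?\<beta>\<close>, so the derivative of the cutoff drops out.\<close>
    finally have "v f = (\<Sum>i\<in>Basis. G i (x p) * v (\<psi> i))"
      using \<beta> \<psi> g tangent_mult[OF v \<beta>(1) f] by simp
    then show "v f = (\<Sum>i\<in>Basis. v (\<psi> i) * frechet_derivative ?f (at (x p)) i)"
      by (simp add: G(2) mult.commute)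
  qed
qed

section \<open>Smooth vector fields and cut-off coordinate frames\<close>

lemma vector_fieldD: "X \<in> \<XX> \<Longrightarrow> X q \<in> tangent_space A q"
  "X \<in> \<XX> \<Longrightarrow> f \<in> C \<Longrightarrow> (\<lambda>q. X q f) \<in> C"
  unfolding vector_fields_def by auto

lemma field_add: "X \<in> \<XX> \<Longrightarrow> Y \<in> \<XX> \<Longrightarrow> X + Y \<in> \<XX>"
  unfolding vector_fields_def
  by (auto simp: fun_ops subspace_add[OF tangent_space_subspace] smooth_add)

lemma field_scale: "f \<in> C \<Longrightarrow> X \<in> \<XX> \<Longrightarrow> f \<cdot>\<^sub>F X \<in> \<XX>"
  unfolding vector_fields_def
  by (auto simp: fun_scale_def subspace_scale[OF tangent_space_subspace])
    (auto simp: scaleR_fun_def smooth_mult)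

lemma field_minus: "X \<in> \<XX> \<Longrightarrow> - X \<in> \<XX>"
  using field_scale[OF smooth_const[of "-1"], of X] by (simp add: fun_scale_def fun_Compl_def)

lemma field_diff: "X \<in> \<XX> \<Longrightarrow> Y \<in> \<XX> \<Longrightarrow> X - Y \<in> \<XX>"
  using field_add[of X "- Y"] field_minus[of Y] by simp

lemma field_zero: "0 \<in> \<XX>"
  unfolding vector_fields_def by (auto simp: zero_fun_def subspace_0[OF tangent_space_subspace, simplified zero_fun_def] smooth_const)

lemma field_sum: "(\<And>i. i \<in> I \<Longrightarrow> X i \<in> \<XX>) \<Longrightarrow> (\<Sum>i\<in>I. X i) \<in> \<XX>"
  by (induction I rule: infinite_finite_induct) (auto intro: field_zero field_add)

lemma apply_field_smooth: "X \<in> \<XX> \<Longrightarrow> f \<in> C \<Longrightarrow> apply_field X f \<in> C"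
  unfolding apply_field_def by (rule vector_fieldD)

lemma chart_has_derivative:
  assumes "f \<in> C" "(U, x) \<in> A" "p \<in> U"
  shows "((f \<circ> inv_into U x) has_derivative frechet_derivative (f \<circ> inv_into U x) (at (x p))) (at (x p))"
  using smooth_on_has_derivative[OF smooth_function_chart[OF assms(1,2)]] assms(3) by blast

text \<open>With a bump \<open>\<beta>\<close> supported in a chart with coordinates \<open>x\<^sub>i\<close>, the fields \<open>E\<^sub>i = \<beta> \<partial>\<^sub>i\<close> and the
  forms \<open>a\<^sub>i(X) = \<beta> X(\<beta> x\<^sub>i) - \<beta> x\<^sub>i X(\<beta>)\<close>, which equal \<open>\<beta>\<^sup>2 dx\<^sub>i\<close>, are globally smooth, and
  \<open>\<beta>\<^sup>3 X = \<Sum>\<^sub>i a\<^sub>i(X) E\<^sub>i\<close>.\<close>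

lemma frame_exists:
  obtains E :: "'b \<Rightarrow> 'a vector_field" and a w where
    "\<And>i. E i \<in> \<XX>" "\<And>i. one_form A (a i)" "w \<in> C" "w q = 1"
    "\<And>X p. X \<in> \<XX> \<Longrightarrow> w p *\<^sub>R X p = (\<Sum>i\<in>Basis. a i X p *\<^sub>R E i p)"
    "\<And>i X Y p. X p = Y p \<Longrightarrow> a i X p = a i Y p"
    "\<And>v. v \<in> tangent_space A q \<Longrightarrow> \<exists>c. v = (\<Sum>i\<in>Basis. c i *\<^sub>R E i q)"
    "\<And>i. i \<in> Basis \<Longrightarrow> a i (E i) q = 1"
proof -
  obtain U x where U: "(U, x) \<in> A" "q \<in> U" by (rule chart_at)
  obtain r where r: "r > 0" "cball (x q) r \<subseteq> x ` U"
    using chartD(2)[OF U(1)] U(2) open_contains_cball by blast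
  obtain b where b: "smooth_on UNIV b" "b (x q) = 1" "\<And>z. z \<notin> cball (x q) r \<Longrightarrow> b z = (0::real)"
    using bump_exists[of r "x q"] r(1) by auto
  have inv: "inv_into U x (x p) = p" if "p \<in> U" for p
    using chartD(3)[OF U(1)] that by simp
  define ext where "ext F = (\<lambda>p. if p \<in> U then b (x p) * F (x p) else 0)" for F :: "'b \<Rightarrow> real"
  have ext: "ext F \<in> C" if "smooth_on (x ` U) F" for F
  proof -
    have "(\<lambda>p. if p \<in> U \<and> x p \<in> x ` U then b (x p) * F (x p) else 0) \<in> C"
    proof (rule chart_extension[OF U(1) chartD(2)[OF U(1)] subset_refl])
      show "smooth_on (x ` U) (\<lambda>z. b z * F z)"
        using that b(1) Ck_on_subset[of _ UNIV b] chartD(2)[OF U(1)] unfolding smooth_on_def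
        by (blast intro: Ck_on_mult)
    qed (use r b(3) in auto)
    moreover have "ext F = (\<lambda>p. if p \<in> U \<and> x p \<in> x ` U then b (x p) * F (x p) else 0)"
      by (auto simp: ext_def)
    ultimately show ?thesis by simp
  qed
  define \<beta> where "\<beta> = ext (\<lambda>z. 1)"
  define c where "c i = ext (\<lambda>z. z \<bullet> i)" for i
  have \<beta>: "\<beta> \<in> C" unfolding \<beta>_def by (rule ext) (simp add: smooth_on_def Ck_on_const)
  have c: "c i \<in> C" for i
    unfolding c_def by (rule ext) (simp add: smooth_on_def Ck_on_inner_left Ck_on_ident chartD(2)[OF U(1)])
  let ?d = "\<lambda>f p. frechet_derivative (f \<circ> inv_into U x) (at (x p))"
  have D: "((f \<circ> inv_into U x) has_derivative ?d f p) (at (x p))" if "f \<in> C" "p \<in> U" for f p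
    using chart_has_derivative[OF that(1) U(1) that(2)] .
  have d_add: "?d (\<lambda>r. f r + h r) p i = ?d f p i + ?d h p i"
    if "f \<in> C" "h \<in> C" "p \<in> U" for f h p i
    using fun_cong[OF frechet_derivative_at[OF has_derivative_add[OF D[OF that(1,3)] D[OF that(2,3)]]], of i]
    by (simp add: o_def)
  have d_mult: "?d (\<lambda>r. f r * h r) p i = f p * ?d h p i + h p * ?d f p i"
    if "f \<in> C" "h \<in> C" "p \<in> U" for f h p i
    using fun_cong[OF frechet_derivative_at[OF has_derivative_mult[OF D[OF that(1,3)] D[OF that(2,3)]]], of i]
    by (simp add: o_def inv[OF that(3)] mult.commute)
  have d_const: "?d (\<lambda>r. k) p i = 0" for k p i
    by (simp add: o_def)
  define E where "E i p f = (if f \<in> C then ext (\<lambda>z. frechet_derivative (f \<circ> inv_into U x) (at z) i) p else 0)"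
    for i p f
  have E_at: "E i p f = (if p \<in> U then b (x p) * ?d f p i else 0)" if "f \<in> C" for i p f
    using that by (simp add: E_def ext_def)
  have E_tangent: "E i p \<in> tangent_space A p" for i p
  proof -
    have "E i p (\<lambda>r. k * f r) = k * E i p f" if "f \<in> C" for k f
      using that smooth_cmult[OF that, of k] d_mult[OF smooth_const that, of p k i]
      by (simp add: E_at d_const)
    then show ?thesis
      unfolding tangent_space_def
      by (auto simp: E_at smooth_add smooth_mult d_add d_mult algebra_simps) (simp add: E_def)
  qed
  have E: "E i \<in> \<XX>" for i
  proof -
    have "(\<lambda>p. E i p f) \<in> C" if "f \<in> C" for f
      using ext[OF smooth_on_derivative[OF smooth_function_chart[OF that U(1)]]] that
      by (simp add: E_def)
    then show ?thesis using E_tangent by (simp add: vector_fields_def)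
  qed
  define a where "a i X p = \<beta> p * X p (c i) - c i p * X p \<beta>" for i and X :: "'a vector_field" and p
  have a: "one_form A (a i)" for i
    unfolding one_form_def function_linear_def a_def
    using \<beta> c vector_fieldD(2)
    by (auto simp: fun_ops algebra_simps fun_eq_iff intro!: smooth_intros)
  define w where "w p = \<beta> p * \<beta> p * \<beta> p" for p
  have w: "w \<in> C" "w q = 1"
    unfolding w_def using \<beta> b(2) U(2)
    by (intro smooth_mult, simp_all) (simp add: \<beta>_def ext_def)
  \<comment> \<open>As \<open>c i\<close> is \<open>\<beta>\<close> times a coordinate, its
    derivative contains that of \<open>\<beta>\<close>; the second term of \<open>a i\<close> is
    there to cancel it.\<close>
  have dc: "?d (c i) p j = ?d \<beta> p j * (x p \<bullet> i) + \<beta> p * (j \<bullet> i)" if p: "p \<in> U" for i j p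
  proof -
    have "((\<lambda>z. (\<beta> \<circ> inv_into U x) z * (z \<bullet> i)) has_derivative
        (\<lambda>j. (\<beta> \<circ> inv_into U x) (x p) * (j \<bullet> i) + ?d \<beta> p j * (x p \<bullet> i))) (at (x p))"
      by (intro has_derivative_mult D[OF \<beta> p] has_derivative_inner_left has_derivative_ident)
    then have "((c i \<circ> inv_into U x) has_derivative
        (\<lambda>j. (\<beta> \<circ> inv_into U x) (x p) * (j \<bullet> i) + ?d \<beta> p j * (x p \<bullet> i))) (at (x p))"
      by (rule has_derivative_transform_within_open[OF _ chartD(2)[OF U(1)]])
        (use p inv in \<open>auto simp: c_def \<beta>_def ext_def\<close>)
    from fun_cong[OF frechet_derivative_at[OF this], of j] show ?thesis
      using inv[OF p] by simp
  qed
  have rep: "w p *\<^sub>R v = (\<Sum>i\<in>Basis. (\<beta> p * v (c i) - c i p * v \<beta>) *\<^sub>R E i p)"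
    if v: "v \<in> tangent_space A p" for v p
  proof
    fix f
    show "(w p *\<^sub>R v) f = (\<Sum>i\<in>Basis. (\<beta> p * v (c i) - c i p * v \<beta>) *\<^sub>R E i p) f"
    proof (cases "f \<in> C \<and> p \<in> U")
      case True
      then have f: "f \<in> C" and p: "p \<in> U" by auto
      obtain k where k: "\<And>f. f \<in> C \<Longrightarrow> v f = (\<Sum>i\<in>Basis. k i * ?d f p i)"
        using tangent_coordinates[OF U(1) p v] by blast
      have "v (c i) = v \<beta> * (x p \<bullet> i) + \<beta> p * k i" if "i \<in> Basis" for i
        unfolding k[OF c] k[OF \<beta>] dc[OF p]
        using that by (simp add: algebra_simps sum.distrib sum_distrib_left sum_distrib_right inner_Basis
            if_distrib[of "\<lambda>u. _ * u"] sum.delta cong: if_cong)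
      moreover have "c i p = \<beta> p * (x p \<bullet> i)" for i
        by (simp add: c_def \<beta>_def ext_def)
      ultimately have "\<beta> p * v (c i) - c i p * v \<beta> = \<beta> p * \<beta> p * k i" if "i \<in> Basis" for i
        using that by (simp add: algebra_simps)
      moreover have "E i p f = \<beta> p * ?d f p i" for i
        using p f by (simp add: E_at \<beta>_def ext_def)
      ultimately show ?thesis
        by (simp add: sum_fun_apply scaleR_fun_def k[OF f] w_def sum_distrib_left mult.assoc mult.left_commute)
    next
      case False
      \<comment> \<open>Off the chart the cutoffs vanish; on nonsmooth functions tangent vectors are
        0 by convention.\<close>
      then consider "f \<notin> C" | "p \<notin> U" by blast
      then show ?thesis
        by cases (simp_all add: sum_fun_apply scaleR_fun_def tangent_nonsmooth[OF v] E_def w_def \<beta>_def c_def ext_def)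
    qed
  qed
  show thesis
  proof (rule that[of E a w])
    show "w p *\<^sub>R X p = (\<Sum>i\<in>Basis. a i X p *\<^sub>R E i p)" if "X \<in> \<XX>" for X p
      using rep[OF vector_fieldD(1)[OF that]] by (simp add: a_def)
    show "\<exists>c. v = (\<Sum>i\<in>Basis. c i *\<^sub>R E i q)" if "v \<in> tangent_space A q" for v
      using rep[OF that] w(2) by (intro exI[of _ "\<lambda>i. \<beta> q * v (c i) - c i q * v \<beta>"]) simp
    show "a i (E i) q = 1" if "i \<in> Basis" for i
      using that U(2) b(2) dc[OF U(2), of i i]
      by (simp add: a_def E_at \<beta> c) (simp add: c_def \<beta>_def ext_def)
    show "a i X p = a i Y p" if "X p = Y p" for i X Y p
      using that by (simp add: a_def)
  qed (use E a w in auto)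
qed

end


section \<open>Orthonormal expansions\<close>

text \<open>Gram-Schmidt for a product \<open>G\<close> whose properties are known on
  \<open>W\<close>, adjoining one generator at a time. A trace uses the expansion, so the family is
  characterised by it instead of by orthonormality.\<close>

lemma orthonormal_expansion:
  fixes G :: "'v::real_vector \<Rightarrow> 'v \<Rightarrow> real"
  assumes W: "subspace W" and "finite S" "S \<subseteq> W"
    and add: "\<And>u v w. u \<in> W \<Longrightarrow> v \<in> W \<Longrightarrow> w \<in> W \<Longrightarrow> G u (v + w) = G u v + G u w"
    and scale: "\<And>u v c. u \<in> W \<Longrightarrow> v \<in> W \<Longrightarrow> G u (c *\<^sub>R v) = c * G u v"
    and sym: "\<And>u v. u \<in> W \<Longrightarrow> v \<in> W \<Longrightarrow> G u v = G v u"
    and pos: "\<And>v. v \<in> W \<Longrightarrow> v \<noteq> 0 \<Longrightarrow> G v v > 0"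
  shows "\<exists>N. finite N \<and> N \<subseteq> span S \<and> (\<forall>v\<in>span S. v = (\<Sum>e\<in>N. G e v *\<^sub>R e))"
  using \<open>finite S\<close> \<open>S \<subseteq> W\<close>
proof (induction S)
  case empty
  then show ?case by (intro exI[of _ "{}"]) simp
next
  case (insert x S)
  then obtain N where N: "finite N" "N \<subseteq> span S" "\<And>v. v \<in> span S \<Longrightarrow> v = (\<Sum>e\<in>N. G e v *\<^sub>R e)"
    by auto
  have SW: "span S \<subseteq> W" and xW: "x \<in> W"
    using insert.prems W span_minimal[of S W] by auto
  have zero: "G u 0 = 0" if "u \<in> W" for u
    using scale[OF that that, of 0] by simp
  have sum: "finite J \<Longrightarrow> (\<And>j. j \<in> J \<Longrightarrow> v j \<in> W) \<Longrightarrow> G u (\<Sum>j\<in>J. c j *\<^sub>R v j) = (\<Sum>j\<in>J. c j * G u (v j))"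
    if "u \<in> W" for J :: "'v set" and u c v
    by (induction J rule: finite_induct)
      (auto simp: zero that add[OF that] scale[OF that] subspace_scale[OF W] subspace_sum[OF W])
  define x' where "x' = x - (\<Sum>e\<in>N. G e x *\<^sub>R e)"
  define u where "u = (\<Sum>e\<in>N. G e x *\<^sub>R e)"
  have u: "u \<in> span S" "u \<in> W"
    using N(2) SW by (auto simp: u_def intro!: span_sum span_scale)
  have x'W: "x' \<in> W" and xu: "x = x' + u"
    using u xW W by (auto simp: x'_def u_def subspace_diff)
  have xspan: "x' \<in> span (insert x S)"
    using u(1) by (auto simp: x'_def simp flip: u_def intro: span_diff span_base span_mono[THEN subsetD, of S])
  \<comment> \<open>Orthonormality of \<open>N\<close> is not at hand; symmetry of \<open>G\<close>
    and the expansion of \<open>v\<close> give \<open>G v u = G v x\<close> without it.\<close>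
  have orth: "G v x' = 0" if "v \<in> span S" for v
  proof -
    have vW: "v \<in> W" using that SW by auto
    have "G v u = (\<Sum>e\<in>N. G e x * G v e)"
      unfolding u_def using N SW vW by (intro sum) auto
    also have "\<dots> = (\<Sum>e\<in>N. G e v * G x e)"
      using N(2) SW vW xW sym by (intro sum.cong refl) (metis mult.commute subsetD)
    also have "\<dots> = G x (\<Sum>e\<in>N. G e v *\<^sub>R e)"
      using N SW xW by (intro sum[symmetric]) auto
    also have "\<dots> = G v x"
      using N(3)[OF that] sym xW vW by simp
    finally show ?thesis
      using xu add[OF vW x'W u(2)] by simp
  qed
  have span_insert_cases: "\<exists>k z. v = k *\<^sub>R x' + z \<and> z \<in> span S" if v: "v \<in> span (insert x S)" for v
  proof -
    obtain k where k: "v - k *\<^sub>R x \<in> span S"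
      using v by (auto simp: span_insert)
    then have "(v - k *\<^sub>R x) + k *\<^sub>R u \<in> span S"
      using u(1) by (intro span_add span_scale)
    moreover have "v = k *\<^sub>R x' + ((v - k *\<^sub>R x) + k *\<^sub>R u)"
      by (simp add: xu algebra_simps)
    ultimately show ?thesis by blast
  qed
  have expand: "(\<Sum>e\<in>N. G e (k *\<^sub>R x' + z) *\<^sub>R e) = z" if z: "z \<in> span S" for k z
  proof -
    have "G e (k *\<^sub>R x' + z) = G e z" if "e \<in> N" for e
    proof -
      have e: "e \<in> span S" "e \<in> W" "z \<in> W" using that N(2) SW z by auto
      show ?thesis
        using add[OF e(2) subspace_scale[OF W x'W] e(3), of k] scale[OF e(2) x'W, of k] orth[OF e(1)] by simp
    qed
    then show ?thesis using N(3)[OF z] by simp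
  qed
  show ?case
  proof (cases "x' = 0")
    case True
    have "v \<in> span S" if "v \<in> span (insert x S)" for v
      using span_insert_cases[OF that] True by auto
    then have "span (insert x S) = span S"
      by (auto intro: span_mono[THEN subsetD, of S])
    then show ?thesis using N by blast
  next
    case False
    define s where "s = sqrt (G x' x')"
    have s: "s > 0" "s * s = G x' x'"
      using pos[OF x'W False] by (simp_all add: s_def)
    define e' where "e' = (1 / s) *\<^sub>R x'"
    have e'W: "e' \<in> W" using x'W W by (simp add: e'_def subspace_scale)
    have e'G: "G e' (k *\<^sub>R x' + z) = k * s" if z: "z \<in> span S" for k z
    proof -
      have zW: "z \<in> W" using z SW by auto
      have "G x' e' = s"
        using scale[OF x'W x'W, of "1 / s"] s(1) by (simp add: e'_def flip: s(2))
      moreover have "G z e' = 0"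
        using scale[OF zW x'W, of "1 / s"] orth[OF z] by (simp add: e'_def)
      ultimately show ?thesis
        using add[OF e'W subspace_scale[OF W x'W] zW, of k] scale[OF e'W x'W, of k]
          sym[OF e'W x'W] sym[OF e'W zW] by simp
    qed
    have "e' \<notin> N"
    proof
      assume "e' \<in> N"
      then have "e' \<in> span S" using N(2) by auto
      from orth[OF this] e'G[OF span_zero, of 1] s(1) show False by simp
    qed
    then have "v = (\<Sum>e\<in>insert e' N. G e v *\<^sub>R e)" if v: "v \<in> span (insert x S)" for v
    proof -
      obtain k z where kz: "v = k *\<^sub>R x' + z" "z \<in> span S"
        using span_insert_cases[OF v] by blast
      then show ?thesis
        using \<open>e' \<notin> N\<close> N(1) expand[OF kz(2)] e'G[OF kz(2)] s(1) by (simp add: e'_def)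
    qed
    moreover have "insert e' N \<subseteq> span (insert x S)"
      using N(2) xspan span_mono[of S "insert x S"] by (auto simp: e'_def intro: span_scale)
    ultimately show ?thesis using N(1) by (intro exI[of _ "insert e' N"]) auto
  qed
qed


section \<open>Tensor fields at a point, traces and Lie derivatives\<close>

context smooth_manifold
begin

lemma function_linear_scale: "function_linear A L \<Longrightarrow> f \<in> C \<Longrightarrow> X \<in> \<XX> \<Longrightarrow> L (f \<cdot>\<^sub>F X) = f \<cdot>\<^sub>F L X"
  and function_linear_add: "function_linear A L \<Longrightarrow> X \<in> \<XX> \<Longrightarrow> Y \<in> \<XX> \<Longrightarrow> L (X + Y) = L X + L Y"
  unfolding function_linear_def by auto

lemma function_linear_zero: "function_linear A L \<Longrightarrow> L 0 = 0"
  using function_linear_scale[of L "\<lambda>_. 0" 0] smooth_const field_zero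
  by (simp add: fun_scale_def zero_fun_def)

lemma function_linear_minus: "function_linear A L \<Longrightarrow> X \<in> \<XX> \<Longrightarrow> L (- X) = - L X"
  using function_linear_scale[of L "\<lambda>_. -1" X] smooth_const by (simp add: fun_scale_def fun_Compl_def)

lemma function_linear_diff:
  "function_linear A L \<Longrightarrow> X \<in> \<XX> \<Longrightarrow> Y \<in> \<XX> \<Longrightarrow> L (X - Y) = L X - L Y"
  using function_linear_add[of L X "- Y"] function_linear_minus[of L Y] field_minus[of Y] by simp

lemma function_linear_sum:
  assumes "function_linear A L"
  shows "(\<And>i. i \<in> I \<Longrightarrow> X i \<in> \<XX>) \<Longrightarrow> L (\<Sum>i\<in>I. X i) = (\<Sum>i\<in>I. L (X i))"
  by (induction I rule: infinite_finite_induct)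
    (auto simp: function_linear_zero[OF assms] function_linear_add[OF assms] field_sum)

lemma one_formD: "one_form A \<alpha> \<Longrightarrow> X \<in> \<XX> \<Longrightarrow> \<alpha> X \<in> C"
  "one_form A \<alpha> \<Longrightarrow> function_linear A \<alpha>"
  unfolding one_form_def by auto

lemma endomorphismD: "endomorphism_field A L \<Longrightarrow> X \<in> \<XX> \<Longrightarrow> L X \<in> \<XX>"
  "endomorphism_field A L \<Longrightarrow> function_linear A L"
  unfolding endomorphism_field_def by auto

text \<open>Tensoriality: in \<open>w X = \<Sum>\<^sub>i a\<^sub>i(X) E\<^sub>i\<close> all
  coefficients vanish at \<open>q\<close>, and linearity over the smooth functions passes this on to
  \<open>L X\<close>.\<close>

lemma function_linear_vanish:
  assumes L: "function_linear A L" and X: "X \<in> \<XX>" and 0: "X q = 0"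
  shows "L X q = 0"
proof -
  obtain E :: "'b \<Rightarrow> 'a vector_field" and a w where fr:
    "\<And>i. E i \<in> \<XX>" "\<And>i. one_form A (a i)" "w \<in> C" "w q = 1"
    "\<And>X p. X \<in> \<XX> \<Longrightarrow> w p *\<^sub>R X p = (\<Sum>i\<in>Basis. a i X p *\<^sub>R E i p)"
    "\<And>i X Y p. X p = Y p \<Longrightarrow> a i X p = a i Y p"
    by (rule frame_exists[of q]) blast
  have a0: "a i X q = 0" for i
    using fr(6)[of X q 0] 0 function_linear_zero[OF one_formD(2)[OF fr(2)]] by simp
  have aX: "a i X \<in> C" for i by (rule one_formD(1)[OF fr(2) X])
  have "w \<cdot>\<^sub>F X = (\<Sum>i\<in>Basis. a i X \<cdot>\<^sub>F E i)"
    by (rule ext) (simp add: fun_scale_def sum_fun_apply fr(5)[OF X])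
  then have "w \<cdot>\<^sub>F L X = (\<Sum>i\<in>Basis. a i X \<cdot>\<^sub>F L (E i))"
    using function_linear_sum[OF L, of Basis "\<lambda>i. a i X \<cdot>\<^sub>F E i"] function_linear_scale[OF L fr(3) X]
      function_linear_scale[OF L aX fr(1)] field_scale[OF aX fr(1)]
    by simp
  from fun_cong[OF this, of q] show ?thesis
    by (simp add: fun_scale_def sum_fun_apply fr(4) a0)
qed

lemma function_linear_local:
  assumes "function_linear A L" "X \<in> \<XX>" "Y \<in> \<XX>" "X q = Y q"
  shows "L X q = L Y q"
  using function_linear_vanish[OF assms(1) field_diff[OF assms(2,3)], of q] assms
  by (simp add: function_linear_diff)

lemma function_linear_combination:
  assumes L: "function_linear A L" and X: "X \<in> \<XX>" and Y: "\<And>j. j \<in> J \<Longrightarrow> Y j \<in> \<XX>"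
    and eq: "k *\<^sub>R X q = (\<Sum>j\<in>J. c j *\<^sub>R Y j q)"
  shows "k *\<^sub>R L X q = (\<Sum>j\<in>J. c j *\<^sub>R L (Y j) q)"
proof -
  have "L ((\<lambda>_. k) \<cdot>\<^sub>F X) q = L (\<Sum>j\<in>J. (\<lambda>_. c j) \<cdot>\<^sub>F Y j) q"
    using eq by (intro function_linear_local[OF L] field_scale field_sum smooth_const X Y)
      (auto simp: fun_scale_def sum_fun_apply)
  then show ?thesis
    using L X Y by (simp add: function_linear_sum field_scale smooth_const function_linear_scale)
      (simp add: fun_scale_def sum_fun_apply)
qed

lemma tangent_extend:
  assumes "v \<in> tangent_space A q"
  obtains X where "X \<in> \<XX>" "X q = v"
proof -
  obtain E :: "'b \<Rightarrow> 'a vector_field" and a w where fr: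
    "\<And>i. E i \<in> \<XX>" "\<And>i. one_form A (a i)" "w \<in> C" "w q = 1"
    "\<And>X p. X \<in> \<XX> \<Longrightarrow> w p *\<^sub>R X p = (\<Sum>i\<in>Basis. a i X p *\<^sub>R E i p)"
    "\<And>i X Y p. X p = Y p \<Longrightarrow> a i X p = a i Y p"
    "\<And>v. v \<in> tangent_space A q \<Longrightarrow> \<exists>c. v = (\<Sum>i\<in>Basis. c i *\<^sub>R E i q)"
    by (rule frame_exists[of q]) blast
  obtain c where "v = (\<Sum>i\<in>Basis. c i *\<^sub>R E i q)"
    using fr(7)[OF assms] by (rule exE)
  then show ?thesis
    by (intro that[of "\<Sum>i\<in>Basis. (\<lambda>_. c i) \<cdot>\<^sub>F E i"] field_sum field_scale smooth_const fr(1))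
      (simp add: fun_scale_def sum_fun_apply)
qed

text \<open>The choice made in \<open>endomorphism_at\<close>, named so that traces can be folded
  into it.\<close>

definition ext_field :: "'a \<Rightarrow> 'a tangent_vector \<Rightarrow> 'a vector_field" where
  "ext_field q v = (SOME X. X \<in> \<XX> \<and> X q = v)"

lemma ext_field:
  assumes "v \<in> tangent_space A q"
  shows "ext_field q v \<in> \<XX>" "ext_field q v q = v"
  using someI_ex[of "\<lambda>X. X \<in> \<XX> \<and> X q = v"] tangent_extend[OF assms] unfolding ext_field_def by blast+

lemma tangent_finite_span:
  obtains S where "finite S" "S \<subseteq> tangent_space A q" "span S = tangent_space A q"
proof -
  obtain E :: "'b \<Rightarrow> 'a vector_field" and a w where fr:
    "\<And>i. E i \<in> \<XX>" "\<And>i. one_form A (a i)" "w \<in> C" "w q = 1"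
    "\<And>X p. X \<in> \<XX> \<Longrightarrow> w p *\<^sub>R X p = (\<Sum>i\<in>Basis. a i X p *\<^sub>R E i p)"
    "\<And>i X Y p. X p = Y p \<Longrightarrow> a i X p = a i Y p"
    "\<And>v. v \<in> tangent_space A q \<Longrightarrow> \<exists>c. v = (\<Sum>i\<in>Basis. c i *\<^sub>R E i q)"
    by (rule frame_exists[of q]) blast
  have sub: "(\<lambda>i. E i q) ` Basis \<subseteq> tangent_space A q"
    using vector_fieldD(1)[OF fr(1)] by blast
  have "v \<in> span ((\<lambda>i. E i q) ` Basis)" if v: "v \<in> tangent_space A q" for v
  proof -
    obtain c where "v = (\<Sum>i\<in>Basis. c i *\<^sub>R E i q)" using fr(7)[OF v] by blast
    then show ?thesis by (simp add: span_sum span_scale span_base)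
  qed
  then show ?thesis
    using sub span_minimal[OF sub tangent_space_subspace] by (intro that[of "(\<lambda>i. E i q) ` Basis"]) auto
qed

text \<open>The pairs of \<open>a i\<close> and \<open>E i\<close> need not come from a basis, and
  \<open>k\<close> may be 0. This freedom serves cut-off frames, orthonormal families and
  differentiated frame expansions. Basis vectors are expanded by the \<open>E i\<close>, each
  \<open>L (E i)\<close> by the basis, and the two sums are swapped.\<close>

lemma trace_formula:
  assumes L: "endomorphism_field A L" and E: "\<And>i. i \<in> I \<Longrightarrow> E i \<in> \<XX>"
    and a: "\<And>i. i \<in> I \<Longrightarrow> one_form A (a i)"
    and rep: "\<And>X. X \<in> \<XX> \<Longrightarrow> k *\<^sub>R X q = (\<Sum>i\<in>I. a i X q *\<^sub>R E i q)"
  shows "k * trace_field A L q = (\<Sum>i\<in>I. a i (L (E i)) q)"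
proof -
  let ?T = "tangent_space A q"
  note Lf = endomorphismD(2)[OF L]
  define B where "B = (SOME B. B \<subseteq> ?T \<and> independent B \<and> ?T \<subseteq> span B)"
  have "B \<subseteq> ?T \<and> independent B \<and> ?T \<subseteq> span B"
    unfolding B_def by (rule someI_ex) (use maximal_independent_subset[of ?T] in metis)
  then have B: "B \<subseteq> ?T" "independent B" "?T \<subseteq> span B" by auto
  obtain S where S: "finite S" "span S = ?T" by (rule tangent_finite_span)
  have "finite B"
    using independent_span_bound[OF S(1) B(2)] B(1) S(2) by simp
  let ?R = "representation B"
  have LX: "L X q \<in> span B" if "X \<in> \<XX>" for X
    using vector_fieldD(1)[OF endomorphismD(1)[OF L that]] B(3) by blast
  have tr: "trace_field A L q = (\<Sum>b\<in>B. ?R (L (ext_field q b) q) b)"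
    by (simp add: trace_field_def trace_on_def Let_def endomorphism_at_def flip: B_def ext_field_def)
  have Lb: "k * ?R (L (ext_field q b) q) b = (\<Sum>i\<in>I. a i (ext_field q b) q * ?R (L (E i) q) b)"
    if "b \<in> B" for b
  proof -
    have bX: "ext_field q b \<in> \<XX>" using ext_field that B(1) by blast
    have "k *\<^sub>R L (ext_field q b) q = (\<Sum>i\<in>I. a i (ext_field q b) q *\<^sub>R L (E i) q)"
      by (rule function_linear_combination[OF Lf bX E rep[OF bX]])
    then have "?R (k *\<^sub>R L (ext_field q b) q) b = ?R (\<Sum>i\<in>I. a i (ext_field q b) q *\<^sub>R L (E i) q) b"
      by simp
    then show ?thesis
      using LX E bX by (simp add: representation_scale[OF B(2)] representation_sum[OF B(2)] span_scale)
  qed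
  have aL: "a i (L (E i)) q = (\<Sum>b\<in>B. ?R (L (E i) q) b * a i (ext_field q b) q)" if i: "i \<in> I" for i
  proof -
    have "1 *\<^sub>R L (E i) q = (\<Sum>b\<in>B. ?R (L (E i) q) b *\<^sub>R b)"
      using sum_representation_eq[OF B(2) LX[OF E[OF i]] \<open>finite B\<close> subset_refl] by simp
    also have "\<dots> = (\<Sum>b\<in>B. ?R (L (E i) q) b *\<^sub>R ext_field q b q)"
      using ext_field(2) B(1) by (intro sum.cong) auto
    finally show ?thesis
      using function_linear_combination[OF one_formD(2)[OF a[OF i]] endomorphismD(1)[OF L E[OF i]],
          of B "ext_field q" 1 q "?R (L (E i) q)"] ext_field(1) B(1) by fastforce
  qed
  have "k * trace_field A L q = (\<Sum>b\<in>B. \<Sum>i\<in>I. a i (ext_field q b) q * ?R (L (E i) q) b)"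
    unfolding tr sum_distrib_left by (intro sum.cong refl Lb)
  also have "\<dots> = (\<Sum>i\<in>I. \<Sum>b\<in>B. ?R (L (E i) q) b * a i (ext_field q b) q)"
    by (subst sum.swap) (simp add: mult.commute)
  finally show ?thesis using aL by simp
qed

text \<open>At \<open>q\<close> itself the cutoff is 1. The last property yields the trace of the
  identity without showing that the vectors \<open>E i q\<close> are independent.\<close>

lemma frame_at:
  obtains E :: "'b \<Rightarrow> 'a vector_field" and a where
    "\<And>i. E i \<in> \<XX>" "\<And>i. one_form A (a i)"
    "\<And>X. X \<in> \<XX> \<Longrightarrow> X q = (\<Sum>i\<in>Basis. a i X q *\<^sub>R E i q)"
    "\<And>L. endomorphism_field A L \<Longrightarrow> trace_field A L q = (\<Sum>i\<in>Basis. a i (L (E i)) q)"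
    "(\<Sum>i\<in>Basis. a i (E i) q) = real DIM('b)"
proof -
  obtain E :: "'b \<Rightarrow> 'a vector_field" and a w where fr:
    "\<And>i. E i \<in> \<XX>" "\<And>i. one_form A (a i)" "w \<in> C" "w q = 1"
    "\<And>X p. X \<in> \<XX> \<Longrightarrow> w p *\<^sub>R X p = (\<Sum>i\<in>Basis. a i X p *\<^sub>R E i p)"
    "\<And>i. i \<in> Basis \<Longrightarrow> a i (E i) q = 1"
    by (rule frame_exists[of q]) blast
  have rep: "1 *\<^sub>R X q = (\<Sum>i\<in>Basis. a i X q *\<^sub>R E i q)" if "X \<in> \<XX>" for X
    using fr(5)[OF that, of q] fr(4) by simp
  show ?thesis
  proof (rule that[of E a])
    show "trace_field A L q = (\<Sum>i\<in>Basis. a i (L (E i)) q)" if "endomorphism_field A L" for L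
      using trace_formula[OF that fr(1,2) rep] by simp
    show "X q = (\<Sum>i\<in>Basis. a i X q *\<^sub>R E i q)" if "X \<in> \<XX>" for X
      using rep[OF that] by simp
  qed (use fr in auto)
qed

section \<open>Algebra of endomorphism fields and their traces\<close>

lemma function_linearI:
  assumes "\<And>X Y q. X \<in> \<XX> \<Longrightarrow> Y \<in> \<XX> \<Longrightarrow> L (X + Y) q = L X q + L Y q"
    and "\<And>f X q. f \<in> C \<Longrightarrow> X \<in> \<XX> \<Longrightarrow> L (f \<cdot>\<^sub>F X) q = f q *\<^sub>R L X q"
  shows "function_linear A L"
  unfolding function_linear_def using assms by (auto simp: fun_scale_def fun_eq_iff)

lemma endo_id: "endomorphism_field A (\<lambda>Z. Z)"
  unfolding endomorphism_field_def function_linear_def by auto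

lemma endo_comp:
  "endomorphism_field A L \<Longrightarrow> endomorphism_field A M \<Longrightarrow> endomorphism_field A (\<lambda>Z. L (M Z))"
  unfolding endomorphism_field_def function_linear_def by auto

lemma endo_add:
  "endomorphism_field A L \<Longrightarrow> endomorphism_field A M \<Longrightarrow> endomorphism_field A (\<lambda>Z. L Z + M Z)"
  unfolding endomorphism_field_def function_linear_def
  by (auto simp: field_add fun_scale_def scaleR_add_right fun_eq_iff)

lemma endo_scale:
  "f \<in> C \<Longrightarrow> endomorphism_field A L \<Longrightarrow> endomorphism_field A (\<lambda>Z. f \<cdot>\<^sub>F L Z)"
  unfolding endomorphism_field_def function_linear_def
  by (auto simp: field_scale) (auto simp: fun_scale_def scaleR_add_right fun_eq_iff mult.commute)

lemma endo_minus: "endomorphism_field A L \<Longrightarrow> endomorphism_field A (\<lambda>Z. - L Z)"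
  using endo_scale[OF smooth_const[of "-1"], of L] by (simp add: fun_scale_def fun_Compl_def)

lemma endo_diff:
  "endomorphism_field A L \<Longrightarrow> endomorphism_field A M \<Longrightarrow> endomorphism_field A (\<lambda>Z. L Z - M Z)"
  using endo_add[OF _ endo_minus, of L M] by simp

lemma endo_rank_one: "one_form A \<alpha> \<Longrightarrow> W \<in> \<XX> \<Longrightarrow> endomorphism_field A (\<lambda>Z. \<alpha> Z \<cdot>\<^sub>F W)"
  unfolding endomorphism_field_def one_form_def function_linear_def
  by (auto simp: field_scale) (auto simp: fun_scale_def scaleR_add_left fun_eq_iff)

lemma one_form_comp: "one_form A \<alpha> \<Longrightarrow> endomorphism_field A L \<Longrightarrow> one_form A (\<lambda>Z. \<alpha> (L Z))"
  unfolding endomorphism_field_def one_form_def function_linear_def by auto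

text \<open>Identities between tensor fields hold on smooth vector fields only, so they cannot
  simply be rewritten under the abstraction inside a trace.\<close>

lemma trace_cong:
  assumes "endomorphism_field A L" "endomorphism_field A M" "\<And>Z. Z \<in> \<XX> \<Longrightarrow> L Z = M Z"
  shows "trace_field A L q = trace_field A M q"
proof -
  obtain E :: "'b \<Rightarrow> 'a vector_field" and a where fr: "\<And>i. E i \<in> \<XX>" "\<And>i. one_form A (a i)"
    "\<And>X. X \<in> \<XX> \<Longrightarrow> X q = (\<Sum>i\<in>Basis. a i X q *\<^sub>R E i q)"
    "\<And>L. endomorphism_field A L \<Longrightarrow> trace_field A L q = (\<Sum>i\<in>Basis. a i (L (E i)) q)"
    "(\<Sum>i\<in>Basis. a i (E i) q) = real DIM('b)" by (rule frame_at[of q]) blast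
  show ?thesis using fr(4)[OF assms(1)] fr(4)[OF assms(2)] assms(3) fr(1) by simp
qed

lemma trace_add:
  assumes "endomorphism_field A L" "endomorphism_field A M"
  shows "trace_field A (\<lambda>Z. L Z + M Z) q = trace_field A L q + trace_field A M q"
proof -
  obtain E :: "'b \<Rightarrow> 'a vector_field" and a where fr: "\<And>i. E i \<in> \<XX>" "\<And>i. one_form A (a i)"
    "\<And>X. X \<in> \<XX> \<Longrightarrow> X q = (\<Sum>i\<in>Basis. a i X q *\<^sub>R E i q)"
    "\<And>L. endomorphism_field A L \<Longrightarrow> trace_field A L q = (\<Sum>i\<in>Basis. a i (L (E i)) q)"
    "(\<Sum>i\<in>Basis. a i (E i) q) = real DIM('b)" by (rule frame_at[of q]) blast
  show ?thesis
    using fr(1,2) assms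
    by (simp add: fr(4) endo_add function_linear_add[OF one_formD(2)[OF fr(2)]] endomorphismD(1) sum.distrib)
qed

lemma trace_scale:
  assumes "endomorphism_field A L" "f \<in> C"
  shows "trace_field A (\<lambda>Z. f \<cdot>\<^sub>F L Z) q = f q * trace_field A L q"
proof -
  obtain E :: "'b \<Rightarrow> 'a vector_field" and a where fr: "\<And>i. E i \<in> \<XX>" "\<And>i. one_form A (a i)"
    "\<And>X. X \<in> \<XX> \<Longrightarrow> X q = (\<Sum>i\<in>Basis. a i X q *\<^sub>R E i q)"
    "\<And>L. endomorphism_field A L \<Longrightarrow> trace_field A L q = (\<Sum>i\<in>Basis. a i (L (E i)) q)"
    "(\<Sum>i\<in>Basis. a i (E i) q) = real DIM('b)" by (rule frame_at[of q]) blast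
  show ?thesis
    using fr(1,2) assms
    by (simp add: fr(4) endo_scale function_linear_scale[OF one_formD(2)[OF fr(2)]] endomorphismD(1)
        sum_distrib_left) (simp add: fun_scale_def)
qed

lemma trace_minus: "endomorphism_field A L \<Longrightarrow> trace_field A (\<lambda>Z. - L Z) q = - trace_field A L q"
  using trace_scale[OF _ smooth_const[of "-1"], of L q] by (simp add: fun_scale_def fun_Compl_def)

lemma trace_diff:
  "endomorphism_field A L \<Longrightarrow> endomorphism_field A M \<Longrightarrow>
    trace_field A (\<lambda>Z. L Z - M Z) q = trace_field A L q - trace_field A M q"
  using trace_add[OF _ endo_minus, of L M q] trace_minus[of M q] by simp

lemma trace_id: "trace_field A (\<lambda>Z. Z) q = real DIM('b)"
proof -
  obtain E :: "'b \<Rightarrow> 'a vector_field" and a where fr: "\<And>i. E i \<in> \<XX>" "\<And>i. one_form A (a i)"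
    "\<And>X. X \<in> \<XX> \<Longrightarrow> X q = (\<Sum>i\<in>Basis. a i X q *\<^sub>R E i q)"
    "\<And>L. endomorphism_field A L \<Longrightarrow> trace_field A L q = (\<Sum>i\<in>Basis. a i (L (E i)) q)"
    "(\<Sum>i\<in>Basis. a i (E i) q) = real DIM('b)" by (rule frame_at[of q]) blast
  show ?thesis using fr(4)[OF endo_id] fr(5) by simp
qed

lemma trace_rank_one:
  assumes "one_form A \<alpha>" "W \<in> \<XX>"
  shows "trace_field A (\<lambda>Z. \<alpha> Z \<cdot>\<^sub>F W) q = \<alpha> W q"
proof -
  obtain E :: "'b \<Rightarrow> 'a vector_field" and a where fr: "\<And>i. E i \<in> \<XX>" "\<And>i. one_form A (a i)"
    "\<And>X. X \<in> \<XX> \<Longrightarrow> X q = (\<Sum>i\<in>Basis. a i X q *\<^sub>R E i q)"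
    "\<And>L. endomorphism_field A L \<Longrightarrow> trace_field A L q = (\<Sum>i\<in>Basis. a i (L (E i)) q)"
    "(\<Sum>i\<in>Basis. a i (E i) q) = real DIM('b)" by (rule frame_at[of q]) blast
  have "trace_field A (\<lambda>Z. \<alpha> Z \<cdot>\<^sub>F W) q = (\<Sum>i\<in>Basis. a i W q * \<alpha> (E i) q)"
    using fr(4)[OF endo_rank_one[OF assms]] function_linear_scale[OF one_formD(2)[OF fr(2)] one_formD(1)[OF assms(1) fr(1)] assms(2)]
    by (simp add: fun_scale_def mult.commute)
  also have "\<dots> = \<alpha> W q"
    using function_linear_combination[OF one_formD(2)[OF assms(1)] assms(2), of Basis E 1 q "\<lambda>i. a i W q"]
      fr(1) fr(3)[OF assms(2)] by simp
  finally show ?thesis .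
qed

lemma trace_commute:
  assumes L: "endomorphism_field A L" and M: "endomorphism_field A M"
  shows "trace_field A (\<lambda>Z. L (M Z)) q = trace_field A (\<lambda>Z. M (L Z)) q"
proof -
  obtain E :: "'b \<Rightarrow> 'a vector_field" and a where fr: "\<And>i. E i \<in> \<XX>" "\<And>i. one_form A (a i)"
    "\<And>X. X \<in> \<XX> \<Longrightarrow> X q = (\<Sum>i\<in>Basis. a i X q *\<^sub>R E i q)"
    "\<And>L. endomorphism_field A L \<Longrightarrow> trace_field A L q = (\<Sum>i\<in>Basis. a i (L (E i)) q)"
    "(\<Sum>i\<in>Basis. a i (E i) q) = real DIM('b)" by (rule frame_at[of q]) blast
  have expand: "trace_field A (\<lambda>Z. L (M Z)) q = (\<Sum>i\<in>Basis. \<Sum>j\<in>Basis. a j (M (E i)) q * a i (L (E j)) q)"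
    if L: "endomorphism_field A L" and M: "endomorphism_field A M" for L M
  proof -
    have "a i (L (M (E i))) q = (\<Sum>j\<in>Basis. a j (M (E i)) q * a i (L (E j)) q)" for i
      using function_linear_combination[OF one_formD(2)[OF one_form_comp[OF fr(2)[of i] L]]
          endomorphismD(1)[OF M fr(1)[of i]], of Basis E 1 q "\<lambda>j. a j (M (E i)) q"]
        fr(1) fr(3)[OF endomorphismD(1)[OF M fr(1)]] by simp
    then show ?thesis by (simp add: fr(4)[OF endo_comp[OF L M]])
  qed
  show ?thesis
    unfolding expand[OF L M] expand[OF M L] by (subst sum.swap) (simp add: mult.commute)
qed

lemma metric_form: "riemannian_metric A g \<Longrightarrow> X \<in> \<XX> \<Longrightarrow> one_form A (g X)"
  unfolding riemannian_metric_def by simp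

lemma metricD:
  assumes "riemannian_metric A g" "X \<in> \<XX>" "Y \<in> \<XX>"
  shows "g X Y = g Y X" "g X Y \<in> C" "X q \<noteq> 0 \<Longrightarrow> g X X q > 0"
  using assms unfolding riemannian_metric_def one_form_def by auto

text \<open>For an orthonormal family the diagonal entries of \<open>L\<close> are the products of
  \<open>e\<close> with \<open>L e\<close>, all 0 by hypothesis.\<close>

lemma trace_skew:
  assumes g: "riemannian_metric A g" and L: "endomorphism_field A L"
    and skew: "\<And>X. X \<in> \<XX> \<Longrightarrow> g X (L X) q = 0"
  shows "trace_field A L q = 0"
proof -
  let ?T = "tangent_space A q"
  let ?e = "ext_field q"
  obtain S where S: "finite S" "S \<subseteq> ?T" "span S = ?T" by (rule tangent_finite_span)
  define G where "G u v = g (?e u) (?e v) q" for u v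
  \<comment> \<open>The index type \<open>bool\<close> suffices: bilinearity of \<open>G\<close>
    involves sums of at most two terms.\<close>
  have comb: "k * g (?e u) X q = (\<Sum>j\<in>J. c j * g (?e u) (Y j) q)"
    if "u \<in> ?T" "X \<in> \<XX>" "\<And>j. j \<in> J \<Longrightarrow> Y j \<in> \<XX>" "k *\<^sub>R X q = (\<Sum>j\<in>J. c j *\<^sub>R Y j q)"
    for u k X c Y and J :: "bool set"
    using function_linear_combination[OF one_formD(2)[OF metric_form[OF g]] that(2-4), of "?e u"] ext_field that(1)
    by simp
  have "\<exists>N. finite N \<and> N \<subseteq> span S \<and> (\<forall>v\<in>span S. v = (\<Sum>e\<in>N. G e v *\<^sub>R e))"
  proof (rule orthonormal_expansion[OF tangent_space_subspace S(1,2)])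
    fix u v w assume uvw: "u \<in> ?T" "v \<in> ?T" "w \<in> ?T"
    show "G u (v + w) = G u v + G u w"
      using comb[OF uvw(1) ext_field(1)[of "v + w" q], of UNIV "\<lambda>b. if b then ?e v else ?e w" 1 "\<lambda>_. 1"]
        ext_field uvw subspace_add[OF tangent_space_subspace, of v A q w]
      by (simp add: G_def UNIV_bool add.commute)
  next
    fix u v and c :: real assume uv: "u \<in> ?T" "v \<in> ?T"
    show "G u (c *\<^sub>R v) = c * G u v"
      using comb[OF uv(1) ext_field(1)[of "c *\<^sub>R v" q], of "{True}" "\<lambda>_. ?e v" 1 "\<lambda>_. c"]
        ext_field uv subspace_scale[OF tangent_space_subspace, of v A q c]
      by (simp add: G_def)
  next
    fix u v assume "u \<in> ?T" "v \<in> ?T"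
    then show "G u v = G v u" using metricD(1)[OF g] ext_field(1) by (simp add: G_def)
  next
    fix v assume "v \<in> ?T" "v \<noteq> 0"
    then show "G v v > 0" using metricD(3)[OF g, of "?e v" "?e v" q] ext_field by (simp add: G_def)
  qed
  then obtain N where N: "finite N" "N \<subseteq> ?T" "\<And>v. v \<in> ?T \<Longrightarrow> v = (\<Sum>e\<in>N. G e v *\<^sub>R e)"
    unfolding S(3) by blast
  have eN: "?e e \<in> \<XX>" "?e e q = e" if "e \<in> N" for e using ext_field N(2) that by blast+
  have "1 * trace_field A L q = (\<Sum>e\<in>N. g (?e e) (L (?e e)) q)"
  proof (rule trace_formula[OF L, where a = "\<lambda>e. g (?e e)"])
    fix X assume X: "X \<in> \<XX>"
    note XT = vector_fieldD(1)[OF X, of q]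
    have "G e (X q) = g (?e e) X q" if "e \<in> N" for e
      unfolding G_def using eN(1)[OF that] X ext_field[OF XT]
      by (intro function_linear_local[OF one_formD(2)[OF metric_form[OF g]]]) auto
    then show "1 *\<^sub>R X q = (\<Sum>e\<in>N. g (?e e) X q *\<^sub>R ?e e q)"
      using N(3)[OF XT] eN(2) by simp
  qed (use eN in \<open>auto intro: metric_form[OF g]\<close>)
  then show ?thesis using skew eN by simp
qed

section \<open>Lie brackets and Lie derivatives of tensor fields\<close>

lemma apply_field_at: "apply_field X f q = X q f"
  by (simp add: apply_field_def)

text \<open>Fields send a nonsmooth function to the constant 0, which every tangent vector kills;
  the bracket thus respects the convention built into \<open>tangent_space\<close>.\<close>

lemma lie_bracket_apply:
  assumes "X \<in> \<XX>" "Y \<in> \<XX>" "f \<notin> C"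
  shows "lie_bracket X Y q f = 0"
proof -
  have "apply_field Z f = (\<lambda>_. 0)" if "Z \<in> \<XX>" for Z
    using tangent_nonsmooth[OF vector_fieldD(1)[OF that] assms(3)] by (auto simp: apply_field_def)
  then show ?thesis
    using tangent_const[OF vector_fieldD(1)[OF assms(1)]] tangent_const[OF vector_fieldD(1)[OF assms(2)]] assms
    by (simp add: lie_bracket_def)
qed

lemma field_eqI:
  assumes "X \<in> \<XX>" "Y \<in> \<XX>" "\<And>q f. f \<in> C \<Longrightarrow> X q f = Y q f"
  shows "X = Y"
  using assms tangent_nonsmooth[OF vector_fieldD(1)] by (metis ext)

lemma lie_bracket_field:
  assumes X: "X \<in> \<XX>" and Y: "Y \<in> \<XX>"
  shows "lie_bracket X Y \<in> \<XX>"
proof -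
  note XT = vector_fieldD(1)[OF X] and YT = vector_fieldD(1)[OF Y]
  note XS = vector_fieldD(2)[OF X] and YS = vector_fieldD(2)[OF Y]
  have "lie_bracket X Y q \<in> tangent_space A q" for q
    unfolding tangent_space_def
    by (auto simp: lie_bracket_apply[OF X Y])
      (auto simp: lie_bracket_def apply_field_def tangent_add[OF XT] tangent_add[OF YT]
        tangent_mult[OF XT] tangent_mult[OF YT] tangent_cmult[OF XT] tangent_cmult[OF YT]
        XS YS smooth_mult smooth_add algebra_simps)
  moreover have "(\<lambda>q. lie_bracket X Y q f) \<in> C" if "f \<in> C" for f
    unfolding lie_bracket_def
    by (intro smooth_diff XS YS apply_field_smooth X Y that)
  ultimately show ?thesis by (simp add: vector_fields_def)
qed

lemma lie_bracket_add:
  assumes X: "X \<in> \<XX>" and Y: "Y \<in> \<XX>" and Z: "Z \<in> \<XX>"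
  shows "lie_bracket X (Y + Z) = lie_bracket X Y + lie_bracket X Z"
proof (rule field_eqI)
  show "lie_bracket X (Y + Z) q f = (lie_bracket X Y + lie_bracket X Z) q f" if "f \<in> C" for q f
    using that X Y Z
    by (simp add: lie_bracket_def apply_field_def vector_fieldD tangent_add[OF vector_fieldD(1)[OF X]])
qed (intro lie_bracket_field field_add X Y Z)+

lemma lie_bracket_scale:
  assumes X: "X \<in> \<XX>" and Y: "Y \<in> \<XX>" and f: "f \<in> C"
  shows "lie_bracket X (f \<cdot>\<^sub>F Y) = apply_field X f \<cdot>\<^sub>F Y + f \<cdot>\<^sub>F lie_bracket X Y"
proof (rule field_eqI)
  show "lie_bracket X (f \<cdot>\<^sub>F Y) q h = (apply_field X f \<cdot>\<^sub>F Y + f \<cdot>\<^sub>F lie_bracket X Y) q h"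
    if "h \<in> C" for q h
    using that X Y f
    by (simp add: lie_bracket_def apply_field_def fun_ops vector_fieldD
        tangent_mult[OF vector_fieldD(1)[OF X]] algebra_simps)
qed (intro lie_bracket_field field_add field_scale apply_field_smooth X Y f)+

lemma lie_bracket_skew: "lie_bracket X Y = - lie_bracket Y X"
  by (auto simp: lie_bracket_def fun_eq_iff)

lemma lie_bracket_minus: "X \<in> \<XX> \<Longrightarrow> Y \<in> \<XX> \<Longrightarrow> lie_bracket X (- Y) = - lie_bracket X Y"
  using lie_bracket_scale[OF _ _ smooth_const[of "-1"], of X Y] tangent_const[OF vector_fieldD(1), of X]
  by (simp add: fun_scale_def fun_Compl_def apply_field_def plus_fun_def)

lemma lie_bracket_diff:
  "X \<in> \<XX> \<Longrightarrow> Y \<in> \<XX> \<Longrightarrow> Z \<in> \<XX> \<Longrightarrow> lie_bracket X (Y - Z) = lie_bracket X Y - lie_bracket X Z"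
  using lie_bracket_add[of X Y "- Z"] lie_bracket_minus[of X Z] field_minus[of Z] by simp

lemma lie_bracket_sum:
  "X \<in> \<XX> \<Longrightarrow> (\<And>i. i \<in> I \<Longrightarrow> Y i \<in> \<XX>) \<Longrightarrow> lie_bracket X (\<Sum>i\<in>I. Y i) = (\<Sum>i\<in>I. lie_bracket X (Y i))"
proof (induction I rule: infinite_finite_induct)
  case (insert i I)
  have "lie_bracket X (Y i + sum Y I) = lie_bracket X (Y i) + lie_bracket X (sum Y I)"
    using insert.prems by (intro lie_bracket_add field_sum) auto
  also have "lie_bracket X (sum Y I) = (\<Sum>i\<in>I. lie_bracket X (Y i))"
    using insert by blast
  finally show ?case unfolding sum.insert[OF insert.hyps] .
qed (use lie_bracket_minus[OF _ field_zero] lie_bracket_add[OF _ field_zero field_zero] in auto)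

lemma jacobi:
  assumes X: "X \<in> \<XX>" and Y: "Y \<in> \<XX>" and Z: "Z \<in> \<XX>"
  shows "lie_bracket X (lie_bracket Y Z) - lie_bracket Y (lie_bracket X Z) = lie_bracket (lie_bracket X Y) Z"
proof (rule field_eqI)
  show "(lie_bracket X (lie_bracket Y Z) - lie_bracket Y (lie_bracket X Z)) q f =
      lie_bracket (lie_bracket X Y) Z q f" if "f \<in> C" for q f
    using that assms
    by (simp add: lie_bracket_def apply_field_def vector_fieldD tangent_diff[OF vector_fieldD(1)[OF X]]
      tangent_diff[OF vector_fieldD(1)[OF Y]] tangent_diff[OF vector_fieldD(1)[OF Z]])
qed (intro lie_bracket_field field_diff X Y Z)+

text \<open>The terms with the derivative of \<open>f\<close> along \<open>X\<close> cancel between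
  the two brackets, so a tensor field results.\<close>

lemma lie_derivative_endo:
  assumes X: "X \<in> \<XX>" and L: "endomorphism_field A L"
  shows "endomorphism_field A (\<lambda>Z. lie_bracket X (L Z) - L (lie_bracket X Z))"
proof -
  note Lf = endomorphismD(2)[OF L] and LX = endomorphismD(1)[OF L]
  show ?thesis
    unfolding endomorphism_field_def
  proof (intro conjI ballI function_linearI)
    fix Y Z q assume YZ: "Y \<in> \<XX>" "Z \<in> \<XX>"
    show "(lie_bracket X (L (Y + Z)) - L (lie_bracket X (Y + Z))) q =
      (lie_bracket X (L Y) - L (lie_bracket X Y)) q + (lie_bracket X (L Z) - L (lie_bracket X Z)) q"
      using X YZ LX by (simp add: function_linear_add[OF Lf] lie_bracket_add lie_bracket_field)
  next
    fix f Z q assume fZ: "f \<in> C" "Z \<in> \<XX>"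
    show "(lie_bracket X (L (f \<cdot>\<^sub>F Z)) - L (lie_bracket X (f \<cdot>\<^sub>F Z))) q =
      f q *\<^sub>R (lie_bracket X (L Z) - L (lie_bracket X Z)) q"
      using X fZ LX
      by (simp add: function_linear_add[OF Lf] function_linear_scale[OF Lf] lie_bracket_scale
          lie_bracket_field field_scale apply_field_smooth) (simp add: fun_scale_def scaleR_diff_right)
  qed (use X LX in \<open>auto intro!: field_diff lie_bracket_field\<close>)
qed

lemma lie_derivative_form:
  assumes X: "X \<in> \<XX>" and \<alpha>: "one_form A \<alpha>"
  shows "one_form A (lie_derivative_one_form X \<alpha>)"
proof -
  note \<alpha>f = one_formD(2)[OF \<alpha>] and \<alpha>X = one_formD(1)[OF \<alpha>]
  show ?thesis
    unfolding one_form_def lie_derivative_one_form_def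
  proof (intro conjI ballI function_linearI)
    fix Y Z q assume YZ: "Y \<in> \<XX>" "Z \<in> \<XX>"
    show "(apply_field X (\<alpha> (Y + Z)) - \<alpha> (lie_bracket X (Y + Z))) q =
      (apply_field X (\<alpha> Y) - \<alpha> (lie_bracket X Y)) q + (apply_field X (\<alpha> Z) - \<alpha> (lie_bracket X Z)) q"
    proof -
      have "X q (\<alpha> Y + \<alpha> Z) = X q (\<alpha> Y) + X q (\<alpha> Z)"
        using tangent_add[OF vector_fieldD(1)[OF X], of "\<alpha> Y" "\<alpha> Z" q] YZ \<alpha>X
        by (simp add: plus_fun_def)
      then show ?thesis
        using X YZ by (simp add: function_linear_add[OF \<alpha>f] lie_bracket_add lie_bracket_field apply_field_at)
    qed
  next
    fix f Z q assume fZ: "f \<in> C" "Z \<in> \<XX>"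
    show "(apply_field X (\<alpha> (f \<cdot>\<^sub>F Z)) - \<alpha> (lie_bracket X (f \<cdot>\<^sub>F Z))) q =
      f q *\<^sub>R (apply_field X (\<alpha> Z) - \<alpha> (lie_bracket X Z)) q"
      using X fZ \<alpha>X tangent_mult[OF vector_fieldD(1)[OF X], of f "\<alpha> Z" q]
      by (simp add: function_linear_add[OF \<alpha>f] function_linear_scale[OF \<alpha>f] lie_bracket_scale
          lie_bracket_field field_scale apply_field_smooth)
        (simp add: fun_scale_def apply_field_at algebra_simps)
  next
    fix Y assume "Y \<in> \<XX>"
    then show "apply_field X (\<alpha> Y) - \<alpha> (lie_bracket X Y) \<in> C"
      using smooth_diff[OF apply_field_smooth[OF X \<alpha>X] \<alpha>X, of Y "lie_bracket X Y"] X
      by (simp add: lie_bracket_field fun_diff_def)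
  qed
qed

text \<open>Differentiating \<open>w Z = \<Sum>\<^sub>i a\<^sub>i(Z) E\<^sub>i\<close> along \<open>X\<close> gives another expansion, of \<open>X(w) Z\<close>, to
  which the trace formula applies; this accounts for the derivatives of the frame.\<close>

lemma trace_derivative:
  assumes X: "X \<in> \<XX>" and L: "endomorphism_field A L" and t: "trace_field A L \<in> C"
  shows "X q (trace_field A L) = trace_field A (\<lambda>Z. lie_bracket X (L Z) - L (lie_bracket X Z)) q"
proof -
  obtain E :: "'b \<Rightarrow> 'a vector_field" and a w where fr:
    "\<And>i. E i \<in> \<XX>" "\<And>i. one_form A (a i)" "w \<in> C" "w q = 1"
    "\<And>X p. X \<in> \<XX> \<Longrightarrow> w p *\<^sub>R X p = (\<Sum>i\<in>Basis. a i X p *\<^sub>R E i p)"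
    by (rule frame_exists[of q]) blast
  let ?t = "trace_field A L" and ?M = "\<lambda>Z. lie_bracket X (L Z) - L (lie_bracket X Z)"
  let ?b = "\<lambda>i. lie_derivative_one_form X (a i)"
  note XT = vector_fieldD(1)[OF X, of q]
  have LE: "L (E i) \<in> \<XX>" "lie_bracket X (E i) \<in> \<XX>" "L (lie_bracket X (E i)) \<in> \<XX>" for i
    using fr(1) X by (auto intro: endomorphismD(1)[OF L] lie_bracket_field)
  have aLE: "a i (L (E i)) \<in> C" for i
    by (rule one_formD(1)[OF fr(2) LE(1)])
  have "(\<lambda>p. w p * ?t p) = (\<lambda>p. \<Sum>i\<in>Basis. a i (L (E i)) p)"
    by (rule ext, rule trace_formula[OF L fr(1,2,5)])
  then have "X q (\<lambda>p. w p * ?t p) = X q (\<lambda>p. \<Sum>i\<in>Basis. a i (L (E i)) p)" by simp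
  then have 1: "X q ?t + ?t q * X q w = (\<Sum>i\<in>Basis. X q (a i (L (E i))))"
    using tangent_mult[OF XT fr(3) t] tangent_sum[OF XT aLE] fr(4) by simp
  have 2: "X q (a i (L (E i))) = ?b i (L (E i)) q + a i (?M (E i)) q + a i (L (lie_bracket X (E i))) q" for i
    using LE X by (simp add: lie_derivative_one_form_def apply_field_at lie_bracket_field
        function_linear_diff[OF one_formD(2)[OF fr(2)]])
  \<comment> \<open>Bracketing the expansion with \<open>X\<close> also produces \<open>w\<close>
    times the bracket of \<open>X\<close> and \<open>Z\<close>, which cancels by the expansion
    itself. What remains pairs differentiated forms with \<open>E i\<close> and the forms
    \<open>a i\<close> with differentiated fields, hence the doubled index set.\<close>
  have exp: "X q w *\<^sub>R Z q = (\<Sum>j\<in>Basis <+> Basis. case_sum ?b a j Z q *\<^sub>R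
      case_sum E (\<lambda>i. lie_bracket X (E i)) j q)" if Z: "Z \<in> \<XX>" for Z
  proof -
    have aZ: "a i Z \<in> C" for i by (rule one_formD(1)[OF fr(2) Z])
    have "w \<cdot>\<^sub>F Z = (\<Sum>i\<in>Basis. a i Z \<cdot>\<^sub>F E i)"
      by (rule ext) (simp add: fun_scale_def sum_fun_apply fr(5)[OF Z])
    then have "lie_bracket X (w \<cdot>\<^sub>F Z) q = lie_bracket X (\<Sum>i\<in>Basis. a i Z \<cdot>\<^sub>F E i) q" by simp
    then have "X q w *\<^sub>R Z q + w q *\<^sub>R lie_bracket X Z q =
        (\<Sum>i\<in>Basis. X q (a i Z) *\<^sub>R E i q + a i Z q *\<^sub>R lie_bracket X (E i) q)"
      using X Z fr(1,3) aZ
      by (simp add: lie_bracket_scale lie_bracket_sum field_scale)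
        (simp add: fun_scale_def sum_fun_apply apply_field_at)
    then show ?thesis
      using fr(5)[OF lie_bracket_field[OF X Z], of q]
      by (simp add: sum.Plus lie_derivative_one_form_def apply_field_at scaleR_diff_left
          sum.distrib sum_subtractf algebra_simps)
  qed
  have "X q w * ?t q = (\<Sum>j\<in>Basis <+> Basis. case_sum ?b a j (L (case_sum E (\<lambda>i. lie_bracket X (E i)) j)) q)"
    by (rule trace_formula[OF L, of "Basis <+> Basis" "case_sum E (\<lambda>i. lie_bracket X (E i))"
          "case_sum ?b a" "X q w" q, OF _ _ exp])
      (use fr(1,2) X in \<open>auto intro: lie_bracket_field lie_derivative_form split: sum.split\<close>)
  then have 3: "X q w * ?t q = (\<Sum>i\<in>Basis. ?b i (L (E i)) q) + (\<Sum>i\<in>Basis. a i (L (lie_bracket X (E i))) q)"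
    by (simp add: sum.Plus)
  have "w q * trace_field A ?M q = (\<Sum>i\<in>Basis. a i (?M (E i)) q)"
    by (rule trace_formula[OF lie_derivative_endo[OF X L] fr(1,2,5)])
  \<comment> \<open>Facts \<open>1\<close> and \<open>3\<close> both contain the trace times the
    derivative of \<open>w\<close>, which cancels.\<close>
  then show ?thesis
    using 1 2 3 fr(4) by (simp add: sum.distrib algebra_simps)
qed

end


section \<open>Curvature of Kenmotsu manifolds\<close>

locale kenmotsu_manifold =
  fixes A :: "('a::{t2_space, second_countable_topology}, 'b::euclidean_space) chart set"
    and \<phi> :: "'a vector_field \<Rightarrow> 'a vector_field" and \<xi> :: "'a vector_field"
    and \<eta> :: "'a vector_field \<Rightarrow> 'a \<Rightarrow> real" and g :: "'a bilinear_field" and D :: "'a connection"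
  assumes kenmotsu: "kenmotsu A \<phi> \<xi> \<eta> g D"
begin

lemma acm: "almost_contact_metric A \<phi> \<xi> \<eta> g" and lc: "levi_civita A g D"
  using kenmotsu unfolding kenmotsu_def by auto

sublocale smooth_manifold A
  using acm unfolding almost_contact_metric_def by unfold_locales simp

lemma phi_endo: "endomorphism_field A \<phi>" and xi_field: "\<xi> \<in> \<XX>" and eta_form: "one_form A \<eta>"
  and metric: "riemannian_metric A g" and eta_xi: "\<eta> \<xi> q = 1"
  using acm unfolding almost_contact_metric_def by auto

lemma phi_phi: "X \<in> \<XX> \<Longrightarrow> \<phi> (\<phi> X) = - X + \<eta> X \<cdot>\<^sub>F \<xi>"
  and metric_phi: "X \<in> \<XX> \<Longrightarrow> Y \<in> \<XX> \<Longrightarrow> g (\<phi> X) (\<phi> Y) q = g X Y q - \<eta> X q * \<eta> Y q"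
  using acm unfolding almost_contact_metric_def by auto

lemma D_endo: "Y \<in> \<XX> \<Longrightarrow> endomorphism_field A (\<lambda>X. D X Y)"
  and D_add: "X \<in> \<XX> \<Longrightarrow> Y \<in> \<XX> \<Longrightarrow> Z \<in> \<XX> \<Longrightarrow> D X (Y + Z) = D X Y + D X Z"
  and D_scale: "f \<in> C \<Longrightarrow> X \<in> \<XX> \<Longrightarrow> Y \<in> \<XX> \<Longrightarrow> D X (f \<cdot>\<^sub>F Y) = apply_field X f \<cdot>\<^sub>F Y + f \<cdot>\<^sub>F D X Y"
  and torsion_free: "X \<in> \<XX> \<Longrightarrow> Y \<in> \<XX> \<Longrightarrow> lie_bracket X Y = D X Y - D Y X"
  and metric_compatible:
    "X \<in> \<XX> \<Longrightarrow> Y \<in> \<XX> \<Longrightarrow> Z \<in> \<XX> \<Longrightarrow> apply_field X (g Y Z) = g (D X Y) Z + g Y (D X Z)"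
  using lc unfolding levi_civita_def affine_connection_def by auto

lemma D_phi:
  assumes "X \<in> \<XX>" "Y \<in> \<XX>"
  shows "D X (\<phi> Y) = \<phi> (D X Y) + g (\<phi> X) Y \<cdot>\<^sub>F \<xi> - \<eta> Y \<cdot>\<^sub>F \<phi> X"
proof -
  have "D X (\<phi> Y) - \<phi> (D X Y) = g (\<phi> X) Y \<cdot>\<^sub>F \<xi> - \<eta> Y \<cdot>\<^sub>F \<phi> X"
    using kenmotsu assms unfolding kenmotsu_def by blast
  then show ?thesis by (simp add: algebra_simps)
qed

lemma D_field: "X \<in> \<XX> \<Longrightarrow> Y \<in> \<XX> \<Longrightarrow> D X Y \<in> \<XX>"
  by (rule endomorphismD(1)[OF D_endo])

lemma phi_field: "X \<in> \<XX> \<Longrightarrow> \<phi> X \<in> \<XX>"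
  by (rule endomorphismD(1)[OF phi_endo])

lemmas g_smooth = metricD(2)[OF metric]
lemmas g_sym = metricD(1)[OF metric]
lemmas eta_smooth = one_formD(1)[OF eta_form]

lemma smooth_ops:
  assumes "f \<in> C" shows "- f \<in> C" "h \<in> C \<Longrightarrow> f + h \<in> C" "h \<in> C \<Longrightarrow> f - h \<in> C"
  using assms smooth_minus[of f] smooth_add[of f h] smooth_diff[of f h]
  by (simp_all add: fun_Compl_def plus_fun_def fun_diff_def)

lemmas closures = smooth_ops
  field_add field_diff field_minus field_scale field_zero lie_bracket_field D_field phi_field xi_field
  g_smooth eta_smooth apply_field_smooth smooth_const

lemma D_minus: "X \<in> \<XX> \<Longrightarrow> Y \<in> \<XX> \<Longrightarrow> D X (- Y) = - D X Y"
  using D_scale[OF smooth_const[of "-1"], of X Y] tangent_const[OF vector_fieldD(1), of X]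
  by (simp add: fun_scale_def fun_Compl_def apply_field_def plus_fun_def)

lemma D_diff: "X \<in> \<XX> \<Longrightarrow> Y \<in> \<XX> \<Longrightarrow> Z \<in> \<XX> \<Longrightarrow> D X (Y - Z) = D X Y - D X Z"
  using D_add[of X Y "- Z"] D_minus[of X Z] field_minus[of Z] by simp

lemma D_zero: "X \<in> \<XX> \<Longrightarrow> D X 0 = 0"
  using D_diff[of X 0 0] field_zero by simp

lemmas phi_linear = endomorphismD(2)[OF phi_endo]
lemmas eta_linear = one_formD(2)[OF eta_form]

lemmas D_rules = D_add D_diff D_minus D_scale
  function_linear_add[OF endomorphismD(2)[OF D_endo]]
  function_linear_diff[OF endomorphismD(2)[OF D_endo]]
  function_linear_minus[OF endomorphismD(2)[OF D_endo]]
  function_linear_scale[OF endomorphismD(2)[OF D_endo]]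
  function_linear_zero[OF endomorphismD(2)[OF D_endo]]

lemmas phi_rules =
  function_linear_add[OF phi_linear] function_linear_diff[OF phi_linear]
  function_linear_minus[OF phi_linear] function_linear_scale[OF phi_linear]
  function_linear_zero[OF phi_linear]

lemmas eta_rules =
  function_linear_add[OF eta_linear] function_linear_diff[OF eta_linear]
  function_linear_minus[OF eta_linear] function_linear_scale[OF eta_linear]
  function_linear_zero[OF eta_linear]

lemmas g_linear = one_formD(2)[OF metric_form[OF metric]]

lemma g_rules:
  assumes "X \<in> \<XX>" "Y \<in> \<XX>" "Z \<in> \<XX>"
  shows "g Z (X + Y) = g Z X + g Z Y" "g Z (X - Y) = g Z X - g Z Y" "g Z (- X) = - g Z X"
    "f \<in> C \<Longrightarrow> g Z (f \<cdot>\<^sub>F X) = f \<cdot>\<^sub>F g Z X"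
    "g (X + Y) Z = g X Z + g Y Z" "g (X - Y) Z = g X Z - g Y Z" "g (- X) Z = - g X Z"
    "f \<in> C \<Longrightarrow> g (f \<cdot>\<^sub>F X) Z = f \<cdot>\<^sub>F g X Z"
    "g Z 0 = 0" "g 0 Z = 0"
  using assms function_linear_add[OF g_linear[OF assms(3)]] function_linear_diff[OF g_linear[OF assms(3)]]
    function_linear_minus[OF g_linear[OF assms(3)]] function_linear_scale[OF g_linear[OF assms(3)]]
    function_linear_zero[OF g_linear[OF assms(3)]] g_sym[of _ Z]
  by (simp_all add: field_add field_diff field_minus field_scale field_zero)

text \<open>\<open>phi_phi\<close> at \<xi> gives \<open>\<phi> (\<phi> \<xi>) = 0\<close>, and at
  \<open>\<phi> \<xi>\<close> it makes \<open>\<phi> \<xi>\<close> a multiple \<open>k\<close> of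
  \<xi>; then the square of \<open>k\<close> vanishes.\<close>

lemma phi_xi: "\<phi> \<xi> = 0"
proof -
  define k where "k = \<eta> (\<phi> \<xi>)"
  have k: "k \<in> C" by (simp add: k_def closures)
  have 0: "\<phi> (\<phi> \<xi>) = 0"
    by (auto simp: phi_phi closures fun_eq_iff fun_ops eta_xi)
  have 1: "\<phi> \<xi> = k \<cdot>\<^sub>F \<xi>"
    using phi_phi[of "\<phi> \<xi>"] 0 by (simp add: k_def closures phi_rules)
  then have "\<phi> (\<phi> \<xi>) = k \<cdot>\<^sub>F (k \<cdot>\<^sub>F \<xi>)"
    using phi_rules(4)[OF k xi_field] by simp
  then have "\<eta> (k \<cdot>\<^sub>F (k \<cdot>\<^sub>F \<xi>)) = 0"
    using 0 eta_rules(5) by simp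
  moreover have "\<eta> (k \<cdot>\<^sub>F (k \<cdot>\<^sub>F \<xi>)) = k \<cdot>\<^sub>F (k \<cdot>\<^sub>F \<eta> \<xi>)"
    using k by (simp add: closures eta_rules)
  ultimately have "k q * (k q * \<eta> \<xi> q) = 0" for q
    by (simp add: fun_scale_def fun_eq_iff)
  then have "k q = 0" for q using eta_xi by simp
  then show ?thesis using 1 by (simp add: fun_scale_def zero_fun_def)
qed

lemma eta_g: "X \<in> \<XX> \<Longrightarrow> g X \<xi> = \<eta> X"
  using metric_phi[of X \<xi>] by (simp add: closures phi_xi g_rules eta_xi fun_eq_iff)

lemma eta_g': "X \<in> \<XX> \<Longrightarrow> g \<xi> X = \<eta> X"
  using eta_g g_sym closures by metis

text \<open>Two evaluations of the third power of \<phi> are compared.\<close>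

lemma eta_phi:
  assumes X: "X \<in> \<XX>" shows "\<eta> (\<phi> X) = 0"
proof -
  have "\<phi> (\<phi> (\<phi> X)) = - \<phi> X + \<eta> (\<phi> X) \<cdot>\<^sub>F \<xi>"
    by (rule phi_phi[OF phi_field[OF X]])
  moreover have "\<phi> (\<phi> (\<phi> X)) = - \<phi> X"
    unfolding phi_phi[OF X] using X by (simp add: closures phi_rules phi_xi) (simp add: fun_ops fun_eq_iff)
  ultimately have "\<eta> (\<eta> (\<phi> X) \<cdot>\<^sub>F \<xi>) = 0" using eta_rules(5) by simp
  then have "\<eta> (\<phi> X) \<cdot>\<^sub>F \<eta> \<xi> = 0" using X by (simp add: closures eta_rules)
  then show ?thesis by (simp add: fun_scale_def fun_eq_iff eta_xi)
qed

lemma phi_skew: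
  assumes X: "X \<in> \<XX>" and Y: "Y \<in> \<XX>" shows "g X (\<phi> Y) = - g (\<phi> X) Y"
proof
  fix q
  have "g (\<phi> X) (\<phi> (\<phi> Y)) q = g X (\<phi> Y) q - \<eta> X q * \<eta> (\<phi> Y) q"
    using X Y by (simp add: metric_phi closures)
  then show "g X (\<phi> Y) q = (- g (\<phi> X) Y) q"
    unfolding phi_phi[OF Y] using X Y
    by (simp add: closures g_rules eta_phi eta_g) (simp add: fun_scale_def)
qed

lemma phi_skew': "X \<in> \<XX> \<Longrightarrow> Y \<in> \<XX> \<Longrightarrow> g (\<phi> Y) X = - g (\<phi> X) Y"
  using phi_skew g_sym closures by metis

lemma nondegenerate:
  assumes X: "X \<in> \<XX>" and Y: "Y \<in> \<XX>" and eq: "\<And>W q. W \<in> \<XX> \<Longrightarrow> g X W q = g Y W q"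
  shows "X = Y"
proof
  fix q
  have "g (X - Y) (X - Y) q = 0"
    using eq[of "X - Y" q] X Y by (simp add: closures g_rules)
  then have "(X - Y) q = 0"
    using metricD(3)[OF metric, of "X - Y" "X - Y" q] X Y by (fastforce simp: closures)
  then show "X q = Y q" by simp
qed

text \<open>\<open>D_phi\<close> at \<open>Y = \<xi>\<close> says that \<phi> takes the same value
  on \<open>D X \<xi>\<close> and on \<open>X\<close>, and \<phi> determines a field up to its
  \<xi>-component. That component of \<open>D X \<xi>\<close> is 0 because \<xi> has constant
  length.\<close>

lemma D_xi:
  assumes X: "X \<in> \<XX>" shows "D X \<xi> = X - \<eta> X \<cdot>\<^sub>F \<xi>"
proof -
  have eta: "\<eta> (D X \<xi>) = 0"
  proof
    fix q
    have "g \<xi> \<xi> = (\<lambda>_. 1)" using eta_g[OF xi_field] eta_xi by auto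
    then have "apply_field X (g \<xi> \<xi>) q = 0"
      using tangent_const[OF vector_fieldD(1)[OF X]] by (simp add: apply_field_def)
    then have "g (D X \<xi>) \<xi> q + g \<xi> (D X \<xi>) q = 0"
      using metric_compatible[OF X xi_field xi_field] by simp
    then show "\<eta> (D X \<xi>) q = 0 q"
      using X by (simp add: closures eta_g eta_g')
  qed
  have "\<phi> (D X \<xi>) = \<phi> X"
    using D_phi[OF X xi_field] X
    by (simp add: closures phi_xi eta_g eta_phi D_zero) (auto simp: fun_ops fun_eq_iff eta_xi)
  then have "\<phi> (\<phi> (D X \<xi>)) = \<phi> (\<phi> X)" by simp
  then show ?thesis
    using X by (simp add: phi_phi closures eta) (simp add: fun_scale_def fun_eq_iff algebra_simps)
qed

definition \<gamma> :: "'a bilinear_field" where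
  "\<gamma> X Y = (\<lambda>q. g X Y q - \<eta> X q * \<eta> Y q)"

lemma deriv_eta:
  assumes "X \<in> \<XX>" "Y \<in> \<XX>"
  shows "apply_field X (\<eta> Y) = \<eta> (D X Y) + \<gamma> X Y"
proof -
  have "apply_field X (g Y \<xi>) = g (D X Y) \<xi> + g Y (D X \<xi>)"
    by (rule metric_compatible[OF assms xi_field])
  then show ?thesis
    using assms g_sym[of X Y]
    by (simp add: eta_g D_xi g_rules closures) (simp add: \<gamma>_def fun_scale_def fun_eq_iff)
qed

section \<open>Symmetries of the curvature\<close>

abbreviation "R \<equiv> curvature D"

lemma R_field: "X \<in> \<XX> \<Longrightarrow> Y \<in> \<XX> \<Longrightarrow> Z \<in> \<XX> \<Longrightarrow> R X Y Z \<in> \<XX>"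
  unfolding curvature_def by (intro closures)

lemma R_skew: "X \<in> \<XX> \<Longrightarrow> Y \<in> \<XX> \<Longrightarrow> Z \<in> \<XX> \<Longrightarrow> R X Y Z = - R Y X Z"
  unfolding curvature_def using lie_bracket_skew[of X Y]
  by (simp add: D_rules closures)

lemma R_endo3: assumes X: "X \<in> \<XX>" and Y: "Y \<in> \<XX>" shows "endomorphism_field A (\<lambda>Z. R X Y Z)"
  unfolding endomorphism_field_def
proof (intro conjI ballI function_linearI)
  fix Z W q assume ZW: "Z \<in> \<XX>" "W \<in> \<XX>"
  show "R X Y (Z + W) q = R X Y Z q + R X Y W q"
    using X Y ZW by (simp add: curvature_def D_rules closures)
next
  fix f Z q assume fZ: "f \<in> C" "Z \<in> \<XX>"
  show "R X Y (f \<cdot>\<^sub>F Z) q = f q *\<^sub>R R X Y Z q"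
    using X Y fZ
    by (simp add: curvature_def D_rules closures)
      (simp add: fun_ops fun_eq_iff apply_field_def lie_bracket_def algebra_simps)
qed (use X Y R_field in auto)

lemma R_endo1: assumes Y: "Y \<in> \<XX>" and Z: "Z \<in> \<XX>" shows "endomorphism_field A (\<lambda>X. R X Y Z)"
  unfolding endomorphism_field_def
proof (intro conjI ballI function_linearI)
  fix X W q assume XW: "X \<in> \<XX>" "W \<in> \<XX>"
  show "R (X + W) Y Z q = R X Y Z q + R W Y Z q"
    using Y Z XW by (simp add: curvature_def D_rules closures torsion_free)
next
  fix f X q assume fX: "f \<in> C" "X \<in> \<XX>"
  show "R (f \<cdot>\<^sub>F X) Y Z q = f q *\<^sub>R R X Y Z q"
    using Y Z fX
    by (simp add: curvature_def D_rules closures torsion_free)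
      (simp add: fun_ops fun_eq_iff algebra_simps)
qed (use Y Z R_field in auto)

text \<open>Torsion-freeness turns the cyclic sum into that of the Jacobi identity.\<close>

lemma bianchi:
  assumes X: "X \<in> \<XX>" and Y: "Y \<in> \<XX>" and Z: "Z \<in> \<XX>"
  shows "R X Y Z + R Y Z X + R Z X Y = 0"
proof -
  have "R X Y Z + R Y Z X + R Z X Y =
      lie_bracket X (lie_bracket Y Z) + lie_bracket Y (lie_bracket Z X) + lie_bracket Z (lie_bracket X Y)"
    unfolding curvature_def using assms
    by (simp add: torsion_free[of _ "lie_bracket _ _"] closures)
      (simp add: torsion_free D_rules closures)
  also have "\<dots> = 0"
    using jacobi[OF X Y Z] lie_bracket_skew[of Z X] lie_bracket_skew[of "lie_bracket X Y" Z]
      lie_bracket_minus[OF Y lie_bracket_field[OF X Z]]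
    by (simp add: algebra_simps)
  finally show ?thesis .
qed

text \<open>The commutator of the derivatives along \<open>X\<close> and \<open>Y\<close>, minus the
  derivative along their bracket, kills the function \<open>g Z W\<close>. When it is expanded by
  metric compatibility, the mixed terms cancel.\<close>

lemma R_metric_skew:
  assumes X: "X \<in> \<XX>" and Y: "Y \<in> \<XX>" and Z: "Z \<in> \<XX>" and W: "W \<in> \<XX>"
  shows "g (R X Y Z) W q = - g Z (R X Y W) q"
proof -
  have second: "U q (apply_field T (g Z W)) = g (D U (D T Z)) W q + g (D T Z) (D U W) q
      + g (D U Z) (D T W) q + g Z (D U (D T W)) q" if U: "U \<in> \<XX>" and T: "T \<in> \<XX>" for U T
  proof -
    have "U q (apply_field T (g Z W)) = U q (g (D T Z) W) + U q (g Z (D T W))"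
      using tangent_add[OF vector_fieldD(1)[OF U], of "g (D T Z) W" "g Z (D T W)"] T Z W
      by (simp add: metric_compatible plus_fun_def closures)
    then show ?thesis
      using U T Z W by (simp add: metric_compatible closures flip: apply_field_at)
  qed
  have "apply_field (lie_bracket X Y) (g Z W) q = X q (apply_field Y (g Z W)) - Y q (apply_field X (g Z W))"
    by (simp add: apply_field_def lie_bracket_def)
  then show ?thesis
    unfolding second[OF X Y] second[OF Y X] using assms
    by (simp add: metric_compatible curvature_def g_rules closures)
qed

lemma R_xi:
  assumes X: "X \<in> \<XX>" and Y: "Y \<in> \<XX>" shows "R X Y \<xi> = \<eta> X \<cdot>\<^sub>F Y - \<eta> Y \<cdot>\<^sub>F X"
  unfolding curvature_def using X Y g_sym[of X Y]
  by (simp add: D_xi D_rules closures deriv_eta torsion_free eta_rules)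
    (simp add: fun_ops fun_eq_iff algebra_simps \<gamma>_def)

text \<open>The metric terms make the tensor vanish when \<xi> is inserted and commute with \<phi>;
  \<open>R\<close> alone need not do either.\<close>

definition K :: "'a vector_field \<Rightarrow> 'a vector_field \<Rightarrow> 'a vector_field \<Rightarrow> 'a vector_field" where
  "K X Y Z = R X Y Z + g Y Z \<cdot>\<^sub>F X - g X Z \<cdot>\<^sub>F Y"

lemma K_field: "X \<in> \<XX> \<Longrightarrow> Y \<in> \<XX> \<Longrightarrow> Z \<in> \<XX> \<Longrightarrow> K X Y Z \<in> \<XX>"
  unfolding K_def by (intro closures R_field)

lemma K_skew: "X \<in> \<XX> \<Longrightarrow> Y \<in> \<XX> \<Longrightarrow> Z \<in> \<XX> \<Longrightarrow> K X Y Z = - K Y X Z"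
  unfolding K_def using R_skew[of X Y Z] by simp

lemma K_bianchi:
  "X \<in> \<XX> \<Longrightarrow> Y \<in> \<XX> \<Longrightarrow> Z \<in> \<XX> \<Longrightarrow> K X Y Z + K Y Z X + K Z X Y = 0"
  unfolding K_def using bianchi[of X Y Z] g_sym[of X Y] g_sym[of Y Z] g_sym[of X Z]
  by (simp add: algebra_simps)

lemma K_metric_skew:
  assumes "X \<in> \<XX>" "Y \<in> \<XX>" "Z \<in> \<XX>" "W \<in> \<XX>"
  shows "g (K X Y Z) W q = - g Z (K X Y W) q"
  unfolding K_def using assms R_metric_skew[OF assms, of q] g_sym[of X Z] g_sym[of Y Z]
  by (simp add: g_rules closures R_field) (simp add: fun_scale_def)

text \<open>The classical argument: four instances of the first Bianchi identity, combined with the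
  two skew symmetries.\<close>

lemma K_pair:
  assumes X: "X \<in> \<XX>" and Y: "Y \<in> \<XX>" and Z: "Z \<in> \<XX>" and W: "W \<in> \<XX>"
  shows "g (K X Y Z) W q = g (K Z W X) Y q"
proof -
  let ?r = "\<lambda>X Y Z W. g (K X Y Z) W q"
  have b: "?r X Y Z W + ?r Y Z X W + ?r Z X Y W = 0"
    if "X \<in> \<XX>" "Y \<in> \<XX>" "Z \<in> \<XX>" "W \<in> \<XX>" for X Y Z W
  proof -
    have "g (K X Y Z + K Y Z X + K Z X Y) W q = 0"
      unfolding K_bianchi[OF that(1-3)] using g_rules(10)[OF that(1,2,4)] by simp
    then show ?thesis using that by (simp add: g_rules K_field closures)
  qed
  have s12: "?r X Y Z W = - ?r Y X Z W" if "X \<in> \<XX>" "Y \<in> \<XX>" "Z \<in> \<XX>" "W \<in> \<XX>" for X Y Z W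
    unfolding K_skew[OF that(1-3)] using that by (simp add: g_rules K_field)
  have s34: "?r X Y Z W = - ?r X Y W Z" if "X \<in> \<XX>" "Y \<in> \<XX>" "Z \<in> \<XX>" "W \<in> \<XX>" for X Y Z W
    using K_metric_skew[OF that, of q] g_sym[OF K_field[OF that(1,2,4)] that(3)] by simp
  show ?thesis
    using b[OF X Y Z W] b[OF Y Z W X] b[OF Z W X Y] b[OF W X Y Z]
      s12[OF X Y Z W] s12[OF Y Z X W] s12[OF Z X Y W] s12[OF Y Z W X] s12[OF Z W Y X] s12[OF W Y Z X]
      s12[OF Z W X Y] s12[OF W X Z Y] s12[OF X Z W Y] s12[OF W X Y Z] s12[OF X Y W Z] s12[OF Y W X Z]
      s34[OF X Y Z W] s34[OF Y Z X W] s34[OF Z X Y W] s34[OF Z W X Y] s34[OF W X Y Z] s34[OF Y W X Z]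
    by linarith
qed

lemma K_xi3: "X \<in> \<XX> \<Longrightarrow> Y \<in> \<XX> \<Longrightarrow> K X Y \<xi> = 0"
  unfolding K_def by (simp add: R_xi eta_g)

text \<open>Pair symmetry moves \<xi> from the first slot to the third.\<close>

lemma K_xi1:
  assumes "X \<in> \<XX>" "Y \<in> \<XX>" shows "K \<xi> X Y = 0"
proof (rule nondegenerate)
  show "g (K \<xi> X Y) W q = g 0 W q" if "W \<in> \<XX>" for W q
    using K_pair[OF xi_field assms that, of q] K_xi3[OF assms(2) that] assms that by (simp add: g_rules)
qed (use assms in \<open>simp_all add: K_field closures\<close>)

lemma R_xi1:
  assumes "X \<in> \<XX>" "Y \<in> \<XX>" shows "R \<xi> X Y = \<eta> Y \<cdot>\<^sub>F X - g X Y \<cdot>\<^sub>F \<xi>"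
  using K_xi1[OF assms] assms unfolding K_def by (simp add: eta_g' algebra_simps)

text \<open>Moving \<phi> past two covariant derivatives by \<open>D_phi\<close> leaves terms in
  \<open>g\<close> and \<eta>; the correction in \<open>K\<close> absorbs exactly these.\<close>

lemma K_phi:
  assumes X: "X \<in> \<XX>" and Y: "Y \<in> \<XX>" and Z: "Z \<in> \<XX>"
  shows "K X Y (\<phi> Z) = \<phi> (K X Y Z)"
  unfolding K_def curvature_def using X Y Z g_sym[of X Y] phi_skew'[of X Y] phi_skew'[of X Z] phi_skew'[of Y Z]
  by (simp add: D_phi D_xi D_rules closures deriv_eta torsion_free eta_rules phi_rules g_rules
      metric_compatible phi_skew eta_g eta_g')
    (simp add: fun_ops fun_eq_iff algebra_simps \<gamma>_def)

text \<open>Pair symmetry carries both \<phi> to the other pair, where \<open>K_phi\<close> pulls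
  one out and \<open>metric_phi\<close> removes the two together; the leftover \<eta> term is 0 by
  \<open>K_xi3\<close>.\<close>

lemma K_phi_phi:
  assumes Y: "Y \<in> \<XX>" and Z: "Z \<in> \<XX>" and X: "X \<in> \<XX>"
  shows "K (\<phi> Y) (\<phi> Z) X = K Y Z X"
proof (rule nondegenerate)
  fix W q assume W: "W \<in> \<XX>"
  have "\<eta> (K X W Y) q = 0"
    using K_metric_skew[OF X W Y xi_field, of q] K_xi3[OF X W] X W Y by (simp add: eta_g g_rules K_field)
  then have "g (K X W (\<phi> Y)) (\<phi> Z) q = g (K X W Y) Z q"
    unfolding K_phi[OF X W Y] using X W Y Z by (simp add: metric_phi K_field)
  then show "g (K (\<phi> Y) (\<phi> Z) X) W q = g (K Y Z X) W q"
    using K_pair[OF phi_field[OF Y] phi_field[OF Z] X W, of q] K_pair[OF Y Z X W, of q] by simp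
qed (use assms in \<open>simp_all add: K_field closures\<close>)

lemma scale_endo: "f \<in> C \<Longrightarrow> endomorphism_field A (\<lambda>Z. f \<cdot>\<^sub>F Z)"
  by (rule endo_scale[OF _ endo_id])

lemma g_form: "X \<in> \<XX> \<Longrightarrow> one_form A (g X)"
  by (rule metric_form[OF metric])

lemma g_rank_one:
  assumes "X \<in> \<XX>" "W \<in> \<XX>" shows "endomorphism_field A (\<lambda>Z. g X Z \<cdot>\<^sub>F W)"
  by (rule endo_rank_one[OF g_form[OF assms(1)] assms(2)])

lemma K_endo3:
  assumes "X \<in> \<XX>" "Y \<in> \<XX>" shows "endomorphism_field A (\<lambda>Z. K X Y Z)"
  unfolding K_def using assms by (intro endo_add endo_diff R_endo3 g_rank_one)

text \<open>Symmetry of \<open>g\<close> holds for vector fields only, so this is not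
  \<open>g_rank_one\<close> rewritten under the abstraction.\<close>

lemma g_rank_one':
  assumes X: "X \<in> \<XX>" and W: "W \<in> \<XX>" shows "endomorphism_field A (\<lambda>Z. g Z X \<cdot>\<^sub>F W)"
  unfolding endomorphism_field_def
proof (intro conjI ballI function_linearI)
  show "(g (Y + Z) X \<cdot>\<^sub>F W) q = (g Y X \<cdot>\<^sub>F W) q + (g Z X \<cdot>\<^sub>F W) q" if "Y \<in> \<XX>" "Z \<in> \<XX>" for Y Z q
    using that X by (simp add: g_rules) (simp add: fun_scale_def scaleR_add_left)
  show "(g (f \<cdot>\<^sub>F Z) X \<cdot>\<^sub>F W) q = f q *\<^sub>R (g Z X \<cdot>\<^sub>F W) q" if "f \<in> C" "Z \<in> \<XX>" for f Z q
    using that X by (simp add: g_rules) (simp add: fun_scale_def)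
qed (use X W in \<open>simp add: closures\<close>)

lemma K_endo1:
  assumes "Y \<in> \<XX>" "Z \<in> \<XX>" shows "endomorphism_field A (\<lambda>X. K X Y Z)"
  unfolding K_def using assms by (intro endo_add endo_diff R_endo1 g_rank_one' scale_endo g_smooth)

section \<open>Ricci and star-Ricci traces\<close>

definition tK :: "'a bilinear_field" where "tK X Y = trace_field A (\<lambda>Z. K Z X Y)"

lemma tK_ricci:
  assumes X: "X \<in> \<XX>" and Y: "Y \<in> \<XX>"
  shows "tK X Y q = ricci A D X Y q + (real DIM('b) - 1) * g X Y q"
proof -
  have 1: "endomorphism_field A (\<lambda>Z. R Z X Y)" by (rule R_endo1[OF X Y])
  have 2: "endomorphism_field A (\<lambda>Z. g X Y \<cdot>\<^sub>F Z)" by (rule scale_endo[OF g_smooth[OF X Y]])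
  have 3: "endomorphism_field A (\<lambda>Z. g Z Y \<cdot>\<^sub>F X)" by (rule g_rank_one'[OF Y X])
  have "trace_field A (\<lambda>Z. g Z Y \<cdot>\<^sub>F X) q = trace_field A (\<lambda>Z. g Y Z \<cdot>\<^sub>F X) q"
    by (rule trace_cong[OF 3 g_rank_one[OF Y X]]) (simp add: g_sym Y)
  then have "trace_field A (\<lambda>Z. g Z Y \<cdot>\<^sub>F X) q = g X Y q"
    using trace_rank_one[OF g_form[OF Y] X, of q] g_sym[OF X Y] by simp
  then show ?thesis
    unfolding tK_def K_def ricci_def trace_diff[OF endo_add[OF 1 2] 3] trace_add[OF 1 2]
      trace_scale[OF endo_id g_smooth[OF X Y]] trace_id by (simp add: algebra_simps)
qed

text \<open>By the Bianchi identity the difference of the two sides is minus the trace of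
  \<open>K X Y\<close>, a skew endomorphism.\<close>

lemma tK_sym:
  assumes X: "X \<in> \<XX>" and Y: "Y \<in> \<XX>"
  shows "tK X Y q = tK Y X q"
proof -
  have "tK X Y q - tK Y X q = trace_field A (\<lambda>Z. K Z X Y - K Z Y X) q"
    unfolding tK_def by (rule trace_diff[symmetric]) (intro K_endo1 X Y)+
  also have "\<dots> = trace_field A (\<lambda>Z. - K X Y Z) q"
  proof (rule trace_cong[OF endo_diff[OF K_endo1[OF X Y] K_endo1[OF Y X]] endo_minus[OF K_endo3[OF X Y]]])
    fix Z assume Z: "Z \<in> \<XX>"
    show "K Z X Y - K Z Y X = - K X Y Z"
      using K_bianchi[OF X Y Z] K_skew[OF Y Z X] by (simp add: algebra_simps eq_neg_iff_add_eq_0)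
  qed
  also have "\<dots> = - trace_field A (\<lambda>Z. K X Y Z) q"
    by (rule trace_minus[OF K_endo3[OF X Y]])
  also have "trace_field A (\<lambda>Z. K X Y Z) q = 0"
  proof (rule trace_skew[OF metric K_endo3[OF X Y]])
    fix Z assume Z: "Z \<in> \<XX>"
    show "g Z (K X Y Z) q = 0"
      using K_metric_skew[OF X Y Z Z, of q] g_sym[OF Z K_field[OF X Y Z]] by simp
  qed
  finally show ?thesis by simp
qed

abbreviation "S' \<equiv> star_ricci A D \<phi>"

lemma star_endo:
  assumes X: "X \<in> \<XX>" and Y: "Y \<in> \<XX>" shows "endomorphism_field A (\<lambda>Z. \<phi> (R X (\<phi> Y) Z))"
  by (rule endo_comp[OF phi_endo R_endo3[OF X phi_field[OF Y]]])

lemma star_ricci_trace: "2 * S' X Y q = trace_field A (\<lambda>Z. \<phi> (R X (\<phi> Y) Z)) q"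
  by (simp add: star_ricci_def)

text \<open>The tensor \<open>K\<close>, the difference between the curvature of \<open>g\<close> and that of a metric of constant
  curvature \<open>-1\<close>, has the symmetries of a Kaehler curvature tensor, for which Ricci and
  \<open>*\<close>-Ricci traces agree.\<close>

lemma star_ricci_ricci:
  assumes X: "X \<in> \<XX>" and Y: "Y \<in> \<XX>"
  shows "S' X Y q + \<gamma> X Y q = ricci A D X Y q + (real DIM('b) - 1) * g X Y q"
proof -
  have Y': "\<phi> Y \<in> \<XX>" and X': "\<phi> X \<in> \<XX>" and Y'': "\<phi> (\<phi> Y) \<in> \<XX>" using X Y by (simp_all add: closures)
  have 1: "endomorphism_field A (\<lambda>Z. \<phi> (K X (\<phi> Y) Z))" by (rule endo_comp[OF phi_endo K_endo3[OF X Y']])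
  note e2 = g_rank_one[OF Y' X'] and e3 = g_rank_one[OF X Y'']
  have "trace_field A (\<lambda>Z. \<phi> (K X (\<phi> Y) Z)) q =
      trace_field A (\<lambda>Z. \<phi> (R X (\<phi> Y) Z) + g (\<phi> Y) Z \<cdot>\<^sub>F \<phi> X - g X Z \<cdot>\<^sub>F \<phi> (\<phi> Y)) q"
    by (rule trace_cong[OF 1 endo_diff[OF endo_add[OF star_endo[OF X Y] e2] e3]])
      (use X Y in \<open>simp add: K_def phi_rules closures R_field\<close>)
  also have "\<dots> = 2 * S' X Y q + g (\<phi> Y) (\<phi> X) q - g X (\<phi> (\<phi> Y)) q"
    unfolding trace_diff[OF endo_add[OF star_endo[OF X Y] e2] e3] trace_add[OF star_endo[OF X Y] e2]
      trace_rank_one[OF g_form[OF Y'] X'] trace_rank_one[OF g_form[OF X] Y''] star_ricci_trace ..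
  \<comment> \<open>Each of the two rank-one corrections contributes one \<gamma>.\<close>
  also have "\<dots> = 2 * (S' X Y q + \<gamma> X Y q)"
    using X Y g_sym[of X Y] by (simp add: metric_phi phi_phi g_rules closures eta_g) (simp add: fun_scale_def \<gamma>_def)
  finally have left: "trace_field A (\<lambda>Z. \<phi> (K X (\<phi> Y) Z)) q = 2 * (S' X Y q + \<gamma> X Y q)" .
  let ?N = "\<lambda>Z. K Z X Y"
  note N = K_endo1[OF X Y]
  note N\<phi> = endo_comp[OF N phi_endo]
  \<comment> \<open>The Bianchi identity splits the endomorphism in two; each piece contributes one
    Ricci trace, which matches the factor 1/2 in \<open>star_ricci\<close>.\<close>
  have "trace_field A (\<lambda>Z. \<phi> (K X (\<phi> Y) Z)) q = trace_field A (\<lambda>Z. K Z Y X - \<phi> (K (\<phi> Z) X Y)) q"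
  proof (rule trace_cong[OF 1 endo_diff[OF K_endo1[OF Y X] endo_comp[OF phi_endo N\<phi>]]])
    fix Z assume Z: "Z \<in> \<XX>"
    have "\<phi> (K X (\<phi> Y) Z) = K X (\<phi> Y) (\<phi> Z)" by (rule K_phi[OF X Y' Z, symmetric])
    also have "\<dots> = - K (\<phi> Y) (\<phi> Z) X - K (\<phi> Z) X (\<phi> Y)"
      using K_bianchi[OF X Y' phi_field[OF Z]] by (simp add: algebra_simps eq_neg_iff_add_eq_0)
    also have "\<dots> = K Z Y X - \<phi> (K (\<phi> Z) X Y)"
      unfolding K_phi_phi[OF Y Z X] K_phi[OF phi_field[OF Z] X Y] using K_skew[OF Y Z X] by simp
    finally show "\<phi> (K X (\<phi> Y) Z) = K Z Y X - \<phi> (K (\<phi> Z) X Y)" .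
  qed
  also have "\<dots> = tK Y X q - trace_field A (\<lambda>Z. \<phi> (K (\<phi> Z) X Y)) q"
    unfolding tK_def by (rule trace_diff[OF K_endo1[OF Y X] endo_comp[OF phi_endo N\<phi>]])
  \<comment> \<open>Cyclicity brings the two \<phi> together. Their square is minus the identity up
    to a multiple of \<xi>, on which \<open>K\<close> vanishes.\<close>
  also have "trace_field A (\<lambda>Z. \<phi> (K (\<phi> Z) X Y)) q = trace_field A (\<lambda>Z. K (\<phi> (\<phi> Z)) X Y) q"
    by (rule trace_commute[OF phi_endo N\<phi>])
  also have "\<dots> = trace_field A (\<lambda>Z. - K Z X Y) q"
  proof (rule trace_cong[OF endo_comp[OF N\<phi> phi_endo] endo_minus[OF N]])
    fix Z assume Z: "Z \<in> \<XX>"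
    have "K (- Z + \<eta> Z \<cdot>\<^sub>F \<xi>) X Y = - K Z X Y + \<eta> Z \<cdot>\<^sub>F K \<xi> X Y"
      using function_linear_add[OF endomorphismD(2)[OF N], of "- Z" "\<eta> Z \<cdot>\<^sub>F \<xi>"] Z
        function_linear_minus[OF endomorphismD(2)[OF N] Z]
        function_linear_scale[OF endomorphismD(2)[OF N] eta_smooth[OF Z] xi_field]
      by (simp only: closures)
    then show "K (\<phi> (\<phi> Z)) X Y = - K Z X Y"
      unfolding phi_phi[OF Z] K_xi1[OF X Y] by (simp add: fun_scale_def scaleR_fun_def zero_fun_def fun_eq_iff)
  qed
  also have "\<dots> = - tK X Y q"
    unfolding tK_def by (rule trace_minus[OF N])
  finally have "2 * (S' X Y q + \<gamma> X Y q) = 2 * tK X Y q"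
    using left tK_sym[OF X Y] by simp
  then show ?thesis using tK_ricci[OF X Y] by simp
qed

end


section \<open>Lie derivatives along the Reeb field\<close>

text \<open>Jacobi writes the bracket with \<open>lie_bracket V U\<close> as a difference, which is
  the form in which additivity of \<open>G\<close> is assumed; the mixed terms cancel in
  pairs.\<close>

lemma (in smooth_manifold) lie_derivative_bilinear_commutator:
  assumes V: "V \<in> \<XX>" and U: "U \<in> \<XX>" and X: "X \<in> \<XX>" and Y: "Y \<in> \<XX>"
    and smooth: "\<And>X Y. X \<in> \<XX> \<Longrightarrow> Y \<in> \<XX> \<Longrightarrow> G X Y \<in> C"
    and left: "\<And>X Y Z. X \<in> \<XX> \<Longrightarrow> Y \<in> \<XX> \<Longrightarrow> Z \<in> \<XX> \<Longrightarrow> G (X - Y) Z = G X Z - G Y Z"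
    and right: "\<And>X Y Z. X \<in> \<XX> \<Longrightarrow> Y \<in> \<XX> \<Longrightarrow> Z \<in> \<XX> \<Longrightarrow> G Z (X - Y) = G Z X - G Z Y"
  shows "lie_derivative_bilinear V (lie_derivative_bilinear U G) X Y q
      - lie_derivative_bilinear U (lie_derivative_bilinear V G) X Y q
    = lie_derivative_bilinear (lie_bracket V U) G X Y q"
proof -
  have second: "S q (lie_derivative_bilinear T G X Y) =
      S q (apply_field T (G X Y)) - S q (G (lie_bracket T X) Y) - S q (G X (lie_bracket T Y))"
    if S: "S \<in> \<XX>" and T: "T \<in> \<XX>" for S T
  proof -
    have "S q (\<lambda>r. (apply_field T (G X Y) r - G (lie_bracket T X) Y r) - G X (lie_bracket T Y) r) =
        S q (apply_field T (G X Y)) - S q (G (lie_bracket T X) Y) - S q (G X (lie_bracket T Y))"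
      using T X Y
      by (simp add: tangent_diff[OF vector_fieldD(1)[OF S]] smooth apply_field_smooth lie_bracket_field smooth_diff)
    then show ?thesis by (simp add: lie_derivative_bilinear_def fun_diff_def)
  qed
  have "lie_bracket (lie_bracket V U) Z =
      lie_bracket V (lie_bracket U Z) - lie_bracket U (lie_bracket V Z)" if "Z \<in> \<XX>" for Z
    using jacobi[OF V U that] by simp
  then show ?thesis
    using assms
    by (simp add: lie_derivative_bilinear_def[of V "lie_derivative_bilinear U G"]
        lie_derivative_bilinear_def[of U "lie_derivative_bilinear V G"] apply_field_at second)
      (simp add: lie_derivative_bilinear_def apply_field_at left right lie_bracket_field
        lie_bracket_def[of V U])
qed

context kenmotsu_manifold
begin

lemma gamma_smooth: "X \<in> \<XX> \<Longrightarrow> Y \<in> \<XX> \<Longrightarrow> \<gamma> X Y \<in> C"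
  unfolding \<gamma>_def by (intro smooth_diff smooth_mult g_smooth eta_smooth)

lemma gamma_form: assumes X: "X \<in> \<XX>" shows "one_form A (\<gamma> X)"
  unfolding one_form_def
proof (intro conjI ballI function_linearI)
  show "\<gamma> X (Y + Z) q = \<gamma> X Y q + \<gamma> X Z q" if "Y \<in> \<XX>" "Z \<in> \<XX>" for Y Z q
    using that X by (simp add: \<gamma>_def g_rules eta_rules algebra_simps)
  show "\<gamma> X (f \<cdot>\<^sub>F Z) q = f q *\<^sub>R \<gamma> X Z q" if "f \<in> C" "Z \<in> \<XX>" for f Z q
    using that X by (simp add: \<gamma>_def g_rules eta_rules) (simp add: fun_scale_def algebra_simps)
qed (use X gamma_smooth in auto)

lemma gamma_sym: "X \<in> \<XX> \<Longrightarrow> Y \<in> \<XX> \<Longrightarrow> \<gamma> X Y = \<gamma> Y X"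
  by (simp add: \<gamma>_def g_sym[of X Y] mult.commute)

lemma gamma_rules:
  assumes "X \<in> \<XX>" "Y \<in> \<XX>" "Z \<in> \<XX>"
  shows "\<gamma> (X - Y) Z q = \<gamma> X Z q - \<gamma> Y Z q" "\<gamma> (X + Y) Z q = \<gamma> X Z q + \<gamma> Y Z q"
    "\<gamma> Z (X - Y) q = \<gamma> Z X q - \<gamma> Z Y q" "\<gamma> Z (X + Y) q = \<gamma> Z X q + \<gamma> Z Y q"
    "f \<in> C \<Longrightarrow> \<gamma> (f \<cdot>\<^sub>F X) Y q = f q * \<gamma> X Y q" "f \<in> C \<Longrightarrow> \<gamma> X (f \<cdot>\<^sub>F Y) q = f q * \<gamma> X Y q"
  using assms by (simp_all add: \<gamma>_def g_rules eta_rules algebra_simps) (simp_all add: fun_scale_def algebra_simps)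

lemma gamma_xi: "X \<in> \<XX> \<Longrightarrow> \<gamma> X \<xi> = 0" "X \<in> \<XX> \<Longrightarrow> \<gamma> \<xi> X = 0"
  by (auto simp: \<gamma>_def eta_g eta_g' eta_xi)

lemma deriv_gamma:
  assumes X: "X \<in> \<XX>" and Y: "Y \<in> \<XX>" and Z: "Z \<in> \<XX>"
  shows "apply_field X (\<gamma> Y Z) q =
    \<gamma> (D X Y) Z q + \<gamma> Y (D X Z) q - \<gamma> X Y q * \<eta> Z q - \<eta> Y q * \<gamma> X Z q"
proof -
  note T = vector_fieldD(1)[OF X]
  have "apply_field X (\<gamma> Y Z) q = X q (g Y Z) - (\<eta> Y q * X q (\<eta> Z) + \<eta> Z q * X q (\<eta> Y))"
    unfolding \<gamma>_def apply_field_at using Y Z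
    by (simp add: tangent_diff[OF T] tangent_mult[OF T] closures smooth_mult)
  also have "\<dots> = g (D X Y) Z q + g Y (D X Z) q
      - (\<eta> Y q * (\<eta> (D X Z) q + \<gamma> X Z q) + \<eta> Z q * (\<eta> (D X Y) q + \<gamma> X Y q))"
    using X Y Z by (simp add: metric_compatible deriv_eta flip: apply_field_at)
  finally show ?thesis by (simp add: \<gamma>_def algebra_simps)
qed

lemma xi_bracket: "X \<in> \<XX> \<Longrightarrow> lie_bracket \<xi> X = D \<xi> X - X + \<eta> X \<cdot>\<^sub>F \<xi>"
  by (simp add: torsion_free closures D_xi)

text \<open>By \<open>D_phi\<close> and \<open>phi_xi\<close>, \<phi> is parallel along \<xi>, and
  the remaining part of \<open>xi_bracket\<close> commutes with \<phi>; so the Lie derivative of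
  \<phi> along \<xi> is 0.\<close>

lemma xi_phi: "X \<in> \<XX> \<Longrightarrow> lie_bracket \<xi> (\<phi> X) = \<phi> (lie_bracket \<xi> X)"
  by (simp add: xi_bracket closures D_phi phi_rules phi_xi eta_phi g_rules)
    (simp add: fun_ops fun_eq_iff)

text \<open>A form of \<open>R_xi1\<close>: replacing the derivatives along \<xi> by brackets
  through \<open>xi_bracket\<close> exhibits the Lie derivative of the connection as
  \<open>- 2\<gamma> \<otimes> \<xi>\<close>. The factor 2 is a repeated term, which the additive
  rules handle.\<close>

lemma xi_D:
  assumes X: "X \<in> \<XX>" and Y: "Y \<in> \<XX>"
  shows "lie_bracket \<xi> (D X Y) =
    D (lie_bracket \<xi> X) Y + D X (lie_bracket \<xi> Y) - \<gamma> X Y \<cdot>\<^sub>F \<xi> - \<gamma> X Y \<cdot>\<^sub>F \<xi>"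
  using R_xi1[OF X Y] X Y unfolding curvature_def
  by (simp add: xi_bracket closures D_rules D_xi deriv_eta)
    (simp add: fun_ops fun_eq_iff \<gamma>_def algebra_simps)

text \<open>The curvature varies by the antisymmetrised covariant derivative of the variation of the
  connection. Differentiating \<xi> in \<open>- 2\<gamma> \<otimes> \<xi>\<close> gives the terms
  along \<open>X\<close> and \<open>Y\<close>; all multiples of \<xi> cancel by
  \<open>deriv_gamma\<close>.\<close>

lemma xi_R:
  assumes X: "X \<in> \<XX>" and Y: "Y \<in> \<XX>" and Z: "Z \<in> \<XX>"
  shows "lie_bracket \<xi> (R X Y Z) =
    R (lie_bracket \<xi> X) Y Z + R X (lie_bracket \<xi> Y) Z + R X Y (lie_bracket \<xi> Z)
    + (\<lambda>_. 2) \<cdot>\<^sub>F \<gamma> X Z \<cdot>\<^sub>F Y - (\<lambda>_. 2) \<cdot>\<^sub>F \<gamma> Y Z \<cdot>\<^sub>F X"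
proof -
  define a b c where "a = lie_bracket \<xi> X" "b = lie_bracket \<xi> Y" "c = lie_bracket \<xi> Z"
  have abc: "a \<in> \<XX>" "b \<in> \<XX>" "c \<in> \<XX>" using X Y Z by (auto simp: a_b_c_def closures)
  have XY: "lie_bracket X Y \<in> \<XX>" using X Y by (simp add: closures)
  have second: "lie_bracket \<xi> (D U (D W Z)) = D (lie_bracket \<xi> U) (D W Z) + D U (D (lie_bracket \<xi> W) Z)
      + D U (D W c) - apply_field U (\<gamma> W Z) \<cdot>\<^sub>F \<xi> - \<gamma> W Z \<cdot>\<^sub>F (U - \<eta> U \<cdot>\<^sub>F \<xi>)
      - apply_field U (\<gamma> W Z) \<cdot>\<^sub>F \<xi> - \<gamma> W Z \<cdot>\<^sub>F (U - \<eta> U \<cdot>\<^sub>F \<xi>)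
      - \<gamma> U (D W Z) \<cdot>\<^sub>F \<xi> - \<gamma> U (D W Z) \<cdot>\<^sub>F \<xi>" if "U \<in> \<XX>" "W \<in> \<XX>" for U W
    unfolding xi_D[OF that(1) D_field[OF that(2) Z]] xi_D[OF that(2) Z] a_b_c_def(3)[symmetric]
    using that Z abc
    by (simp only: D_rules D_xi closures gamma_smooth) (simp add: algebra_simps)
  have "lie_bracket \<xi> (lie_bracket X Y) = lie_bracket a Y + lie_bracket X b"
    using jacobi[OF xi_field X Y] by (simp add: a_b_c_def algebra_simps)
  then have third: "lie_bracket \<xi> (D (lie_bracket X Y) Z) = D (lie_bracket a Y) Z + D (lie_bracket X b) Z
      + D (lie_bracket X Y) c - \<gamma> (lie_bracket X Y) Z \<cdot>\<^sub>F \<xi> - \<gamma> (lie_bracket X Y) Z \<cdot>\<^sub>F \<xi>"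
    unfolding xi_D[OF XY Z] using X Y Z abc by (simp add: D_rules closures flip: a_b_c_def(3))
  have gXY: "\<gamma> (lie_bracket X Y) Z q = \<gamma> (D X Y) Z q - \<gamma> (D Y X) Z q" for q
    using X Y Z by (simp add: torsion_free gamma_rules closures)
  have "lie_bracket \<xi> (R X Y Z) =
      lie_bracket \<xi> (D X (D Y Z)) - lie_bracket \<xi> (D Y (D X Z)) - lie_bracket \<xi> (D (lie_bracket X Y) Z)"
    unfolding curvature_def using X Y Z by (simp add: lie_bracket_diff closures)
  then show ?thesis
    unfolding second[OF X Y] second[OF Y X] third curvature_def a_b_c_def[symmetric]
    using deriv_gamma[OF X Y Z] deriv_gamma[OF Y X Z] gXY gamma_sym[OF X Y]
    by (simp add: fun_ops fun_eq_iff algebra_simps)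
qed

text \<open>Since the bracket with \<xi> commutes with \<phi>, only the extra terms of
  \<open>xi_R\<close> go beyond the Leibniz rule. Under the trace each of them gives
  \<open>- 2\<gamma>\<close>, and the factor 1/2 in \<open>star_ricci\<close> halves their sum.
  Smoothness of \<open>S' X Y\<close> lets \<open>trace_derivative\<close> apply.\<close>

lemma xi_star_ricci:
  assumes X: "X \<in> \<XX>" and Y: "Y \<in> \<XX>" and smooth: "S' X Y \<in> C"
  shows "\<xi> q (S' X Y) = S' (lie_bracket \<xi> X) Y q + S' X (lie_bracket \<xi> Y) q - 2 * \<gamma> X Y q"
proof -
  let ?a = "lie_bracket \<xi> X" and ?b = "lie_bracket \<xi> Y"
  have F: "?a \<in> \<XX>" "?b \<in> \<XX>" "\<phi> Y \<in> \<XX>" "\<phi> X \<in> \<XX>" "\<phi> (\<phi> Y) \<in> \<XX>"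
    using X Y by (simp_all add: closures)
  let ?M = "\<lambda>Z. \<phi> (R X (\<phi> Y) Z)"
  have M: "endomorphism_field A ?M" by (rule star_endo[OF X Y])
  have t: "trace_field A ?M = (\<lambda>q. 2 * S' X Y q)" using star_ricci_trace by auto
  have tS: "trace_field A ?M \<in> C" unfolding t by (rule smooth_cmult[OF smooth])
  note e1 = star_endo[OF F(1) Y] and e2 = star_endo[OF X F(2)]
  have r1: "endomorphism_field A (\<lambda>Z. \<gamma> X Z \<cdot>\<^sub>F \<phi> (\<phi> Y))"
    and r2: "endomorphism_field A (\<lambda>Z. \<gamma> (\<phi> Y) Z \<cdot>\<^sub>F \<phi> X)"
    using X F by (auto intro!: endo_rank_one gamma_form)
  note e3 = endo_scale[OF smooth_const[of 2] r1] and e4 = endo_scale[OF smooth_const[of 2] r2]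
  have "2 * \<xi> q (S' X Y) = \<xi> q (trace_field A ?M)"
    unfolding t using tangent_cmult[OF vector_fieldD(1)[OF xi_field] smooth] by simp
  also have "\<dots> = trace_field A (\<lambda>Z. lie_bracket \<xi> (?M Z) - ?M (lie_bracket \<xi> Z)) q"
    by (rule trace_derivative[OF xi_field M tS])
  also have "\<dots> = trace_field A (\<lambda>Z. \<phi> (R ?a (\<phi> Y) Z) + \<phi> (R X (\<phi> ?b) Z)
      + (\<lambda>_. 2) \<cdot>\<^sub>F \<gamma> X Z \<cdot>\<^sub>F \<phi> (\<phi> Y) - (\<lambda>_. 2) \<cdot>\<^sub>F \<gamma> (\<phi> Y) Z \<cdot>\<^sub>F \<phi> X) q"
  proof (rule trace_cong[OF lie_derivative_endo[OF xi_field M] endo_diff[OF endo_add[OF endo_add[OF e1 e2] e3] e4]])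
    fix Z assume Z: "Z \<in> \<XX>"
    have "lie_bracket \<xi> (?M Z) = \<phi> (R ?a (\<phi> Y) Z + R X (\<phi> ?b) Z + R X (\<phi> Y) (lie_bracket \<xi> Z)
        + (\<lambda>_. 2) \<cdot>\<^sub>F \<gamma> X Z \<cdot>\<^sub>F \<phi> Y - (\<lambda>_. 2) \<cdot>\<^sub>F \<gamma> (\<phi> Y) Z \<cdot>\<^sub>F X)"
      unfolding xi_phi[OF R_field[OF X F(3) Z]] xi_R[OF X F(3) Z] xi_phi[OF Y] ..
    then show "lie_bracket \<xi> (?M Z) - ?M (lie_bracket \<xi> Z) = \<phi> (R ?a (\<phi> Y) Z) + \<phi> (R X (\<phi> ?b) Z)
      + (\<lambda>_. 2) \<cdot>\<^sub>F \<gamma> X Z \<cdot>\<^sub>F \<phi> (\<phi> Y) - (\<lambda>_. 2) \<cdot>\<^sub>F \<gamma> (\<phi> Y) Z \<cdot>\<^sub>F \<phi> X"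
      using X F Z by (simp add: phi_rules closures R_field gamma_smooth)
  qed
  also have "\<dots> = 2 * S' ?a Y q + 2 * S' X ?b q + 2 * \<gamma> X (\<phi> (\<phi> Y)) q - 2 * \<gamma> (\<phi> Y) (\<phi> X) q"
    unfolding trace_diff[OF endo_add[OF endo_add[OF e1 e2] e3] e4] trace_add[OF endo_add[OF e1 e2] e3]
      trace_add[OF e1 e2] trace_scale[OF r1 smooth_const] trace_scale[OF r2 smooth_const]
      trace_rank_one[OF gamma_form[OF X] F(5)] trace_rank_one[OF gamma_form[OF F(3)] F(4)] star_ricci_trace ..
  also have "\<gamma> (\<phi> Y) (\<phi> X) q = \<gamma> X Y q"
    using X Y g_sym[OF X Y] by (simp add: \<gamma>_def metric_phi eta_phi)
  also have "\<gamma> X (\<phi> (\<phi> Y)) q = - \<gamma> X Y q"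
  proof -
    have "\<gamma> X (\<phi> (\<phi> Y)) q = g X (\<phi> (\<phi> Y)) q" using Y by (simp add: \<gamma>_def eta_phi closures)
    also have "\<dots> = - \<gamma> X Y q"
      unfolding phi_phi[OF Y] using X Y by (simp add: g_rules closures eta_g) (simp add: fun_scale_def \<gamma>_def)
    finally show ?thesis .
  qed
  finally show ?thesis by simp
qed

text \<open>If \<gamma> vanished, every field would equal its \<xi>-component, and the identity
  would have trace 1.\<close>

lemma gamma_nonzero:
  assumes "DIM('b) \<noteq> 1"
  obtains X Y q where "X \<in> \<XX>" "Y \<in> \<XX>" "\<gamma> X Y q \<noteq> 0"
proof (rule ccontr)
  assume no: "\<not> thesis"
  note witness = that
  have 0: "\<gamma> X Y q = 0" if "X \<in> \<XX>" "Y \<in> \<XX>" for X Y q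
    using witness[OF that] no by blast
  have "Z = \<eta> Z \<cdot>\<^sub>F \<xi>" if Z: "Z \<in> \<XX>" for Z
  proof (rule nondegenerate)
    fix W q assume W: "W \<in> \<XX>"
    show "g Z W q = g (\<eta> Z \<cdot>\<^sub>F \<xi>) W q"
      using 0[OF Z W, of q] Z W by (simp add: g_rules closures eta_g') (simp add: fun_scale_def \<gamma>_def)
  qed (use Z in \<open>simp_all add: closures\<close>)
  then have "trace_field A (\<lambda>Z. Z) q = trace_field A (\<lambda>Z. \<eta> Z \<cdot>\<^sub>F \<xi>) q" for q
    by (intro trace_cong endo_id endo_rank_one eta_form xi_field)
  then show False
    using assms by (simp add: trace_id trace_rank_one[OF eta_form xi_field] eta_xi)
qed

lemma xi_metric:
  assumes "X \<in> \<XX>" "Y \<in> \<XX>"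
  shows "lie_derivative_bilinear \<xi> g X Y = (\<lambda>q. 2 * \<gamma> X Y q)"
  unfolding lie_derivative_bilinear_def using assms
  by (simp add: xi_bracket metric_compatible closures g_rules eta_g eta_g')
    (simp add: fun_ops fun_eq_iff \<gamma>_def algebra_simps)

lemma xi_gamma:
  assumes "X \<in> \<XX>" "Y \<in> \<XX>"
  shows "\<xi> q (\<gamma> X Y) = \<gamma> (lie_bracket \<xi> X) Y q + \<gamma> X (lie_bracket \<xi> Y) q + 2 * \<gamma> X Y q"
  using deriv_gamma[OF xi_field assms, of q] assms
  by (simp add: xi_bracket gamma_rules closures gamma_xi apply_field_at)

lemma xi_eta: "X \<in> \<XX> \<Longrightarrow> \<xi> q (\<eta> X) = \<eta> (lie_bracket \<xi> X) q"
  using deriv_eta[OF xi_field, of X, THEN fun_cong, of q]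
  by (simp add: xi_bracket eta_rules closures gamma_xi apply_field_at) (simp add: fun_scale_def eta_xi)

lemma star_ricci_xi:
  assumes X: "X \<in> \<XX>" shows "S' X \<xi> q = 0"
proof -
  have "trace_field A (\<lambda>Z. \<phi> (R X (\<phi> \<xi>) Z)) q = trace_field A (\<lambda>Z. (\<lambda>_. 0) \<cdot>\<^sub>F Z) q"
  proof (rule trace_cong[OF star_endo[OF X xi_field] scale_endo[OF smooth_const]])
    fix Z assume Z: "Z \<in> \<XX>"
    have "R X 0 Z = 0"
      using R_skew[OF X field_zero Z] function_linear_zero[OF endomorphismD(2)[OF R_endo1[OF X Z]]] by simp
    then show "\<phi> (R X (\<phi> \<xi>) Z) = (\<lambda>_. 0) \<cdot>\<^sub>F Z"
      by (simp add: phi_xi phi_rules) (simp add: fun_scale_def zero_fun_def)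
  qed
  then show ?thesis
    using star_ricci_trace[of X \<xi> q] trace_scale[OF endo_id smooth_const, of 0 q] by simp
qed


section \<open>Solitons with contact potential field\<close>

context
  fixes V l \<mu> p c F f
  assumes soliton: "star_conformal_eta_ricci_soliton A \<phi> \<eta> g D V l \<mu> p"
    and f: "f \<in> C" "lie_bracket V \<xi> = f \<cdot>\<^sub>F \<xi>"
  defines c_def: "c \<equiv> 2 * l - (p + 2 / real DIM('b))"
    and F_def: "F \<equiv> c / 2 + \<mu>"
begin

lemma V_field: "V \<in> \<XX>"
  using soliton unfolding star_conformal_eta_ricci_soliton_def by simp

abbreviation (input) "T \<equiv> lie_derivative_bilinear V g"

lemma soliton_eq:
  "X \<in> \<XX> \<Longrightarrow> Y \<in> \<XX> \<Longrightarrow> T X Y q + 2 * S' X Y q + c * g X Y q + 2 * \<mu> * (\<eta> X q * \<eta> Y q) = 0"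
  using soliton unfolding star_conformal_eta_ricci_soliton_def c_def by blast

lemma T_smooth:
  assumes "X \<in> \<XX>" "Y \<in> \<XX>" shows "T X Y \<in> C"
  unfolding lie_derivative_bilinear_def using assms V_field by (simp add: closures)

text \<open>The soliton equation expresses this pointwise trace by tensors already known to be
  smooth.\<close>

lemma star_ricci_smooth:
  assumes X: "X \<in> \<XX>" and Y: "Y \<in> \<XX>" shows "S' X Y \<in> C"
proof -
  have "S' X Y = (\<lambda>q. (-1/2) * ((T X Y q + c * g X Y q) + 2 * \<mu> * (\<eta> X q * \<eta> Y q)))"
    using soliton_eq[OF X Y] by (intro ext) (simp add: field_simps, smt (verit))
  also have "\<dots> \<in> C"
    using X Y by (intro smooth_intros T_smooth g_smooth eta_smooth)
  finally show ?thesis .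
qed

lemma T_xi:
  assumes X: "X \<in> \<XX>" shows "T X \<xi> q = - 2 * F * \<eta> X q"
  using soliton_eq[OF X xi_field, of q] star_ricci_xi[OF X, of q] X
  by (simp add: eta_g eta_xi F_def algebra_simps)

text \<open>\<open>g \<xi> \<xi>\<close> is constant, so the Lie derivative of \<open>g\<close> on
  the pair \<xi>, \<xi> sees only the brackets and equals \<open>- 2 * f\<close>.\<close>

lemma f_eq: "f = (\<lambda>_. F)"
proof
  fix q
  have "g \<xi> \<xi> = (\<lambda>_. 1)" using eta_g[OF xi_field] eta_xi by auto
  then have "T \<xi> \<xi> q = - 2 * f q"
    using tangent_const[OF vector_fieldD(1)[OF V_field]] f xi_field
    by (simp add: lie_derivative_bilinear_def apply_field_at g_rules) (simp add: fun_scale_def)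
  then show "f q = F" using T_xi[OF xi_field, of q] by (simp add: eta_xi)
qed

text \<open>With \<xi> inserted, the Lie derivative of \<open>g\<close> is that of \<eta> minus a
  contribution \<open>F \<eta>\<close> from the bracket of \<open>V\<close> and \<xi>; this takes up
  one of the two \<open>F\<close> in \<open>T_xi\<close>.\<close>

lemma V_eta:
  assumes X: "X \<in> \<XX>" shows "V q (\<eta> X) = \<eta> (lie_bracket V X) q - F * \<eta> X q"
proof -
  have "T X \<xi> q = V q (g X \<xi>) - g (lie_bracket V X) \<xi> q - g X (f \<cdot>\<^sub>F \<xi>) q"
    by (simp add: lie_derivative_bilinear_def apply_field_at f(2))
  also have "\<dots> = V q (\<eta> X) - \<eta> (lie_bracket V X) q - F * \<eta> X q"
    using X V_field f(1) by (simp add: eta_g closures g_rules) (simp add: fun_scale_def f_eq)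
  finally show ?thesis using T_xi[OF X, of q] by simp
qed

text \<open>By \<open>xi_metric\<close> the inner derivative is \<open>2\<gamma>\<close>, and by
  \<open>V_eta\<close> the Lie derivative along \<open>V\<close> multiplies \<eta> \<otimes> \<eta>
  by \<open>- 2 * F\<close>.\<close>

lemma V_xi_metric:
  assumes X: "X \<in> \<XX>" and Y: "Y \<in> \<XX>"
  shows "lie_derivative_bilinear V (lie_derivative_bilinear \<xi> g) X Y q =
    2 * (T X Y q + 2 * F * (\<eta> X q * \<eta> Y q))"
proof -
  note V = vector_fieldD(1)[OF V_field]
  have "V q (\<gamma> X Y) = V q (g X Y) - (\<eta> X q * V q (\<eta> Y) + \<eta> Y q * V q (\<eta> X))"
    unfolding \<gamma>_def using X Y
    by (simp add: tangent_diff[OF V] tangent_mult[OF V] closures smooth_mult)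
  then have "V q (\<lambda>q. 2 * \<gamma> X Y q) = 2 * (V q (g X Y) - (\<eta> X q * V q (\<eta> Y) + \<eta> Y q * V q (\<eta> X)))"
    using tangent_cmult[OF V gamma_smooth[OF X Y]] by simp
  then show ?thesis
    using X Y V_field
    by (simp add: lie_derivative_bilinear_def[of V] xi_metric closures apply_field_at V_eta)
      (simp add: \<gamma>_def algebra_simps)
qed

text \<open>In \<open>T = - 2S' - c\<gamma> - (c + 2\<mu>) \<eta> \<otimes> \<eta>\<close> the first
  term yields \<open>4\<gamma>\<close>, the second \<open>- 2c\<gamma>\<close>, and the third
  nothing, because by \<open>xi_eta\<close> the Lie derivative of \<eta> along \<xi> is 0.\<close>

lemma xi_V_metric:
  assumes X: "X \<in> \<XX>" and Y: "Y \<in> \<XX>"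
  shows "lie_derivative_bilinear \<xi> (lie_derivative_bilinear V g) X Y q = (4 - 2 * c) * \<gamma> X Y q"
proof -
  note V = vector_fieldD(1)[OF xi_field]
  have T: "T Z W = (\<lambda>q. (- 2) * S' Z W q + ((- c) * \<gamma> Z W q + (- (c + 2 * \<mu>)) * (\<eta> Z q * \<eta> W q)))"
    if "Z \<in> \<XX>" "W \<in> \<XX>" for Z W
    using soliton_eq[OF that] by (intro ext) (simp add: \<gamma>_def algebra_simps, smt (verit))
  have "\<xi> q (T X Y) = - 2 * \<xi> q (S' X Y) - c * \<xi> q (\<gamma> X Y)
      - (c + 2 * \<mu>) * (\<eta> X q * \<xi> q (\<eta> Y) + \<eta> Y q * \<xi> q (\<eta> X))"
  proof -
    note s1 = star_ricci_smooth[OF X Y] and s2 = gamma_smooth[OF X Y]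
      and s3 = smooth_mult[OF eta_smooth[OF X] eta_smooth[OF Y]]
    show ?thesis
      unfolding T[OF X Y]
        tangent_add[OF V smooth_cmult[OF s1] smooth_add[OF smooth_cmult[OF s2] smooth_cmult[OF s3]]]
        tangent_add[OF V smooth_cmult[OF s2] smooth_cmult[OF s3]]
        tangent_cmult[OF V s1] tangent_cmult[OF V s2] tangent_cmult[OF V s3]
        tangent_mult[OF V eta_smooth[OF X] eta_smooth[OF Y]]
      by (simp add: algebra_simps)
  qed
  then show ?thesis
    unfolding lie_derivative_bilinear_def[of \<xi>] using X Y
    by (simp add: apply_field_at T closures xi_star_ricci star_ricci_smooth xi_gamma xi_eta)
      (simp add: algebra_simps)
qed

text \<open>Since \<open>f\<close> is constant by \<open>f_eq\<close>, scaling \<xi> by it scales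
  the Lie derivative without extra terms.\<close>

lemma xi_scaled_metric:
  assumes X: "X \<in> \<XX>" and Y: "Y \<in> \<XX>"
  shows "lie_derivative_bilinear (lie_bracket V \<xi>) g X Y q = 2 * F * \<gamma> X Y q"
proof -
  have b: "lie_bracket (f \<cdot>\<^sub>F \<xi>) Z = f \<cdot>\<^sub>F lie_bracket \<xi> Z" if Z: "Z \<in> \<XX>" for Z
    using lie_bracket_skew[of "f \<cdot>\<^sub>F \<xi>" Z] lie_bracket_scale[OF Z xi_field f(1)]
      tangent_const[OF vector_fieldD(1)[OF Z]] lie_bracket_skew[of \<xi> Z]
    by (simp add: f_eq apply_field_def fun_ops fun_eq_iff)
  have "lie_derivative_bilinear (f \<cdot>\<^sub>F \<xi>) g X Y q = F * lie_derivative_bilinear \<xi> g X Y q"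
    using X Y f(1) unfolding lie_derivative_bilinear_def
    by (simp add: b g_rules closures) (simp add: fun_ops apply_field_def f_eq algebra_simps)
  then show ?thesis unfolding f(2) xi_metric[OF X Y] by simp
qed

lemma star_ricci_gamma:
  assumes X: "X \<in> \<XX>" and Y: "Y \<in> \<XX>"
  shows "S' X Y q = - (F / 2 + 1) * \<gamma> X Y q"
proof -
  have "2 * (T X Y q + 2 * F * (\<eta> X q * \<eta> Y q)) - (4 - 2 * c) * \<gamma> X Y q = 2 * F * \<gamma> X Y q"
    using lie_derivative_bilinear_commutator[OF V_field xi_field X Y, of g q]
    unfolding V_xi_metric[OF X Y] xi_V_metric[OF X Y] xi_scaled_metric[OF X Y]
    by (simp add: g_smooth g_rules)
  moreover have "g X Y q = \<gamma> X Y q + \<eta> X q * \<eta> Y q" by (simp add: \<gamma>_def)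
  \<comment> \<open>This cancels the \<eta> \<otimes> \<eta> terms, so that \<open>S'\<close> is
    left against \<gamma> alone.\<close>
  moreover have "2 * F = c + 2 * \<mu>" by (simp add: F_def)
  ultimately have "2 * S' X Y q = - (F + 2) * \<gamma> X Y q"
    using soliton_eq[OF X Y, of q] by algebra
  then show ?thesis by (simp add: field_simps)
qed

lemma F_zero:
  assumes "DIM('b) \<noteq> 1" shows "F = 0"
proof -
  obtain X Y q where XY: "X \<in> \<XX>" "Y \<in> \<XX>" "\<gamma> X Y q \<noteq> 0"
    using gamma_nonzero[OF assms] by blast
  have "S' X Y = (\<lambda>q. - (F / 2 + 1) * \<gamma> X Y q)"
    using star_ricci_gamma XY by auto
  then have "\<xi> q (S' X Y) = - (F / 2 + 1) * \<xi> q (\<gamma> X Y)"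
    using tangent_cmult[OF vector_fieldD(1)[OF xi_field] gamma_smooth[OF XY(1,2)]] by simp
  \<comment> \<open>Beyond the common bracket terms the left-hand side gives
    \<open>- 2\<gamma>\<close> and the right-hand side \<open>- (F + 2) \<gamma>\<close>.\<close>
  then have "F * \<gamma> X Y q = 0"
    using XY by (simp add: xi_star_ricci star_ricci_smooth xi_gamma star_ricci_gamma closures algebra_simps)
  then show ?thesis using XY(3) by simp
qed

lemma strict_and_einstein:
  assumes "DIM('b) \<noteq> 1"
  shows "strict_infinitesimal_contact A \<eta> V \<and> einstein A g D"
proof
  show "strict_infinitesimal_contact A \<eta> V"
    unfolding strict_infinitesimal_contact_def lie_derivative_one_form_def
    using V_field V_eta F_zero[OF assms] by (simp add: apply_field_at)
  \<comment> \<open>With \<open>F = 0\<close> the sum \<open>S' + \<gamma>\<close> in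
    \<open>star_ricci_ricci\<close> vanishes; in dimension \<open>2n+1\<close> the Einstein constant
    is \<open>- 2n\<close>.\<close>
  have "ricci A D X Y q = (1 - real DIM('b)) * g X Y q" if "X \<in> \<XX>" "Y \<in> \<XX>" for X Y q
    using star_ricci_ricci[OF that, of q] star_ricci_gamma[OF that, of q] F_zero[OF assms]
    by (simp add: algebra_simps)
  then show "einstein A g D" unfolding einstein_def by blast
qed

end

end

theorem theorem3p3:
  fixes n :: nat
    and A :: "('a::{t2_space, second_countable_topology}, 'b::euclidean_space) chart set"
    and \<phi> :: "'a vector_field \<Rightarrow> 'a vector_field"
    and \<xi> V :: "'a vector_field"
    and \<eta> :: "'a vector_field \<Rightarrow> 'a \<Rightarrow> real"
    and g :: "'a bilinear_field"
    and D :: "'a connection"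
    and l \<mu> p :: real
  assumes "n \<ge> 1" and "DIM('b) = 2 * n + 1"
    and "kenmotsu A \<phi> \<xi> \<eta> g D"
    and "star_conformal_eta_ricci_soliton A \<phi> \<eta> g D V l \<mu> p"
    and "contact_vector_field A \<xi> V"
  shows "strict_infinitesimal_contact A \<eta> V \<and> einstein A g D"
proof -
  interpret kenmotsu_manifold A \<phi> \<xi> \<eta> g D
    using assms(3) by unfold_locales
  obtain f where "f \<in> C" "lie_bracket V \<xi> = f \<cdot>\<^sub>F \<xi>"
    using assms(5) unfolding contact_vector_field_def by blast
  then show ?thesis
    using strict_and_einstein[OF assms(4)] assms(1,2) by simp
qed

end
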